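(* Let $\epsilon>0$, let $k_0=\lceil \log(1/\epsilon)\rceil+20$, and let $d$ be a positive integer with $d\ge \frac{80000000}{\epsilon^3}$. Consider the randomly sampled and discretized instance of $\textsc{1-in-3-SAT}$ vs $\textsc{NAE-SAT}$ (with negations and constants) described in the context. Then: (1) There is a solution to the basic SDP relaxation of the $\textsc{1-in-3-SAT}$ instance that gives a value of at least $1-\epsilon$ to each constraint that is not discarded. (2) The probability that a sampled constraint is discarded is at most $6e^{-10/\epsilon}$. (3) For every assignment of values in $\{-1,1\}$ to the variables (with the constant $\vec v_0$ assigned $1$ and the constant $-\vec v_0$ assigned $-1$), the probability, over the sampling procedure (discarded constraints included), that the sampled triple is assigned three equal values (i.e. violates the $\textsc{NAE-SAT}$ constraint) is at least $\frac{1}{10^{60}\lceil \log(1/\epsilon)\rceil}$.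
   Context: Work in $\mathbb R^{d+1}$ with $\vec v_0=\vec e_{d+1}$, and identify $\mathbb R^d$ with the orthogonal complement of $\vec v_0$. Write $\mathcal N(0,1/d)^d$ for the distribution of a vector in $\mathbb R^d$ with independent coordinates of mean $0$ and variance $1/d$. For $x\in[-1,1]$, $A'_x$ is the distribution of $x\vec v_0+\sqrt{1-x^2}\,\vec w$ with $\vec w\sim\mathcal N(0,1/d)^d$. For $x\in[0,1)$ let $\rho_x=\frac{\sqrt{1-(2x-1)^2}}{2\sqrt{1-x^2}}$. $T'_x$ is the distribution of triples $(\vec p_1,\vec p_2,\vec p_3)$ obtained by sampling independent $\vec u,\vec w\sim\mathcal N(0,1/d)^d$ and setting $\vec p_3=(1-2x)\vec v_0+\sqrt{1-(2x-1)^2}\,\vec w$, $\vec p_1=x\vec v_0+\sqrt{1-x^2}\,(-\rho_x\vec w+\sqrt{1-\rho_x^2}\,\vec u)$, $\vec p_2=x\vec v_0+\sqrt{1-x^2}\,(-\rho_x\vec w-\sqrt{1-\rho_x^2}\,\vec u)$. $T'_{-x}$ is defined identically, except that the coefficient of $\vec v_0$ is $2x-1$ in $\vec p_3$ and $-x$ in $\vec p_1$ and $\vec p_2$. Sampling procedure. For each $k\in[k_0]$, with $x=1-2^{-k}$, a triple is sampled from $T'_x$ with probability $\frac{1}{2(k_0+1)}$ and from $T'_{-x}$ with probability $\frac{1}{2(k_0+1)}$. Let $x_0=1-2^{-k_0}$. With probability $\frac{1}{2(k_0+1)}$ sample $\vec p\sim A'_{x_0}$ and take the triple $(-\vec v_0,-\vec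 v_0,\vec p)$; with probability $\frac{1}{2(k_0+1)}$ sample $\vec p\sim A'_{-x_0}$ and take $(\vec v_0,\vec v_0,\vec p)$. Discarding. A triple is discarded if the sampled $\vec w$ has $|\|\vec w\|^2-1|>\epsilon/1000$, or if a vector $\vec u$ was sampled and $|\|\vec u\|^2-1|>\epsilon/1000$ or $|\vec w\cdot\vec u|>\epsilon/1000$. Discretization. The set of vectors of $\mathbb R^{d+1}$ of length at most $2$ is partitioned into regions, each with a chosen center within distance $\epsilon/1000$ of all points of the region. The vectors of length greater than $2$ form one further region with an arbitrary chosen center. Every sampled vector other than the constants $\pm\vec v_0$ is replaced by the center of its region. The variables of the instance are the region centers; $\vec v_0$ and $-\vec v_0$ are the constant literals true ($1$) and false ($-1$). Constraints. A triple from $T'_{-x}$, or of the form $(-\vec v_0,-\vec v_0,\vec p)$, carries a $\textsc{1-in-3-SAT}$ constraint on its three entries: exactly one of them equals $1$. A triple from $T'_x$, or of the form $(\vec v_0,\vec v_0,\vec p)$, carries a $\textsc{1-in-3-SAT}$ constraint on the negations of its three entries. The $\textsc{NAE-SAT}$ constraint on a triple requires that its three entries are not all equal. Basic SDP relaxation of the $\textsc{1-in-3-SAT}$ instance. Assign a unit vector to each variable, keep $\vec v_0$ unit, and use $-\vec v$ for a negated literal. A constraint on literals $\ell_1,\ell_2,\ell_3$ with vectors $\vec v_1,\vec v_2,\vec v_3$ gets value $\mu(\text{satisfying assignments})$ for a probability distribution $\mu$ on $\{-1,1\}^3$ satisfying $\mathbb E_\mu[x_i]=\vec v_i\cdot\vec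 v_0$ and $\mathbb E_\mu[x_ix_j]=\vec v_i\cdot\vec v_j$ for all $i\ne j$. *)

theory Defs
  imports "HOL-Probability.Probability"
begin

text \<open>
  The space $R^{d+1}$ is \<^typ>\<open>(real ^ 'n) \<times> real\<close> with \<open>d = CARD('n)\<close>; the last coordinate is the
  direction of \<open>v0\<close>, and \<open>w\<close> in $R^d$ is identified with \<open>(w, 0)\<close>.
\<close>

type_synonym 'n pt = "(real ^ 'n) \<times> real"

definition v0 :: "'n::finite pt" where
  "v0 = (0, 1)"

definition emb :: "real ^ 'n::finite \<Rightarrow> 'n pt" where
  "emb w = (w, 0)"

text \<open>The second argument of \<^const>\<open>normal_density\<close> is the standard deviation, so the variance
  of each coordinate is \<open>1/d\<close>.\<close>

definition gauss :: "(real ^ 'n::finite) measure" where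
  "gauss = distr (\<Pi>\<^sub>M i\<in>(UNIV :: 'n set).
                    density lborel (\<lambda>t. ennreal (normal_density 0 (1 / sqrt (real CARD('n))) t)))
             borel (\<lambda>w. \<chi> i. w i)"

definition A_vec :: "real \<Rightarrow> real ^ 'n::finite \<Rightarrow> 'n pt" where
  "A_vec x w = x *\<^sub>R v0 + sqrt (1 - x\<^sup>2) *\<^sub>R emb w"

definition rho :: "real \<Rightarrow> real" where
  "rho x = sqrt (1 - (2 * x - 1)\<^sup>2) / (2 * sqrt (1 - x\<^sup>2))"

text \<open>With \<open>s = 1\<close> this is a sample of $T'_x$, with \<open>s = -1\<close> one of $T'_{-x}$:
  only the coefficients of \<open>v0\<close> change sign. The order is \<open>(p1, p2, p3)\<close>.\<close>

definition T_vecs :: "real \<Rightarrow> real \<Rightarrow> real ^ 'n::finite \<Rightarrow> real ^ 'n \<Rightarrow> 'n pt \<times> 'n pt \<times> 'n pt" where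
  "T_vecs s x w u =
     ((s * x) *\<^sub>R v0 + sqrt (1 - x\<^sup>2) *\<^sub>R emb (- rho x *\<^sub>R w + sqrt (1 - (rho x)\<^sup>2) *\<^sub>R u),
      (s * x) *\<^sub>R v0 + sqrt (1 - x\<^sup>2) *\<^sub>R emb (- rho x *\<^sub>R w - sqrt (1 - (rho x)\<^sup>2) *\<^sub>R u),
      (s * (1 - 2 * x)) *\<^sub>R v0 + sqrt (1 - (2 * x - 1)\<^sup>2) *\<^sub>R emb w)"

text \<open>
  The distribution a triple is drawn from: $T'_x$ or $T'_{-x}$ for $x = 1 - 2^{-k}$, or one of the
  two boundary distributions built from $A'_{x_0}$ and $A'_{-x_0}$.
\<close>

datatype source = T_pos nat | T_neg nat | A_pos | A_neg

definition sources :: "nat \<Rightarrow> source set" where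
  "sources k0 = T_pos ` {1..k0} \<union> T_neg ` {1..k0} \<union> {A_pos, A_neg}"

definition level :: "nat \<Rightarrow> real" where
  "level k = 1 - (1 / 2) ^ k"

text \<open>
  A sample is \<open>(source, w, u)\<close>. There are \<open>2 (k0 + 1)\<close> sources, so the uniform distribution gives
  each the probability \<open>1 / (2 (k0 + 1))\<close>. For \<^const>\<open>A_pos\<close> and \<^const>\<open>A_neg\<close> no vector \<open>u\<close> is
  sampled: the component \<open>u\<close> is then a dummy which neither the triple nor the discarding rule uses.
\<close>

type_synonym 'n sample = "source \<times> (real ^ 'n) \<times> (real ^ 'n)"

definition sampling :: "nat \<Rightarrow> 'n::finite sample measure" where
  "sampling k0 = measure_pmf (pmf_of_set (sources k0)) \<Otimes>\<^sub>M (gauss \<Otimes>\<^sub>M gauss)"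

text \<open>An entry of a triple is the constant \<open>v0\<close>, the constant \<open>-v0\<close>, or a (sampled vector or)
  variable. A region center that happens to equal \<open>v0\<close> or \<open>-v0\<close> still is a variable.\<close>

datatype 'v entry = Const_pos | Const_neg | Var 'v

fun sampled_triple :: "nat \<Rightarrow> 'n::finite sample \<Rightarrow> 'n pt entry \<times> 'n pt entry \<times> 'n pt entry" where
  "sampled_triple k0 (T_pos k, w, u) =
     (case T_vecs 1 (level k) w u of (p1, p2, p3) \<Rightarrow> (Var p1, Var p2, Var p3))"
| "sampled_triple k0 (T_neg k, w, u) =
     (case T_vecs (-1) (level k) w u of (p1, p2, p3) \<Rightarrow> (Var p1, Var p2, Var p3))"
| "sampled_triple k0 (A_pos, w, u) = (Const_neg, Const_neg, Var (A_vec (level k0) w))"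
| "sampled_triple k0 (A_neg, w, u) = (Const_pos, Const_pos, Var (A_vec (- level k0) w))"

fun samples_u :: "source \<Rightarrow> bool" where
  "samples_u (T_pos k) = True"
| "samples_u (T_neg k) = True"
| "samples_u A_pos = False"
| "samples_u A_neg = False"

fun discarded :: "real \<Rightarrow> 'n::finite sample \<Rightarrow> bool" where
  "discarded \<epsilon> (src, w, u) \<longleftrightarrow>
     \<bar>(norm w)\<^sup>2 - 1\<bar> > \<epsilon> / 1000 \<or>
     (samples_u src \<and> (\<bar>(norm u)\<^sup>2 - 1\<bar> > \<epsilon> / 1000 \<or> \<bar>w \<bullet> u\<bar> > \<epsilon> / 1000))"

text \<open>
  The regions \<open>P\<close> partition the vectors of length at most 2, with centers \<open>ctr R\<close>. They are
  finitely many (the instance is a finite one) and Borel (so that for every assignment the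
  probability of violating a constraint makes sense).
\<close>

definition regions :: "real \<Rightarrow> 'n::finite pt set set \<Rightarrow> ('n pt set \<Rightarrow> 'n pt) \<Rightarrow> bool" where
  "regions \<epsilon> P ctr \<longleftrightarrow>
     finite P \<and> partition_on {p. norm p \<le> 2} P \<and> P \<subseteq> sets borel \<and>
     (\<forall>R\<in>P. \<forall>p\<in>R. dist (ctr R) p \<le> \<epsilon> / 1000)"

text \<open>\<open>far\<close> is the center of the further region, of the vectors of length greater than 2.\<close>

definition discretize ::
    "'n::finite pt set set \<Rightarrow> ('n pt set \<Rightarrow> 'n pt) \<Rightarrow> 'n pt \<Rightarrow> 'n pt \<Rightarrow> 'n pt" where
  "discretize P ctr far p = (if norm p \<le> 2 then ctr (THE R. R \<in> P \<and> p \<in> R) else far)"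

definition variables :: "'n::finite pt set set \<Rightarrow> ('n pt set \<Rightarrow> 'n pt) \<Rightarrow> 'n pt \<Rightarrow> 'n pt set" where
  "variables P ctr far = insert far (ctr ` P)"

definition constraint_triple ::
    "'n::finite pt set set \<Rightarrow> ('n pt set \<Rightarrow> 'n pt) \<Rightarrow> 'n pt \<Rightarrow> nat \<Rightarrow> 'n sample
      \<Rightarrow> 'n pt entry \<times> 'n pt entry \<times> 'n pt entry" where
  "constraint_triple P ctr far k0 smp =
     (case sampled_triple k0 smp of (e1, e2, e3) \<Rightarrow>
        (map_entry (discretize P ctr far) e1,
         map_entry (discretize P ctr far) e2,
         map_entry (discretize P ctr far) e3))"

text \<open>\<open>-1\<close> if the literals of the constraint are the negations of the entries, \<open>1\<close> otherwise.\<close>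

fun literal_sign :: "source \<Rightarrow> real" where
  "literal_sign (T_pos k) = -1"
| "literal_sign (T_neg k) = 1"
| "literal_sign A_pos = 1"
| "literal_sign A_neg = -1"

fun one_in_three :: "real \<times> real \<times> real \<Rightarrow> bool" where
  "one_in_three (x1, x2, x3) \<longleftrightarrow> length (filter (\<lambda>x. x = 1) [x1, x2, x3]) = 1"

fun nae :: "real \<times> real \<times> real \<Rightarrow> bool" where
  "nae (x1, x2, x3) \<longleftrightarrow> \<not> (x1 = x2 \<and> x2 = x3)"

fun entry_value :: "('v \<Rightarrow> real) \<Rightarrow> 'v entry \<Rightarrow> real" where
  "entry_value f Const_pos = 1"
| "entry_value f Const_neg = -1"
| "entry_value f (Var c) = f c"

fun triple_values ::
    "('v \<Rightarrow> real) \<Rightarrow> 'v entry \<times> 'v entry \<times> 'v entry \<Rightarrow> real \<times> real \<times> real" where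
  "triple_values f (e1, e2, e3) = (entry_value f e1, entry_value f e2, entry_value f e3)"

text \<open>
  The basic SDP relaxation does not bound the dimension of its vectors. A vector of $R^N$ is a
  function on the naturals of which only the values below \<open>N\<close> matter; \<open>z\<close> is the unit vector that
  stands for the constant true.
\<close>

definition ip :: "nat \<Rightarrow> (nat \<Rightarrow> real) \<Rightarrow> (nat \<Rightarrow> real) \<Rightarrow> real" where
  "ip N a b = (\<Sum>i<N. a i * b i)"

definition sdp_vectors :: "nat \<Rightarrow> (nat \<Rightarrow> real) \<Rightarrow> ('v \<Rightarrow> nat \<Rightarrow> real) \<Rightarrow> 'v set \<Rightarrow> bool" where
  "sdp_vectors N z V X \<longleftrightarrow> ip N z z = 1 \<and> (\<forall>c\<in>X. ip N (V c) (V c) = 1)"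

fun entry_vec :: "(nat \<Rightarrow> real) \<Rightarrow> ('v \<Rightarrow> nat \<Rightarrow> real) \<Rightarrow> 'v entry \<Rightarrow> nat \<Rightarrow> real" where
  "entry_vec z V Const_pos = z"
| "entry_vec z V Const_neg = (\<lambda>i. - z i)"
| "entry_vec z V (Var c) = V c"

definition literal_vec ::
    "(nat \<Rightarrow> real) \<Rightarrow> ('v \<Rightarrow> nat \<Rightarrow> real) \<Rightarrow> real \<Rightarrow> 'v entry \<Rightarrow> nat \<Rightarrow> real" where
  "literal_vec z V s e = (\<lambda>i. s * entry_vec z V e i)"

definition local_distribution ::
    "nat \<Rightarrow> (nat \<Rightarrow> real) \<Rightarrow> (nat \<Rightarrow> real) \<Rightarrow> (nat \<Rightarrow> real) \<Rightarrow> (nat \<Rightarrow> real)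
      \<Rightarrow> (real \<times> real \<times> real) pmf \<Rightarrow> bool" where
  "local_distribution N z v1 v2 v3 \<mu> \<longleftrightarrow>
     set_pmf \<mu> \<subseteq> {-1, 1} \<times> {-1, 1} \<times> {-1, 1} \<and>
     measure_pmf.expectation \<mu> (\<lambda>(x1, x2, x3). x1) = ip N v1 z \<and>
     measure_pmf.expectation \<mu> (\<lambda>(x1, x2, x3). x2) = ip N v2 z \<and>
     measure_pmf.expectation \<mu> (\<lambda>(x1, x2, x3). x3) = ip N v3 z \<and>
     measure_pmf.expectation \<mu> (\<lambda>(x1, x2, x3). x1 * x2) = ip N v1 v2 \<and>
     measure_pmf.expectation \<mu> (\<lambda>(x1, x2, x3). x1 * x3) = ip N v1 v3 \<and>
     measure_pmf.expectation \<mu> (\<lambda>(x1, x2, x3). x2 * x3) = ip N v2 v3"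

text \<open>The vectors \<open>z\<close>, \<open>V\<close> give a value of at least \<open>r\<close> to the 1-in-3-SAT constraint on the
  entries \<open>e1, e2, e3\<close> with literal sign \<open>s\<close>.\<close>

fun sdp_value_ge ::
    "nat \<Rightarrow> (nat \<Rightarrow> real) \<Rightarrow> ('v \<Rightarrow> nat \<Rightarrow> real) \<Rightarrow> real \<Rightarrow> 'v entry \<times> 'v entry \<times> 'v entry
      \<Rightarrow> real \<Rightarrow> bool" where
  "sdp_value_ge N z V s (e1, e2, e3) r \<longleftrightarrow>
     (\<exists>\<mu>. local_distribution N z (literal_vec z V s e1) (literal_vec z V s e2) (literal_vec z V s e3) \<mu> \<and>
          measure_pmf.prob \<mu> {x. one_in_three x} \<ge> r)"

end

theory Submission
  imports Defs
begin

text \<open>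
  \<^bold>\<open>Soundness.\<close> For \<open>s = 1\<close> or \<open>s = -1\<close> let \<open>D s k\<close> be the probability that a sample of the level \<open>s (1 - 2^-k)\<close> is
  assigned \<open>-s\<close>. Both boundary distributions make \<open>D s k0\<close> small if few constraints are violated,
  while \<open>D 1 0 + D (-1) 0 = 1\<close>. A triple at level \<open>k\<close> whose third entry is wrong is violated unless
  one of the first two is wrong, so \<open>D (-s) (k-1)\<close> is at most the violation probability plus twice
  the probability that two Gaussian vectors of correlation between \<open>-1/sqrt 2\<close> and 0 land in two given small
  sets. Small set expansion bounds the latter by \<open>sqrt (D (-s) (k-1)) * (D s k) powr (9/16)\<close>, which
  keeps all \<open>D s k\<close> below a constant. Two applications of Cauchy-Schwarz reduce it to correlation
  at most \<open>1/4\<close>, where hypercontractivity from L2 to L4 has an elementary proof on the line and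
  tensorizes.

  \<^bold>\<open>Discarding.\<close> Chernoff bounds for the squared norm; the inner product is half the difference of the
  squared norms of two rotated copies.

  \<^bold>\<open>Completeness.\<close> The region centers are scaled by \<open>sqrt (1 - \<epsilon>)\<close> and padded by orthogonal
  directions. All moments shrink by \<open>1 - \<epsilon>\<close>, which leaves a uniform component of weight \<open>\<epsilon>\<close> on
  the cube, enough to absorb the errors of discretization and of the Gaussian samples.
\<close>

section \<open>Rotation invariant measures\<close>

text \<open>Cauchy-Schwarz alone bounds the probability of landing in sets of measures \<beta> and
  \<delta> by \<open>sqrt (\<beta> * \<delta>)\<close>. With few violations this gives \<beta> \<le>
  16 \<delta> from one level to the next, so \<open>k0\<close> levels would lose a power of
  \<epsilon>. Any exponent of \<delta> above 1/2 makes smallness reproduce itself: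
  \<open>sqrt \<beta> * \<delta> powr (9/16)\<close> gives \<beta> \<le>
  \<open>16 * \<delta> powr (9/8)\<close>, a fixed threshold survives every level, and the only loss
  is the number of sources. The exponent comes from the contraction from L2 to L4, which yields 5/4
  in place of 1 at correlation 1/4; the two Cauchy-Schwarz steps leading there divide this gain of
  1/4 by 4.

  Functions with values in [0,1] make integrability automatic, and stating the inequalities with
  integer powers of integrals avoids real exponents. Large \<epsilon> is split off in each of the
  three claims, since its numerical bound is then trivial; the vector solution must still be
  exhibited.\<close>

lemma nn_integral_lborel_translate:
  fixes f :: "'a::euclidean_space \<Rightarrow> ennreal"
  assumes [measurable]: "f \<in> borel_measurable borel"
  shows "(\<integral>\<^sup>+x. f (x + a) \<partial>lborel) = (\<integral>\<^sup>+x. f x \<partial>lborel)"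
proof -
  have "(\<integral>\<^sup>+x. f x \<partial>lborel) = (\<integral>\<^sup>+x. f x \<partial>distr lborel borel ((+) a))"
    by (simp add: lborel_distr_plus)
  also have "\<dots> = (\<integral>\<^sup>+x. f (x + a) \<partial>lborel)"
    by (subst nn_integral_distr) (auto simp: add.commute)
  finally show ?thesis ..
qed

text \<open>With the unchanged coordinate fixed, a shear is a translation of the other one, so
  Tonelli with the moving coordinate innermost reduces both parts to translation invariance.\<close>

lemma nn_integral_shear:
  fixes H :: "'a::euclidean_space \<times> 'a \<Rightarrow> ennreal"
  assumes [measurable]: "H \<in> borel_measurable (borel \<Otimes>\<^sub>M borel)"
  shows "(\<integral>\<^sup>+p. H (fst p + a *\<^sub>R snd p, snd p) \<partial>(lborel \<Otimes>\<^sub>M lborel)) = (\<integral>\<^sup>+p. H p \<partial>(lborel \<Otimes>\<^sub>M lborel))"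
    and "(\<integral>\<^sup>+p. H (fst p, snd p + a *\<^sub>R fst p) \<partial>(lborel \<Otimes>\<^sub>M lborel)) = (\<integral>\<^sup>+p. H p \<partial>(lborel \<Otimes>\<^sub>M lborel))"
proof -
  have m [measurable]: "H \<in> borel_measurable (lborel \<Otimes>\<^sub>M lborel)"
    by (simp cong: measurable_cong_sets sets_pair_measure_cong)
  show "(\<integral>\<^sup>+p. H (fst p + a *\<^sub>R snd p, snd p) \<partial>(lborel \<Otimes>\<^sub>M lborel)) = (\<integral>\<^sup>+p. H p \<partial>(lborel \<Otimes>\<^sub>M lborel))"
    by (subst (1 2) lborel_pair.nn_integral_snd[symmetric])
       (auto simp: nn_integral_lborel_translate[of "\<lambda>x. H (x, _)"])
  show "(\<integral>\<^sup>+p. H (fst p, snd p + a *\<^sub>R fst p) \<partial>(lborel \<Otimes>\<^sub>M lborel)) = (\<integral>\<^sup>+p. H p \<partial>(lborel \<Otimes>\<^sub>M lborel))"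
    by (subst (1 2) lborel.nn_integral_fst[symmetric])
       (auto simp: nn_integral_lborel_translate[of "\<lambda>x. H (_, x)"])
qed

text \<open>A planar rotation is a composition of three shears.\<close>

lemma nn_integral_lborel_rotate:
  fixes H :: "'a::euclidean_space \<times> 'a \<Rightarrow> ennreal"
  assumes [measurable]: "H \<in> borel_measurable (borel \<Otimes>\<^sub>M borel)" and cs: "c\<^sup>2 + s\<^sup>2 = 1" "s \<noteq> 0"
  shows "(\<integral>\<^sup>+p. H (c *\<^sub>R fst p + s *\<^sub>R snd p, c *\<^sub>R snd p - s *\<^sub>R fst p) \<partial>(lborel \<Otimes>\<^sub>M lborel)) =
    (\<integral>\<^sup>+p. H p \<partial>(lborel \<Otimes>\<^sub>M lborel))"
proof -
  \<comment> \<open>The tangent of half the angle: the rotation is the shear by \<open>a\<close>,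
    then by \<open>- s\<close>, then by \<open>a\<close> again. The division is the reason for
    \<open>s \<noteq> 0\<close>.\<close>
  define a where "a = (1 - c) / s"
  have 1: "1 - a * s = c" using cs by (simp add: a_def)
  have 2: "a + c * a = s"
    using cs by (simp add: a_def field_simps power2_eq_square)
  define H1 where "H1 = (\<lambda>p. H (fst p + a *\<^sub>R snd p, snd p))"
  define H2 where "H2 = (\<lambda>p. H1 (fst p, snd p + (- s) *\<^sub>R fst p))"
  have [measurable]: "H1 \<in> borel_measurable (borel \<Otimes>\<^sub>M borel)" unfolding H1_def by measurable
  have [measurable]: "H2 \<in> borel_measurable (borel \<Otimes>\<^sub>M borel)" unfolding H2_def by measurable
  have eq: "H (c *\<^sub>R x + s *\<^sub>R y, c *\<^sub>R y - s *\<^sub>R x) = H2 (x + a *\<^sub>R y, y)" for x y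
  proof -
    have "x + a *\<^sub>R y + a *\<^sub>R (y - s *\<^sub>R (x + a *\<^sub>R y)) = (1 - a * s) *\<^sub>R x + (a + (1 - a * s) * a) *\<^sub>R y"
      by (simp add: algebra_simps) (metis mult_2_right scaleR_add_left)
    moreover have "y - s *\<^sub>R (x + a *\<^sub>R y) = (1 - a * s) *\<^sub>R y - s *\<^sub>R x"
      by (simp add: algebra_simps)
    ultimately show ?thesis by (simp add: H2_def H1_def 1 2)
  qed
  show ?thesis
    unfolding eq nn_integral_shear(1)[of H2 a, simplified]
    by (simp add: H2_def nn_integral_shear(2)[of H1 "-s", simplified])
       (simp add: H1_def nn_integral_shear(1)[of H a, simplified])
qed

text \<open>Instantiated by the normal distribution on the line and by \<open>gauss\<close>.
  \<open>G_rotate\<close> is the invariance of the density of two independent copies under a planar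
  rotation of the pair.\<close>

locale rotation_invariant =
  fixes N :: "'a::euclidean_space measure" and G :: "'a \<Rightarrow> real"
  assumes N_density: "N = density lborel (\<lambda>x. ennreal (G x))"
    and G_measurable [measurable]: "G \<in> borel_measurable borel"
    and G_nonneg: "0 \<le> G x"
    and G_rotate: "c\<^sup>2 + s\<^sup>2 = 1 \<Longrightarrow> G (c *\<^sub>R x + s *\<^sub>R y) * G (c *\<^sub>R y - s *\<^sub>R x) = G x * G y"
    and N_prob: "prob_space N"
begin

sublocale N: prob_space N by (rule N_prob)
sublocale NN: pair_prob_space N N ..

lemma sets_N [measurable_cong, simp]: "sets N = sets borel"
  by (simp add: N_density)

lemma space_N [simp]: "space N = UNIV"
  by (simp add: N_density)

lemma prob_UNIV [simp]: "measure N UNIV = 1"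
  using N.prob_space by simp

lemma sets_NN: "sets (N \<Otimes>\<^sub>M N) = sets (borel \<Otimes>\<^sub>M borel)"
  by (rule sets_pair_measure_cong) auto

lemma distr_rotate:
  assumes cs: "c\<^sup>2 + s\<^sup>2 = 1" "s \<noteq> 0"
  shows "distr (N \<Otimes>\<^sub>M N) (N \<Otimes>\<^sub>M N) (\<lambda>p. (c *\<^sub>R fst p + s *\<^sub>R snd p, c *\<^sub>R snd p - s *\<^sub>R fst p)) = N \<Otimes>\<^sub>M N"
    (is "distr _ _ ?R = _")
proof (rule measure_eqI)
  show "sets (distr (N \<Otimes>\<^sub>M N) (N \<Otimes>\<^sub>M N) ?R) = sets (N \<Otimes>\<^sub>M N)" by simp
next
  have R [measurable]: "?R \<in> borel \<Otimes>\<^sub>M borel \<rightarrow>\<^sub>M borel \<Otimes>\<^sub>M borel" by measurable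
  have sf: "sigma_finite_measure (density lborel (\<lambda>x. ennreal (G x)))"
    using N.sigma_finite_measure_axioms by (subst (asm) N_density)
  have dens: "N \<Otimes>\<^sub>M N = density (lborel \<Otimes>\<^sub>M lborel) (\<lambda>(x, y). ennreal (G x) * ennreal (G y))"
    by (subst (1 2) N_density, rule pair_measure_density[OF _ _ lborel.sigma_finite_measure_axioms sf]) simp_all
  fix A assume "A \<in> sets (distr (N \<Otimes>\<^sub>M N) (N \<Otimes>\<^sub>M N) ?R)"
  then have A [measurable]: "A \<in> sets (borel \<Otimes>\<^sub>M borel)" by (simp add: sets_NN)
  have emb: "emeasure (N \<Otimes>\<^sub>M N) B =
      (\<integral>\<^sup>+p. ennreal (G (fst p) * G (snd p)) * indicator B p \<partial>(lborel \<Otimes>\<^sub>M lborel))"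
    if B: "B \<in> sets (borel \<Otimes>\<^sub>M borel)" for B
  proof -
    have [measurable]: "B \<in> sets (lborel \<Otimes>\<^sub>M lborel)"
      by (subst sets_pair_measure_cong[OF sets_lborel sets_lborel]) (rule B)
    show ?thesis
      unfolding dens using B by (subst emeasure_density) (auto simp: case_prod_beta ennreal_mult G_nonneg)
  qed
  have "?R -` A \<in> sets (borel \<Otimes>\<^sub>M borel)"
    using measurable_sets[OF R A] by (simp add: space_pair_measure)
  then have "emeasure (N \<Otimes>\<^sub>M N) (?R -` A) =
      (\<integral>\<^sup>+p. ennreal (G (fst (?R p)) * G (snd (?R p))) * indicator A (?R p) \<partial>(lborel \<Otimes>\<^sub>M lborel))"
    using cs by (auto simp: emb G_rotate indicator_def intro!: nn_integral_cong)
  also have "\<dots> = emeasure (N \<Otimes>\<^sub>M N) A"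
    unfolding emb[OF A]
    by (rule nn_integral_lborel_rotate[OF _ cs, of "\<lambda>p. ennreal (G (fst p) * G (snd p)) * indicator A p"]) measurable
  finally show "emeasure (distr (N \<Otimes>\<^sub>M N) (N \<Otimes>\<^sub>M N) ?R) A = emeasure (N \<Otimes>\<^sub>M N) A"
    using A by (subst emeasure_distr) (auto simp: space_pair_measure sets_NN)
qed

lemma integral_rotate:
  fixes F :: "'a \<times> 'a \<Rightarrow> real"
  assumes cs: "c\<^sup>2 + s\<^sup>2 = 1" "s \<noteq> 0" and F [measurable]: "F \<in> borel_measurable (borel \<Otimes>\<^sub>M borel)"
  shows "(\<integral>p. F (c *\<^sub>R fst p + s *\<^sub>R snd p, c *\<^sub>R snd p - s *\<^sub>R fst p) \<partial>(N \<Otimes>\<^sub>M N)) = (\<integral>p. F p \<partial>(N \<Otimes>\<^sub>M N))"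
proof -
  have "(\<integral>p. F p \<partial>(N \<Otimes>\<^sub>M N)) = (\<integral>p. F p \<partial>distr (N \<Otimes>\<^sub>M N) (N \<Otimes>\<^sub>M N) (\<lambda>p. (c *\<^sub>R fst p + s *\<^sub>R snd p, c *\<^sub>R snd p - s *\<^sub>R fst p)))"
    by (simp add: distr_rotate[OF cs])
  also have "\<dots> = (\<integral>p. F (c *\<^sub>R fst p + s *\<^sub>R snd p, c *\<^sub>R snd p - s *\<^sub>R fst p) \<partial>(N \<Otimes>\<^sub>M N))"
    by (rule integral_distr) measurable
  finally show ?thesis ..
qed

end

section \<open>Cauchy-Schwarz and integrals of functions with values in [0,1]\<close>

lemma Cauchy_Schwarz_integral:
  fixes f g :: "'a \<Rightarrow> real"
  assumes [measurable]: "f \<in> borel_measurable M" "g \<in> borel_measurable M"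
    and f: "integrable M (\<lambda>x. (f x)\<^sup>2)" and g: "integrable M (\<lambda>x. (g x)\<^sup>2)"
  shows "integrable M (\<lambda>x. f x * g x)"
    and "(\<integral>x. f x * g x \<partial>M)\<^sup>2 \<le> (\<integral>x. (f x)\<^sup>2 \<partial>M) * (\<integral>x. (g x)\<^sup>2 \<partial>M)"
proof -
  show fg: "integrable M (\<lambda>x. f x * g x)"
  proof (rule Bochner_Integration.integrable_bound[OF Bochner_Integration.integrable_add[OF f g]])
    have "\<bar>a * b\<bar> \<le> a\<^sup>2 + b\<^sup>2" for a b :: real
    proof -
      have "2 * (\<bar>a\<bar> * \<bar>b\<bar>) \<le> a\<^sup>2 + b\<^sup>2"
        using sum_squares_bound[of "\<bar>a\<bar>" "\<bar>b\<bar>"] by simp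
      moreover have "0 \<le> \<bar>a\<bar> * \<bar>b\<bar>" by simp
      ultimately show ?thesis unfolding abs_mult by linarith
    qed
    then show "AE x in M. norm (f x * g x) \<le> norm ((f x)\<^sup>2 + (g x)\<^sup>2)" by simp
  qed measurable
  define A B C where "A = (\<integral>x. (f x)\<^sup>2 \<partial>M)" and "B = (\<integral>x. f x * g x \<partial>M)" and "C = (\<integral>x. (g x)\<^sup>2 \<partial>M)"
  have q: "0 \<le> t\<^sup>2 * A - 2 * t * B + C" for t
  proof -
    have "0 \<le> (\<integral>x. (t * f x - g x)\<^sup>2 \<partial>M)" by (rule integral_nonneg_AE) simp
    also have "(\<lambda>x. (t * f x - g x)\<^sup>2) = (\<lambda>x. t\<^sup>2 * (f x)\<^sup>2 - 2 * t * (f x * g x) + (g x)\<^sup>2)"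
      by (simp add: fun_eq_iff power2_eq_square algebra_simps)
    also have "(\<integral>x. t\<^sup>2 * (f x)\<^sup>2 - 2 * t * (f x * g x) + (g x)\<^sup>2 \<partial>M) = t\<^sup>2 * A - 2 * t * B + C"
      using f g fg by (simp add: A_def B_def C_def)
    finally show ?thesis .
  qed
  have "B\<^sup>2 \<le> A * C"
  proof (cases "A = 0")
    case True
    have "B = 0"
    proof (rule ccontr)
      \<comment> \<open>For \<open>A = 0\<close> the quadratic is the linear function
        \<open>C - 2 * t * B\<close>, which takes the value -1 at this \<open>t\<close>.\<close>
      assume "B \<noteq> 0" then show False using q[of "(C + 1) / (2 * B)"] True by simp
    qed
    then show ?thesis using True by simp
  next
    case False
    moreover have "A \<ge> 0" unfolding A_def by (rule integral_nonneg_AE) simp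
    ultimately have "A > 0" by simp
    \<comment> \<open>\<open>B / A\<close> minimizes the quadratic.\<close>
    then show ?thesis using q[of "B / A"] by (simp add: power2_eq_square field_simps)
  qed
  then show "(\<integral>x. f x * g x \<partial>M)\<^sup>2 \<le> (\<integral>x. (f x)\<^sup>2 \<partial>M) * (\<integral>x. (g x)\<^sup>2 \<partial>M)"
    by (simp add: A_def B_def C_def)
qed

lemma (in finite_measure) integrable_unit_valued:
  fixes f :: "'a \<Rightarrow> real"
  assumes "f \<in> borel_measurable M" "\<And>x. 0 \<le> f x \<and> f x \<le> 1"
  shows "integrable M f"
  by (rule integrable_const_bound[of _ 1]) (use assms in auto)

text \<open>Measurability is not among the assumptions because a function that is not integrable has
  integral 0, which lies in the interval.\<close>

lemma (in prob_space) integral_unit_valued: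
  fixes f :: "'a \<Rightarrow> real"
  assumes "\<And>x. 0 \<le> f x \<and> f x \<le> 1"
  shows "0 \<le> (\<integral>x. f x \<partial>M) \<and> (\<integral>x. f x \<partial>M) \<le> 1"
proof (cases "integrable M f")
  case True
  then have "(\<integral>x. f x \<partial>M) \<le> (\<integral>x. 1 \<partial>M)"
    using assms by (intro integral_mono) auto
  moreover have "0 \<le> (\<integral>x. f x \<partial>M)"
    by (rule integral_nonneg_AE) (use assms in auto)
  ultimately show ?thesis by (simp add: prob_space)
qed (simp add: not_integrable_integral_eq)

lemma (in pair_prob_space) integral_pair_unit_valued:
  fixes F :: "'a \<times> 'b \<Rightarrow> real"
  assumes "F \<in> borel_measurable (M1 \<Otimes>\<^sub>M M2)" and "\<And>p. 0 \<le> F p \<and> F p \<le> 1"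
  shows "(\<integral>p. F p \<partial>(M1 \<Otimes>\<^sub>M M2)) = (\<integral>x. (\<integral>y. F (x, y) \<partial>M2) \<partial>M1)"
    and "(\<integral>p. F p \<partial>(M1 \<Otimes>\<^sub>M M2)) = (\<integral>y. (\<integral>x. F (x, y) \<partial>M1) \<partial>M2)"
proof -
  have i: "integrable (M1 \<Otimes>\<^sub>M M2) F"
    by (rule integrable_unit_valued) (use assms in auto)
  show "(\<integral>p. F p \<partial>(M1 \<Otimes>\<^sub>M M2)) = (\<integral>x. (\<integral>y. F (x, y) \<partial>M2) \<partial>M1)"
    by (rule integral_fst'[OF i, symmetric])
  show "(\<integral>p. F p \<partial>(M1 \<Otimes>\<^sub>M M2)) = (\<integral>y. (\<integral>x. F (x, y) \<partial>M1) \<partial>M2)"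
    using integral_snd[of "\<lambda>x y. F (x, y)"] i by simp
qed

section \<open>Noise operators and correlations\<close>

context rotation_invariant
begin

text \<open>For \<open>c\<^sup>2 + s\<^sup>2 = 1\<close> the two arguments are copies of
  \<open>N\<close> with correlation \<open>c\<close>; for indicators this is the probability that
  they land in two given sets.\<close>

definition corr :: "real \<Rightarrow> real \<Rightarrow> ('a \<Rightarrow> real) \<Rightarrow> ('a \<Rightarrow> real) \<Rightarrow> real" where
  "corr c s h f = (\<integral>p. h (fst p) * f (c *\<^sub>R fst p + s *\<^sub>R snd p) \<partial>(N \<Otimes>\<^sub>M N))"

text \<open>The Ornstein-Uhlenbeck operator with parameter \<open>c\<close>. Keeping
  \<open>s\<close> as a separate argument allows both signs: \<open>- s\<close> gives the adjoint,
  and it also describes the second entry of a triple.\<close>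

definition noise :: "real \<Rightarrow> real \<Rightarrow> ('a \<Rightarrow> real) \<Rightarrow> 'a \<Rightarrow> real" where
  "noise c s f x = (\<integral>y. f (c *\<^sub>R x + s *\<^sub>R y) \<partial>N)"

definition unit_valued :: "('a \<Rightarrow> real) \<Rightarrow> bool" where
  "unit_valued f \<longleftrightarrow> f \<in> borel_measurable borel \<and> (\<forall>x. 0 \<le> f x \<and> f x \<le> 1)"

lemma integral_pair_unit_valued:
  fixes F :: "'a \<times> 'a \<Rightarrow> real"
  assumes [measurable]: "F \<in> borel_measurable (borel \<Otimes>\<^sub>M borel)" and "\<And>p. 0 \<le> F p \<and> F p \<le> 1"
  shows "(\<integral>p. F p \<partial>(N \<Otimes>\<^sub>M N)) = (\<integral>x. (\<integral>y. F (x, y) \<partial>N) \<partial>N)"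
  by (rule NN.integral_pair_unit_valued(1)) (use assms in auto)

lemma unit_valued_noise:
  assumes "unit_valued f"
  shows "unit_valued (noise c s f)"
proof -
  have [measurable]: "f \<in> borel_measurable borel" using assms by (simp add: unit_valued_def)
  have [measurable]: "(\<lambda>(x, y). f (c *\<^sub>R x + s *\<^sub>R y)) \<in> borel_measurable (borel \<Otimes>\<^sub>M N)"
    by measurable
  have "noise c s f \<in> borel_measurable borel"
    unfolding noise_def by measurable
  moreover have "0 \<le> noise c s f x \<and> noise c s f x \<le> 1" for x
    unfolding noise_def by (rule N.integral_unit_valued) (use assms in \<open>auto simp: unit_valued_def\<close>)
  ultimately show ?thesis by (simp add: unit_valued_def)
qed

lemma corr_eq_noise:
  assumes "unit_valued h" "unit_valued f"
  shows "corr c s h f = (\<integral>x. h x * noise c s f x \<partial>N)"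
proof -
  have [measurable]: "f \<in> borel_measurable borel" "h \<in> borel_measurable borel"
    using assms by (auto simp: unit_valued_def)
  have "corr c s h f = (\<integral>x. (\<integral>y. h x * f (c *\<^sub>R x + s *\<^sub>R y) \<partial>N) \<partial>N)"
    unfolding corr_def
    by (subst integral_pair_unit_valued) (use assms in \<open>auto simp: unit_valued_def mult_le_one\<close>)
  also have "\<dots> = (\<integral>x. h x * noise c s f x \<partial>N)"
    by (simp add: noise_def)
  finally show ?thesis .
qed

text \<open>The semigroup law: the noise terms \<open>- (c * s) *\<^sub>R y\<close> and
  \<open>s *\<^sub>R z\<close> are independent, and a rotation of the pair merges them into a single
  one of size \<open>sqrt (1 - c ^ 4)\<close>. The sign of the outer \<open>s\<close> is the one
  that the adjoint produces.\<close>

lemma noise_noise: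
  assumes "unit_valued f" and cs: "c\<^sup>2 + s\<^sup>2 = 1" "s \<noteq> 0"
  shows "noise c (- s) (noise c s f) x = noise (c\<^sup>2) (sqrt (1 - c ^ 4)) f x"
proof -
  have [measurable]: "f \<in> borel_measurable borel" 
    using assms by (auto simp: unit_valued_def)
  define S where "S = sqrt (1 - c ^ 4)"
  have c4: "1 - c ^ 4 = s\<^sup>2 * (1 + c\<^sup>2)"
  proof -
    have "1 - c ^ 4 = (1 - c\<^sup>2) * (1 + c\<^sup>2)"
      by (simp add: algebra_simps flip: power_add)
    moreover have "1 - c\<^sup>2 = s\<^sup>2" using cs by simp
    ultimately show ?thesis by simp
  qed
  then have "1 - c ^ 4 > 0" using cs by (simp add: add_pos_nonneg)
  then have S: "S > 0" "S\<^sup>2 = s\<^sup>2 * (1 + c\<^sup>2)" using c4 by (auto simp: S_def)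
  define c' s' where "c' = - (c * s) / S" and "s' = s / S"
  have c's': "c'\<^sup>2 + s'\<^sup>2 = 1" "s' \<noteq> 0"
    using S cs by (auto simp: c'_def s'_def power_divide power_mult_distrib add_divide_distrib[symmetric] algebra_simps)
  have "noise c (- s) (noise c s f) x = (\<integral>y. (\<integral>z. f (c *\<^sub>R (c *\<^sub>R x - s *\<^sub>R y) + s *\<^sub>R z) \<partial>N) \<partial>N)"
    by (simp add: noise_def)
  also have "\<dots> = (\<integral>p. f (c *\<^sub>R (c *\<^sub>R x - s *\<^sub>R fst p) + s *\<^sub>R snd p) \<partial>(N \<Otimes>\<^sub>M N))"
    by (subst integral_pair_unit_valued) (use assms in \<open>auto simp: unit_valued_def\<close>)
  also have "\<dots> = (\<integral>p. f ((c\<^sup>2) *\<^sub>R x + S *\<^sub>R (c' *\<^sub>R fst p + s' *\<^sub>R snd p)) \<partial>(N \<Otimes>\<^sub>M N))"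
    using S by (simp add: c'_def s'_def algebra_simps power2_eq_square)
  also have "\<dots> = (\<integral>p. f ((c\<^sup>2) *\<^sub>R x + S *\<^sub>R fst p) \<partial>(N \<Otimes>\<^sub>M N))"
    by (rule integral_rotate[OF c's', of "\<lambda>p. f ((c\<^sup>2) *\<^sub>R x + S *\<^sub>R fst p)", simplified fst_conv]) measurable
  also have "\<dots> = (\<integral>y. (\<integral>z. f ((c\<^sup>2) *\<^sub>R x + S *\<^sub>R y) \<partial>N) \<partial>N)"
    by (subst integral_pair_unit_valued) (use assms in \<open>auto simp: unit_valued_def\<close>)
  finally show ?thesis by (simp add: noise_def S_def)
qed

text \<open>The square norm of the image of \<open>f\<close> under the operator T is the inner
  product of \<open>f\<close> with T* T f. The adjoint T* is the noise operator with
  \<open>- s\<close>, because exchanging the roles of the two correlated points is a rotation of the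
  pair.\<close>

lemma integral_noise_sq:
  assumes f: "unit_valued f" and cs: "c\<^sup>2 + s\<^sup>2 = 1" "s \<noteq> 0"
  shows "(\<integral>x. (noise c s f x)\<^sup>2 \<partial>N) = corr (c\<^sup>2) (sqrt (1 - c ^ 4)) f f"
proof -
  let ?T = "noise c s f"
  note Tf = unit_valued_noise[OF f, of c s]
  have [measurable]: "f \<in> borel_measurable borel" "?T \<in> borel_measurable borel"
    using f Tf by (auto simp: unit_valued_def)
  have cs': "c * c + s * s = 1" using cs by (simp add: power2_eq_square)
  have "(\<integral>x. (?T x)\<^sup>2 \<partial>N) = corr c s ?T f"
    by (simp add: corr_eq_noise f Tf power2_eq_square)
  \<comment> \<open>The first point is rewritten as the inverse rotation of the rotated pair, so
    that \<open>integral_rotate\<close> can make the second point the new first coordinate.\<close>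
  also have "\<dots> = (\<integral>p. ?T (c *\<^sub>R (c *\<^sub>R fst p + s *\<^sub>R snd p) - s *\<^sub>R (c *\<^sub>R snd p - s *\<^sub>R fst p)) * f (c *\<^sub>R fst p + s *\<^sub>R snd p) \<partial>(N \<Otimes>\<^sub>M N))"
  proof -
    have "c *\<^sub>R (c *\<^sub>R x + s *\<^sub>R y) - s *\<^sub>R (c *\<^sub>R y - s *\<^sub>R x) = (c * c + s * s) *\<^sub>R x" for x y :: 'a
      by (simp add: algebra_simps)
    then show ?thesis by (simp add: corr_def cs')
  qed
  also have "\<dots> = (\<integral>p. ?T (c *\<^sub>R fst p - s *\<^sub>R snd p) * f (fst p) \<partial>(N \<Otimes>\<^sub>M N))"
    by (rule integral_rotate[OF cs, of "\<lambda>p. ?T (c *\<^sub>R fst p - s *\<^sub>R snd p) * f (fst p)", simplified fst_conv snd_conv]) measurable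
  also have "\<dots> = corr c (-s) f ?T" by (simp add: corr_def mult.commute)
  also have "\<dots> = corr (c\<^sup>2) (sqrt (1 - c ^ 4)) f f"
    by (simp add: corr_eq_noise f Tf noise_noise[OF f cs])
  finally show ?thesis .
qed

text \<open>Cauchy-Schwarz applied to \<open>h\<close> and the noised \<open>f\<close>. Each use
  squares the correlation, and the remaining form involves \<open>f\<close> alone, so the step can
  be repeated.\<close>

lemma corr_sq_le:
  assumes h: "unit_valued h" and f: "unit_valued f" and cs: "c\<^sup>2 + s\<^sup>2 = 1" "s \<noteq> 0"
  shows "(corr c s h f)\<^sup>2 \<le> (\<integral>x. (h x)\<^sup>2 \<partial>N) * corr (c\<^sup>2) (sqrt (1 - c ^ 4)) f f"
proof -
  note Tf = unit_valued_noise[OF f, of c s]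
  have sq: "integrable N (\<lambda>x. (g x)\<^sup>2)" if "unit_valued g" for g
    by (rule N.integrable_unit_valued) (use that in \<open>auto simp: unit_valued_def power_le_one\<close>)
  show ?thesis
    unfolding corr_eq_noise[OF h f] integral_noise_sq[OF f cs, symmetric]
    by (rule Cauchy_Schwarz_integral(2)) (use h Tf sq in \<open>auto simp: unit_valued_def\<close>)
qed

end

section \<open>Hypercontractivity on the line\<close>

lemma rotation_invariant_normal:
  assumes "\<sigma> > 0"
  shows "rotation_invariant (density lborel (\<lambda>x. ennreal (normal_density 0 \<sigma> x))) (normal_density 0 \<sigma>)"
proof (rule rotation_invariant.intro)
  fix c s x y :: real
  assume cs: "c\<^sup>2 + s\<^sup>2 = 1"
  have "(c * x + s * y)\<^sup>2 + (c * y - s * x)\<^sup>2 = (c\<^sup>2 + s\<^sup>2) * (x\<^sup>2 + y\<^sup>2)"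
    by (simp add: power2_eq_square algebra_simps)
  then have "(c * x + s * y)\<^sup>2 + (c * y - s * x)\<^sup>2 = x\<^sup>2 + y\<^sup>2" by (simp add: cs)
  then have *: "- (c * x + s * y)\<^sup>2 / (2 * \<sigma>\<^sup>2) + - (c * y - s * x)\<^sup>2 / (2 * \<sigma>\<^sup>2) = - x\<^sup>2 / (2 * \<sigma>\<^sup>2) + - y\<^sup>2 / (2 * \<sigma>\<^sup>2)"
    by (metis add_divide_distrib minus_add_distrib)
  show "normal_density 0 \<sigma> (c *\<^sub>R x + s *\<^sub>R y) * normal_density 0 \<sigma> (c *\<^sub>R y - s *\<^sub>R x) = normal_density 0 \<sigma> x * normal_density 0 \<sigma> y"
    using arg_cong[OF *, of exp] unfolding normal_density_def exp_add by simp
qed (simp_all add: prob_space_normal_density[OF assms])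

text \<open>The exponents combine to a normal density with standard deviation
  \<open>\<sigma> / q\<close>. Used twice: for the moments of the Mehler kernel and for the Chernoff
  bounds.\<close>

lemma integral_exp_square_normal:
  assumes "\<sigma> > 0" "2 * \<theta> * \<sigma>\<^sup>2 < 1"
  shows "has_bochner_integral lborel (\<lambda>x. normal_density 0 \<sigma> x * exp (\<theta> * x\<^sup>2)) (1 / sqrt (1 - 2 * \<theta> * \<sigma>\<^sup>2))"
proof -
  define q where "q = sqrt (1 - 2 * \<theta> * \<sigma>\<^sup>2)"
  have q: "q > 0" "q\<^sup>2 = 1 - 2 * \<theta> * \<sigma>\<^sup>2" using assms by (auto simp: q_def)
  have "normal_density 0 \<sigma> x * exp (\<theta> * x\<^sup>2) = (1 / q) * normal_density 0 (\<sigma> / q) x" for x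
  proof -
    have "- x\<^sup>2 / (2 * \<sigma>\<^sup>2) + \<theta> * x\<^sup>2 = - x\<^sup>2 * q\<^sup>2 / (2 * \<sigma>\<^sup>2)"
      using assms unfolding q(2) by (simp add: field_simps)
    then have "exp (- x\<^sup>2 / (2 * \<sigma>\<^sup>2)) * exp (\<theta> * x\<^sup>2) = exp (- x\<^sup>2 * q\<^sup>2 / (2 * \<sigma>\<^sup>2))"
      by (simp only: exp_add[symmetric])
    then show ?thesis
      using q(1) assms by (simp add: normal_density_def real_sqrt_mult real_sqrt_divide power_divide field_simps)
  qed
  moreover have "has_bochner_integral lborel (\<lambda>x. (1 / q) * normal_density 0 (\<sigma> / q) x) ((1 / q) * 1)"
    by (rule has_bochner_integral_mult_right) (use q assms in \<open>simp add: has_bochner_integral_iff\<close>)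
  ultimately show ?thesis by (simp add: q_def)
qed

text \<open>Hoelder with exponents 4/3 and 4, cleared of roots. Cauchy-Schwarz is applied to the
  product of \<open>v\<^sup>2\<close> and \<open>v * t\<close>, then to the product of
  \<open>v\<^sup>2\<close> and \<open>t\<^sup>2\<close>.\<close>

lemma (in prob_space) Holder_4:
  fixes v t :: "'a \<Rightarrow> real"
  assumes v [measurable]: "v \<in> borel_measurable M" and t [measurable]: "t \<in> borel_measurable M"
    and "\<And>x. 0 \<le> v x \<and> v x \<le> 1" "\<And>x. 0 \<le> t x \<and> t x \<le> 1"
  shows "(\<integral>x. v x ^ 3 * t x \<partial>M) ^ 4 \<le> (\<integral>x. v x ^ 4 \<partial>M) ^ 3 * (\<integral>x. t x ^ 4 \<partial>M)"
proof -
  have i: "integrable M (\<lambda>x. v x ^ m * t x ^ n)" for m n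
    by (rule integrable_unit_valued) (use assms in \<open>auto simp: power_le_one mult_le_one\<close>)
  have 1: "(\<integral>x. v x ^ 2 * (v x * t x) \<partial>M)\<^sup>2 \<le> (\<integral>x. (v x ^ 2)\<^sup>2 \<partial>M) * (\<integral>x. (v x * t x)\<^sup>2 \<partial>M)"
    by (rule Cauchy_Schwarz_integral(2)) (use i[of 4 0] i[of 2 2] in \<open>simp_all add: power_mult_distrib\<close>)
  have 2: "(\<integral>x. v x ^ 2 * t x ^ 2 \<partial>M)\<^sup>2 \<le> (\<integral>x. (v x ^ 2)\<^sup>2 \<partial>M) * (\<integral>x. (t x ^ 2)\<^sup>2 \<partial>M)"
    by (rule Cauchy_Schwarz_integral(2)) (use i[of 4 0] i[of 0 4] in \<open>simp_all\<close>)
  define A B C D where "A = (\<integral>x. v x ^ 3 * t x \<partial>M)" and "B = (\<integral>x. v x ^ 4 \<partial>M)"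
    and "C = (\<integral>x. v x ^ 2 * t x ^ 2 \<partial>M)" and "D = (\<integral>x. t x ^ 4 \<partial>M)"
  have 1: "A\<^sup>2 \<le> B * C"
    using 1 by (simp add: A_def B_def C_def power_mult_distrib power2_eq_square power3_eq_cube mult.assoc mult.left_commute power4_eq_xxxx)
  have 2: "C\<^sup>2 \<le> B * D"
    using 2 by (simp add: B_def C_def D_def)
  have B: "B \<ge> 0" unfolding B_def by (rule integral_nonneg_AE) simp
  have "A ^ 4 = (A\<^sup>2)\<^sup>2" by simp
  also have "\<dots> \<le> (B * C)\<^sup>2" using 1 by (rule power_mono) simp
  also have "\<dots> = B\<^sup>2 * C\<^sup>2" by (simp add: power_mult_distrib)
  also have "\<dots> \<le> B\<^sup>2 * (B * D)" using 2 by (rule mult_left_mono) simp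
  also have "\<dots> = B ^ 3 * D" by (simp add: power2_eq_square power3_eq_cube)
  finally show ?thesis by (simp add: A_def B_def D_def)
qed

text \<open>The Mehler kernel: the operator \<open>noise r s\<close> on the standard Gaussian line is integration
  against this kernel.\<close>

definition mehler :: "real \<Rightarrow> real \<Rightarrow> real \<Rightarrow> real" where
  "mehler r x z = normal_density (r * x) (sqrt (1 - r\<^sup>2)) z / std_normal_density z"

lemma mehler_measurable [measurable]: "mehler r x \<in> borel_measurable borel"
  unfolding mehler_def by measurable

lemma std_mult_mehler: "std_normal_density z * mehler r x z = normal_density (r * x) (sqrt (1 - r\<^sup>2)) z"
  using normal_density_pos[of 1 0 z] by (simp add: mehler_def)

text \<open>The closed form of the squared L2 norm of the kernel in its second variable, proved in
  \<open>integral_mehler_sq\<close>.\<close>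

definition mehler_sq :: "real \<Rightarrow> real \<Rightarrow> real" where
  "mehler_sq r x = exp (r\<^sup>2 / (1 + r\<^sup>2) * x\<^sup>2) / sqrt (1 - r ^ 4)"

lemma integral_mehler_sq:
  assumes "r\<^sup>2 < 1"
  shows "has_bochner_integral lborel (\<lambda>z. std_normal_density z * (mehler r x z)\<^sup>2) (mehler_sq r x)"
proof -
  define s where "s = sqrt (1 - r\<^sup>2)"
  define p where "p = sqrt (1 + r\<^sup>2)"
  have s: "s > 0" "s\<^sup>2 = 1 - r\<^sup>2" using assms by (auto simp: s_def)
  have p: "p > 0" "p\<^sup>2 = 1 + r\<^sup>2" by (auto simp: p_def add_pos_nonneg)
  have sp: "sqrt (1 - r ^ 4) = s * p"
    unfolding s_def p_def real_sqrt_mult[symmetric] by (simp add: algebra_simps flip: power_add)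
  \<comment> \<open>Completing the square in \<open>z\<close>: the result is a multiple of the
    normal density with mean \<open>2 * r * x / (1 + r\<^sup>2)\<close> and variance
    \<open>(1 - r\<^sup>2) / (1 + r\<^sup>2)\<close>.\<close>
  have "std_normal_density z * (mehler r x z)\<^sup>2 = mehler_sq r x * normal_density (2 * r * x / p\<^sup>2) (s / p) z" for z
  proof -
    have "- (z - r * x)\<^sup>2 / (2 * s\<^sup>2) + - (z - r * x)\<^sup>2 / (2 * s\<^sup>2) - (- z\<^sup>2 / 2)
        = r\<^sup>2 / p\<^sup>2 * x\<^sup>2 + - (z - 2 * r * x / p\<^sup>2)\<^sup>2 / (2 * (s / p)\<^sup>2)"
    proof -
      have "- (z - r * x)\<^sup>2 / (2 * s\<^sup>2) + - (z - r * x)\<^sup>2 / (2 * s\<^sup>2) - (- z\<^sup>2 / 2)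
          = (s\<^sup>2 * z\<^sup>2 - 2 * (z - r * x)\<^sup>2) / (2 * s\<^sup>2)"
        using s(1) by (simp add: field_simps)
      also have "\<dots> = (2 * s\<^sup>2 * r\<^sup>2 * x\<^sup>2 - (p\<^sup>2 * z - 2 * r * x)\<^sup>2) / (2 * s\<^sup>2 * p\<^sup>2)"
      proof -
        have "(s\<^sup>2 * z\<^sup>2 - 2 * (z - r * x)\<^sup>2) * p\<^sup>2 = 2 * s\<^sup>2 * r\<^sup>2 * x\<^sup>2 - (p\<^sup>2 * z - 2 * r * x)\<^sup>2"
          unfolding s p by (simp add: power2_eq_square algebra_simps)
        moreover have "(s\<^sup>2 * z\<^sup>2 - 2 * (z - r * x)\<^sup>2) / (2 * s\<^sup>2) = (s\<^sup>2 * z\<^sup>2 - 2 * (z - r * x)\<^sup>2) * p\<^sup>2 / (2 * s\<^sup>2 * p\<^sup>2)"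
          using p(1) by simp
        ultimately show ?thesis by simp
      qed
      also have "\<dots> = r\<^sup>2 / p\<^sup>2 * x\<^sup>2 + - (z - 2 * r * x / p\<^sup>2)\<^sup>2 / (2 * (s / p)\<^sup>2)"
      proof -
        have "(z - 2 * r * x / p\<^sup>2) = (p\<^sup>2 * z - 2 * r * x) / p\<^sup>2" using p(1) by (simp add: field_simps)
        then have e: "- (z - 2 * r * x / p\<^sup>2)\<^sup>2 / (2 * (s / p)\<^sup>2) = - (p\<^sup>2 * z - 2 * r * x)\<^sup>2 / (2 * s\<^sup>2 * p\<^sup>2)"
          using p(1) s(1) by (simp add: power_divide power2_eq_square)
        show ?thesis unfolding e using s(1) p(1) by (simp add: diff_divide_distrib)
      qed
      finally show ?thesis .
    qed
    then have "exp (- (z - r * x)\<^sup>2 / (2 * s\<^sup>2)) * exp (- (z - r * x)\<^sup>2 / (2 * s\<^sup>2)) / exp (- z\<^sup>2 / 2)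
      = exp (r\<^sup>2 / p\<^sup>2 * x\<^sup>2) * exp (- (z - 2 * r * x / p\<^sup>2)\<^sup>2 / (2 * (s / p)\<^sup>2))"
      by (simp only: exp_add[symmetric] exp_diff[symmetric])
    note e = this
    have "std_normal_density z * (mehler r x z)\<^sup>2 = (normal_density (r * x) s z * normal_density (r * x) s z) / std_normal_density z"
      using normal_density_pos[of 1 0 z] by (simp add: mehler_def s_def power2_eq_square)
    also have "\<dots> = sqrt (2 * pi) / (2 * pi * s\<^sup>2) *
       (exp (- (z - r * x)\<^sup>2 / (2 * s\<^sup>2)) * exp (- (z - r * x)\<^sup>2 / (2 * s\<^sup>2)) / exp (- z\<^sup>2 / 2))"
      using s(1) by (simp add: normal_density_def power2_eq_square real_sqrt_mult field_simps)
    also have "\<dots> = sqrt (2 * pi) / (2 * pi * s\<^sup>2) * (exp (r\<^sup>2 / p\<^sup>2 * x\<^sup>2) * exp (- (z - 2 * r * x / p\<^sup>2)\<^sup>2 / (2 * (s / p)\<^sup>2)))"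
      unfolding e ..
    also have "\<dots> = mehler_sq r x * normal_density (2 * r * x / p\<^sup>2) (s / p) z"
    proof -
      have "sqrt (2 * pi) / (2 * pi * s\<^sup>2) = 1 / (s * p) * (1 / (sqrt (2 * pi) * (s / p)))"
      proof -
        have "q / (q * q * s\<^sup>2) = 1 / (s * p) * (1 / (q * (s / p)))" if "q > 0" for q
          using that s(1) p(1) by (simp add: field_simps power2_eq_square)
        from this[of "sqrt (2 * pi)"] show ?thesis by simp
      qed
      moreover have "sqrt (2 * pi * (s / p)\<^sup>2) = sqrt (2 * pi) * (s / p)"
        using s(1) p(1) by (simp add: real_sqrt_mult)
      ultimately show ?thesis
        by (simp add: mehler_sq_def sp normal_density_def p(2))
    qed
    finally show ?thesis .
  qed
  moreover have "has_bochner_integral lborel (\<lambda>z. mehler_sq r x * normal_density (2 * r * x / p\<^sup>2) (s / p) z) (mehler_sq r x * 1)"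
    by (rule has_bochner_integral_mult_right) (use s p in \<open>simp add: has_bochner_integral_iff\<close>)
  ultimately show ?thesis by simp
qed

text \<open>The substitution z = r x + sqrt (1 - r^2) y moves the dependence on \<open>x\<close>
  from the argument of \<open>g\<close> into a kernel, where Cauchy-Schwarz in \<open>z\<close>
  applies for each fixed \<open>x\<close>.\<close>

lemma integral_affine_std:
  fixes g :: "real \<Rightarrow> real"
  assumes g [measurable]: "g \<in> borel_measurable borel" and r: "r\<^sup>2 < 1"
  shows "(\<integral>y. g (r * x + sqrt (1 - r\<^sup>2) * y) \<partial>density lborel (\<lambda>x. ennreal (std_normal_density x)))
    = (\<integral>z. std_normal_density z * (mehler r x z * g z) \<partial>lborel)"
proof -
  define s where "s = sqrt (1 - r\<^sup>2)"
  have s: "s > 0" using r by (simp add: s_def)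
  have "(\<integral>z. std_normal_density z * (mehler r x z * g z) \<partial>lborel) = (\<integral>z. normal_density (r * x) s z * g z \<partial>lborel)"
    by (simp add: std_mult_mehler s_def mult.assoc[symmetric])
  also have "\<dots> = s * (\<integral>y. normal_density (r * x) s (r * x + s * y) * g (r * x + s * y) \<partial>lborel)"
    using lborel_integral_real_affine[of s "\<lambda>z. normal_density (r * x) s z * g z" "r * x"] s by simp
  also have "\<dots> = (\<integral>y. s * (normal_density (r * x) s (r * x + s * y) * g (r * x + s * y)) \<partial>lborel)"
    by simp
  also have "\<dots> = (\<integral>y. std_normal_density y * g (r * x + s * y) \<partial>lborel)"
  proof -
    have "s * normal_density (r * x) s (r * x + s * y) = std_normal_density y" for y
      using s by (simp add: normal_density_def real_sqrt_mult power_mult_distrib)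
    then show ?thesis by (simp add: mult.assoc[symmetric])
  qed
  also have "\<dots> = (\<integral>y. g (r * x + s * y) \<partial>density lborel (\<lambda>x. ennreal (std_normal_density x)))"
    by (subst integral_density) auto
  finally show ?thesis by (simp add: s_def)
qed

text \<open>For small \<open>r\<close> the operator is a strong contraction from L2 to L4 on functions of mean zero,
  because the kernel minus 1 has a small Hilbert-Schmidt type norm. The expansion of
  $(a + h)^4$ with mean \<open>a\<close> then gives the constant exactly 1 that tensorization requires.\<close>

lemma noise_std_L4:
  fixes f :: "real \<Rightarrow> real"
  defines "S \<equiv> density lborel (\<lambda>x. ennreal (std_normal_density x))"
  assumes f: "f \<in> borel_measurable borel" "\<And>x. 0 \<le> f x \<and> f x \<le> 1" and r: "r\<^sup>2 \<le> 1 / 16"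
  shows "(\<integral>x. (\<integral>y. f (r * x + sqrt (1 - r\<^sup>2) * y) \<partial>S) ^ 4 \<partial>S) \<le> (\<integral>x. (f x)\<^sup>2 \<partial>S)\<^sup>2"
proof -
  interpret rotation_invariant S "std_normal_density"
    unfolding S_def by (rule rotation_invariant_normal) simp
  note [measurable] = f(1)
  define s where "s = sqrt (1 - r\<^sup>2)"
  have s: "r\<^sup>2 + s\<^sup>2 = 1" "s \<noteq> 0" using r by (auto simp: s_def)
  have r1: "r\<^sup>2 < 1" using r by simp
  have uf: "unit_valued f" using f by (auto simp: unit_valued_def)
  have u1: "unit_valued (\<lambda>x. 1)" by (auto simp: unit_valued_def)
  define a where "a = (\<integral>x. f x \<partial>S)"
  have a: "0 \<le> a" "a \<le> 1"
    using N.integral_unit_valued[of f] f by (auto simp: a_def)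
  define V where "V = (\<integral>x. (f x - a)\<^sup>2 \<partial>S)"
  have int_f: "integrable S f" "integrable S (\<lambda>x. (f x)\<^sup>2)"
    by (rule N.integrable_unit_valued; use f in \<open>auto simp: power_le_one\<close>)+
  have V: "(\<integral>x. (f x)\<^sup>2 \<partial>S) = a\<^sup>2 + V"
  proof -
    have "V = (\<integral>x. (f x)\<^sup>2 - 2 * a * f x + a\<^sup>2 \<partial>S)"
      unfolding V_def by (rule Bochner_Integration.integral_cong) (auto simp: power2_eq_square algebra_simps)
    also have "\<dots> = (\<integral>x. (f x)\<^sup>2 \<partial>S) - 2 * a * a + a\<^sup>2"
      using int_f by (simp add: a_def)
    finally show ?thesis by (simp add: power2_eq_square)
  qed
  have V0: "V \<ge> 0" unfolding V_def by (rule integral_nonneg_AE) simp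
  define h where "h = (\<lambda>x. noise r s f x - a)"
  note uT = unit_valued_noise[OF uf, of r s]
  have [measurable]: "noise r s f \<in> borel_measurable borel" using uT by (simp add: unit_valued_def)
  have [measurable]: "h \<in> borel_measurable borel" unfolding h_def by measurable
  have h_bound: "\<bar>h x\<bar> \<le> 1" for x
  proof -
    have "0 \<le> noise r s f x" "noise r s f x \<le> 1" using uT by (auto simp: unit_valued_def)
    then show ?thesis using a unfolding h_def by linarith
  qed
  have int_h: "integrable S (\<lambda>x. h x ^ n)" for n
    by (rule N.integrable_const_bound[of _ 1]) (use h_bound in \<open>auto simp: power_abs power_le_one\<close>)
  have mean_h: "(\<integral>x. h x \<partial>S) = 0"
  proof -
    have "(\<integral>x. noise r s f x \<partial>S) = corr r s (\<lambda>_. 1) f"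
      by (simp add: corr_eq_noise[OF u1 uf])
    also have "\<dots> = (\<integral>p. f (fst p) \<partial>(S \<Otimes>\<^sub>M S))"
      unfolding corr_def by (simp add: integral_rotate[OF s, of "\<lambda>p. f (fst p)", simplified])
    also have "\<dots> = a"
      using f by (subst integral_pair_unit_valued) (auto simp: a_def)
    finally have "(\<integral>x. noise r s f x \<partial>S) = a" .
    moreover have "integrable S (noise r s f)"
      by (rule N.integrable_unit_valued) (use uT in \<open>auto simp: unit_valued_def\<close>)
    ultimately show ?thesis by (simp add: h_def)
  qed
  have S_transfer: "integrable S g \<and> (\<integral>x. g x \<partial>S) = I"
    if "g \<in> borel_measurable borel" "has_bochner_integral lborel (\<lambda>x. std_normal_density x * g x) I"
    for g :: "real \<Rightarrow> real" and I
    using that by (simp add: S_def integrable_density integral_density has_bochner_integral_iff)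
  have pos: "1 + r\<^sup>2 > 0" "1 + r\<^sup>2 \<noteq> 0" by (auto simp: add_pos_nonneg add_nonneg_eq_0_iff)
  define K where "K = mehler_sq r"
  have [measurable]: "K \<in> borel_measurable borel" unfolding K_def mehler_sq_def by measurable
  \<comment> \<open>The kernel has integral 1 and \<open>f z - a\<close> has integral 0, so
    \<open>h x\<close> is the integral of the product of both centred factors. Cauchy-Schwarz then
    bounds it by the variance of \<open>f\<close> times that of the kernel.\<close>
  have h_sq: "(h x)\<^sup>2 \<le> V * (K x - 1)" for x
  proof -
    let ?k = "mehler r x"
    have ik2: "integrable S (\<lambda>z. (?k z)\<^sup>2)" and k2: "(\<integral>z. (?k z)\<^sup>2 \<partial>S) = K x"
      using integral_mehler_sq[OF r1, of x]
      by (simp_all add: S_def integrable_density integral_density has_bochner_integral_iff K_def)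
    have ik: "integrable S ?k" and k1: "(\<integral>z. ?k z \<partial>S) = 1"
      using r1 by (simp_all add: S_def integrable_density integral_density std_mult_mehler)
    have ik1: "integrable S (\<lambda>z. (?k z - 1)\<^sup>2)" and k12: "(\<integral>z. (?k z - 1)\<^sup>2 \<partial>S) = K x - 1"
      using ik2 ik k1 k2 by (simp_all add: power2_diff)
    have if2: "integrable S (\<lambda>z. (f z - a)\<^sup>2)"
      using int_f by (simp add: power2_diff)
    have if1: "integrable S (\<lambda>z. f z - a)" using int_f by simp
    have ifk: "integrable S (\<lambda>z. (f z - a) * (?k z - 1))"
      and ineq: "(\<integral>z. (f z - a) * (?k z - 1) \<partial>S)\<^sup>2 \<le> V * (K x - 1)"
      using Cauchy_Schwarz_integral[OF _ _ if2 ik1] by (simp_all add: V_def k12)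
    have "h x = (\<integral>z. ?k z * f z \<partial>S) - a"
      unfolding h_def noise_def s_def real_scaleR_def
      by (simp add: S_def integral_affine_std[OF f(1) r1] integral_density)
    also have "(\<lambda>z. ?k z * f z) = (\<lambda>z. (f z - a) * (?k z - 1) + a * ?k z + (f z - a))"
      by (simp add: fun_eq_iff algebra_simps)
    also have "(\<integral>z. (f z - a) * (?k z - 1) + a * ?k z + (f z - a) \<partial>S) - a = (\<integral>z. (f z - a) * (?k z - 1) \<partial>S)"
      using ifk ik if1 int_f(1) k1 by (simp add: a_def[symmetric])
    finally show ?thesis using ineq by simp
  qed
  have EK: "integrable S K" "(\<integral>x. K x \<partial>S) = 1 / (1 - r\<^sup>2)"
  proof -
    have l: "1 - 2 * (r\<^sup>2 / (1 + r\<^sup>2)) = (1 - r\<^sup>2) / (1 + r\<^sup>2)"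
      using pos by (simp add: field_simps)
    have "has_bochner_integral lborel (\<lambda>x. std_normal_density x * exp (r\<^sup>2 / (1 + r\<^sup>2) * x\<^sup>2)) (1 / sqrt ((1 - r\<^sup>2) / (1 + r\<^sup>2)))"
      using integral_exp_square_normal[of 1 "r\<^sup>2 / (1 + r\<^sup>2)"] r1 using pos unfolding l[symmetric]
      by (simp add: field_simps)
    then have "has_bochner_integral lborel (\<lambda>x. std_normal_density x * exp (r\<^sup>2 / (1 + r\<^sup>2) * x\<^sup>2) / sqrt (1 - r ^ 4)) (1 / sqrt ((1 - r\<^sup>2) / (1 + r\<^sup>2)) / sqrt (1 - r ^ 4))"
      by (rule has_bochner_integral_divide_zero)
    moreover have "1 / sqrt ((1 - r\<^sup>2) / (1 + r\<^sup>2)) / sqrt (1 - r ^ 4) = 1 / (1 - r\<^sup>2)"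
    proof -
      have "sqrt ((1 - r\<^sup>2) / (1 + r\<^sup>2)) * sqrt (1 - r ^ 4) = sqrt ((1 - r\<^sup>2)\<^sup>2)"
      proof -
        have "1 - r ^ 4 = (1 - r\<^sup>2) * (1 + r\<^sup>2)" by (simp add: algebra_simps flip: power_add)
        then show ?thesis by (simp add: real_sqrt_mult[symmetric] power2_eq_square pos[unfolded power2_eq_square])
      qed
      then show ?thesis using r1 by simp
    qed
    ultimately have "has_bochner_integral lborel (\<lambda>x. std_normal_density x * K x) (1 / (1 - r\<^sup>2))"
      by (simp add: K_def mehler_sq_def)
    from S_transfer[OF _ this] show "integrable S K" "(\<integral>x. K x \<partial>S) = 1 / (1 - r\<^sup>2)" by simp_all
  qed
  have EK2: "integrable S (\<lambda>x. (K x)\<^sup>2)" "(\<integral>x. (K x)\<^sup>2 \<partial>S) \<le> 4 / 3"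
  proof -
    have l: "1 - 2 * (2 * (r\<^sup>2 / (1 + r\<^sup>2))) = (1 - 3 * r\<^sup>2) / (1 + r\<^sup>2)"
      using pos by (simp add: field_simps)
    have "has_bochner_integral lborel (\<lambda>x. std_normal_density x * exp (2 * (r\<^sup>2 / (1 + r\<^sup>2)) * x\<^sup>2)) (1 / sqrt ((1 - 3 * r\<^sup>2) / (1 + r\<^sup>2)))"
      using integral_exp_square_normal[of 1 "2 * (r\<^sup>2 / (1 + r\<^sup>2))"] r using pos unfolding l[symmetric]
      by (simp add: field_simps)
    then have *: "has_bochner_integral lborel (\<lambda>x. std_normal_density x * exp (2 * (r\<^sup>2 / (1 + r\<^sup>2)) * x\<^sup>2) / (1 - r ^ 4)) (1 / sqrt ((1 - 3 * r\<^sup>2) / (1 + r\<^sup>2)) / (1 - r ^ 4))"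
      by (rule has_bochner_integral_divide_zero)
    have r4: "r ^ 4 \<le> 1 / 256"
      using power_mono[OF r, of 2] by (simp add: power_divide)
    have "(mehler_sq r x)\<^sup>2 = exp (2 * (r\<^sup>2 / (1 + r\<^sup>2)) * x\<^sup>2) / (1 - r ^ 4)" for x
      using r4 by (simp add: mehler_sq_def power_divide exp_double[symmetric] mult.assoc)
    then have i: "integrable S (\<lambda>x. (K x)\<^sup>2)" "(\<integral>x. (K x)\<^sup>2 \<partial>S) = 1 / sqrt ((1 - 3 * r\<^sup>2) / (1 + r\<^sup>2)) / (1 - r ^ 4)"
      using S_transfer[OF _ *[folded times_divide_eq_right]] by (simp_all add: K_def)
    show "integrable S (\<lambda>x. (K x)\<^sup>2)" by fact
    \<comment> \<open>For \<open>r\<^sup>2 \<le> 1 / 16\<close> the quotient is at least 13/17,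
      hence above 16/25, and 4/5 times 15/16 is 3/4, the inverse of the claimed bound.\<close>
    have "(1 - 3 * r\<^sup>2) / (1 + r\<^sup>2) \<ge> (4 / 5)\<^sup>2"
      using r pos by (simp add: field_simps power2_eq_square)
    then have "sqrt ((1 - 3 * r\<^sup>2) / (1 + r\<^sup>2)) \<ge> 4 / 5"
      by (rule real_le_rsqrt)
    moreover have "1 - r ^ 4 \<ge> 15 / 16" using r4 by simp
    ultimately have "sqrt ((1 - 3 * r\<^sup>2) / (1 + r\<^sup>2)) * (1 - r ^ 4) \<ge> (4 / 5) * (15 / 16)"
      by (intro mult_mono) linarith+
    then show "(\<integral>x. (K x)\<^sup>2 \<partial>S) \<le> 4 / 3"
      unfolding i(2) divide_divide_eq_left by (simp add: field_simps) 
  qed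
  have EK_bounds: "1 \<le> (\<integral>x. K x \<partial>S)" "(\<integral>x. K x \<partial>S) \<le> 5 / 4"
    unfolding EK(2) using r r1 by (simp_all add: field_simps)
  have h2: "(\<integral>x. (h x)\<^sup>2 \<partial>S) \<le> V / 4"
  proof -
    have "(\<integral>x. (h x)\<^sup>2 \<partial>S) \<le> (\<integral>x. V * (K x - 1) \<partial>S)"
      by (rule integral_mono) (use h_sq int_h EK in auto)
    also have "\<dots> = V * ((\<integral>x. K x \<partial>S) - 1)" using EK(1) by simp
    also have "\<dots> \<le> V * (1 / 4)" by (rule mult_left_mono) (use V0 EK_bounds in auto)
    finally show ?thesis by simp
  qed
  have h4: "(\<integral>x. (h x) ^ 4 \<partial>S) \<le> V\<^sup>2 / 3"
  proof -
    have "(\<integral>x. (h x) ^ 4 \<partial>S) \<le> (\<integral>x. V\<^sup>2 * ((K x)\<^sup>2 - 2 * K x + 1) \<partial>S)"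
    proof (rule integral_mono)
      fix x
      have "h x ^ 4 = ((h x)\<^sup>2)\<^sup>2" by simp
      also have "\<dots> \<le> (V * (K x - 1))\<^sup>2" by (rule power_mono[OF h_sq]) simp
      also have "\<dots> = V\<^sup>2 * ((K x)\<^sup>2 - 2 * K x + 1)" by (simp add: power2_eq_square algebra_simps)
      finally show "h x ^ 4 \<le> V\<^sup>2 * ((K x)\<^sup>2 - 2 * K x + 1)" .
    qed (use int_h EK EK2 in auto)
    also have "\<dots> = V\<^sup>2 * ((\<integral>x. (K x)\<^sup>2 \<partial>S) - 2 * (\<integral>x. K x \<partial>S) + 1)" using EK(1) EK2(1) by simp
    also have "\<dots> \<le> V\<^sup>2 * (1 / 3)" by (rule mult_left_mono) (use EK2 EK_bounds in auto)
    finally show ?thesis by simp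
  qed
  have "(\<integral>x. noise r s f x ^ 4 \<partial>S) \<le> (\<integral>x. a ^ 4 + 4 * a ^ 3 * h x + 8 * a\<^sup>2 * (h x)\<^sup>2 + 3 * h x ^ 4 \<partial>S)"
  proof (rule integral_mono)
    show "integrable S (\<lambda>x. noise r s f x ^ 4)"
      by (rule N.integrable_unit_valued) (use uT in \<open>auto simp: unit_valued_def power_le_one\<close>)
    fix x
    define y where "y = h x"
    \<comment> \<open>In the expansion of \<open>(a + y) ^ 4\<close> the cubic term has no sign. It
      is absorbed by 4 a y^3 \<le> 2 a^2 y^2 + 2 y^4; the linear term is kept since it integrates to
      0.\<close>
    have "0 \<le> 2 * (y * (a - y))\<^sup>2" by simp
    also have "2 * (y * (a - y))\<^sup>2 = a ^ 4 + 4 * a ^ 3 * y + 8 * a\<^sup>2 * y\<^sup>2 + 3 * y ^ 4 - (a + y) ^ 4"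
      by (simp add: power2_eq_square power3_eq_cube power4_eq_xxxx algebra_simps)
    finally have "(a + y) ^ 4 \<le> a ^ 4 + 4 * a ^ 3 * y + 8 * a\<^sup>2 * y\<^sup>2 + 3 * y ^ 4" by simp
    then show "noise r s f x ^ 4 \<le> a ^ 4 + 4 * a ^ 3 * h x + 8 * a\<^sup>2 * (h x)\<^sup>2 + 3 * h x ^ 4"
      by (simp add: y_def h_def)
  qed (use int_h[of 1] int_h[of 2] int_h[of 4] in auto)
  also have "\<dots> = a ^ 4 + 8 * a\<^sup>2 * (\<integral>x. (h x)\<^sup>2 \<partial>S) + 3 * (\<integral>x. (h x) ^ 4 \<partial>S)"
    using int_h[of 1] int_h[of 2] int_h[of 4] by (simp add: mean_h)
  \<comment> \<open>The factors 1/4 in \<open>h2\<close> and 1/3 in \<open>h4\<close> are just what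
    turns the sum into the perfect square of \<open>a\<^sup>2 + V\<close>.\<close>
  also have "\<dots> \<le> a ^ 4 + 8 * a\<^sup>2 * (V / 4) + 3 * (V\<^sup>2 / 3)"
    by (intro add_mono mult_left_mono h2 h4) auto
  also have "\<dots> = (a\<^sup>2 + V)\<^sup>2" by (simp add: power2_eq_square power4_eq_xxxx algebra_simps)
  finally show ?thesis by (simp add: V noise_def s_def)
qed

section \<open>Tensorization\<close>

text \<open>Fubini with the two middle integrations exchanged: two copies of a product space become
  two copies of each factor, which suits operators that act coordinatewise.\<close>

lemma integral_pair_exchange:
  fixes F :: "('a \<times> 'b) \<times> ('a \<times> 'b) \<Rightarrow> real"
  assumes "prob_space M1" "prob_space M2"
    and F [measurable]: "F \<in> borel_measurable ((M1 \<Otimes>\<^sub>M M2) \<Otimes>\<^sub>M (M1 \<Otimes>\<^sub>M M2))"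
    and F01: "\<And>p. 0 \<le> F p \<and> F p \<le> 1"
  shows "(\<integral>p. F p \<partial>((M1 \<Otimes>\<^sub>M M2) \<Otimes>\<^sub>M (M1 \<Otimes>\<^sub>M M2))) =
    (\<integral>p. (\<integral>q. F ((fst p, fst q), (snd p, snd q)) \<partial>(M2 \<Otimes>\<^sub>M M2)) \<partial>(M1 \<Otimes>\<^sub>M M1))"
proof -
  interpret M1: prob_space M1 by fact
  interpret M2: prob_space M2 by fact
  interpret P12: pair_prob_space M1 M2 ..
  interpret P21: pair_prob_space M2 M1 ..
  interpret P11: pair_prob_space M1 M1 ..
  interpret P22: pair_prob_space M2 M2 ..
  interpret PP: pair_prob_space "M1 \<Otimes>\<^sub>M M2" "M1 \<Otimes>\<^sub>M M2" ..
  define G where "G = (\<lambda>x. \<integral>y. F (x, y) \<partial>(M1 \<Otimes>\<^sub>M M2))"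
  have [measurable]: "G \<in> borel_measurable (M1 \<Otimes>\<^sub>M M2)" unfolding G_def by measurable
  have "(\<integral>p. F p \<partial>((M1 \<Otimes>\<^sub>M M2) \<Otimes>\<^sub>M (M1 \<Otimes>\<^sub>M M2))) = (\<integral>x. G x \<partial>(M1 \<Otimes>\<^sub>M M2))"
    unfolding G_def by (rule PP.integral_pair_unit_valued(1)[OF F F01])
  also have "\<dots> = (\<integral>x1. (\<integral>x2. G (x1, x2) \<partial>M2) \<partial>M1)"
    by (rule P12.integral_pair_unit_valued(1)) (use F01 P12.integral_unit_valued in \<open>auto simp: G_def\<close>)
  also have "\<dots> = (\<integral>x1. (\<integral>y1. (\<integral>q. F ((x1, fst q), (y1, snd q)) \<partial>(M2 \<Otimes>\<^sub>M M2)) \<partial>M1) \<partial>M1)"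
  proof (rule Bochner_Integration.integral_cong[OF refl])
    fix x1 assume [measurable]: "x1 \<in> space M1"
    have "(\<integral>x2. G (x1, x2) \<partial>M2) = (\<integral>x2. (\<integral>y1. (\<integral>y2. F ((x1, x2), (y1, y2)) \<partial>M2) \<partial>M1) \<partial>M2)"
    proof (rule Bochner_Integration.integral_cong[OF refl])
      fix x2 assume [measurable]: "x2 \<in> space M2"
      show "G (x1, x2) = (\<integral>y1. (\<integral>y2. F ((x1, x2), (y1, y2)) \<partial>M2) \<partial>M1)"
        unfolding G_def by (rule P12.integral_pair_unit_valued(1)) (use F01 in auto)
    qed
    also have "\<dots> = (\<integral>y1. (\<integral>x2. (\<integral>y2. F ((x1, x2), (y1, y2)) \<partial>M2) \<partial>M2) \<partial>M1)"
    proof -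
      let ?H = "\<lambda>p. \<integral>y2. F ((x1, fst p), (snd p, y2)) \<partial>M2"
      have m: "?H \<in> borel_measurable (M2 \<Otimes>\<^sub>M M1)" by measurable
      have b: "0 \<le> ?H p \<and> ?H p \<le> 1" for p by (rule M2.integral_unit_valued) (rule F01)
      show ?thesis
        using P21.integral_pair_unit_valued[OF m b] by simp
    qed
    also have "\<dots> = (\<integral>y1. (\<integral>q. F ((x1, fst q), (y1, snd q)) \<partial>(M2 \<Otimes>\<^sub>M M2)) \<partial>M1)"
    proof (rule Bochner_Integration.integral_cong[OF refl])
      fix y1 assume [measurable]: "y1 \<in> space M1"
      have m: "(\<lambda>q. F ((x1, fst q), (y1, snd q))) \<in> borel_measurable (M2 \<Otimes>\<^sub>M M2)" by measurable
      show "(\<integral>x2. (\<integral>y2. F ((x1, x2), (y1, y2)) \<partial>M2) \<partial>M2) = (\<integral>q. F ((x1, fst q), (y1, snd q)) \<partial>(M2 \<Otimes>\<^sub>M M2))"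
        using P22.integral_pair_unit_valued(1)[OF m F01] by simp
    qed
    finally show "(\<integral>x2. G (x1, x2) \<partial>M2) = (\<integral>y1. (\<integral>q. F ((x1, fst q), (y1, snd q)) \<partial>(M2 \<Otimes>\<^sub>M M2)) \<partial>M1)" .
  qed
  also have "\<dots> = (\<integral>p. (\<integral>q. F ((fst p, fst q), (snd p, snd q)) \<partial>(M2 \<Otimes>\<^sub>M M2)) \<partial>(M1 \<Otimes>\<^sub>M M1))"
  proof -
    let ?H = "\<lambda>p. \<integral>q. F ((fst p, fst q), (snd p, snd q)) \<partial>(M2 \<Otimes>\<^sub>M M2)"
    have m: "?H \<in> borel_measurable (M1 \<Otimes>\<^sub>M M1)" by measurable
    have b: "0 \<le> ?H p \<and> ?H p \<le> 1" for p by (rule P22.integral_unit_valued) (rule F01)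
    show ?thesis
      using P11.integral_pair_unit_valued(1)[OF m b] by simp
  qed
  finally show ?thesis .
qed

text \<open>The bilinear form of the statement that the operator $f \mapsto E_y\, f(T(\cdot, y))$ is
  a contraction from L2 to L4, tested against \<open>v ^ 3\<close> so that only integer powers occur.\<close>

definition hypercontractive :: "'a measure \<Rightarrow> ('a \<Rightarrow> 'a \<Rightarrow> 'a) \<Rightarrow> bool" where
  "hypercontractive M T \<longleftrightarrow>
     (\<forall>v f. v \<in> borel_measurable M \<longrightarrow> f \<in> borel_measurable M \<longrightarrow>
        (\<forall>x. 0 \<le> v x \<and> v x \<le> (1 :: real)) \<longrightarrow> (\<forall>x. 0 \<le> f x \<and> f x \<le> (1 :: real)) \<longrightarrow>
        (\<integral>p. v (fst p) ^ 3 * f (T (fst p) (snd p)) \<partial>(M \<Otimes>\<^sub>M M)) ^ 4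
          \<le> (\<integral>x. v x ^ 4 \<partial>M) ^ 3 * (\<integral>x. (f x)\<^sup>2 \<partial>M)\<^sup>2)"

text \<open>The inequality of the second factor is applied to slices with the first coordinates
  fixed, and that of the first factor to the norms of the slices. The constants multiply, so only
  the constant 1 survives arbitrarily many factors.\<close>

lemma hypercontractive_pair:
  assumes M1: "prob_space M1" and M2: "prob_space M2"
    and T1 [measurable]: "case_prod T1 \<in> M1 \<Otimes>\<^sub>M M1 \<rightarrow>\<^sub>M M1"
    and T2 [measurable]: "case_prod T2 \<in> M2 \<Otimes>\<^sub>M M2 \<rightarrow>\<^sub>M M2"
    and H1: "hypercontractive M1 T1" and H2: "hypercontractive M2 T2"
  shows "hypercontractive (M1 \<Otimes>\<^sub>M M2) (\<lambda>x y. (T1 (fst x) (fst y), T2 (snd x) (snd y)))"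
  unfolding hypercontractive_def
proof (intro allI impI)
  fix v f :: "'a \<times> 'b \<Rightarrow> real"
  assume [measurable]: "v \<in> borel_measurable (M1 \<Otimes>\<^sub>M M2)" "f \<in> borel_measurable (M1 \<Otimes>\<^sub>M M2)"
    and v01: "\<forall>x. 0 \<le> v x \<and> v x \<le> 1" and f01: "\<forall>x. 0 \<le> f x \<and> f x \<le> 1"
  interpret M1: prob_space M1 by fact
  interpret M2: prob_space M2 by fact
  interpret P12: pair_prob_space M1 M2 ..
  interpret P11: pair_prob_space M1 M1 ..
  interpret P22: pair_prob_space M2 M2 ..
  \<comment> \<open>The L4 norm of a slice of \<open>v\<close>; \<Phi> is the L2 norm of a slice of
    \<open>f\<close>. Both again take values in [0,1], as the hypothesis on \<open>M1\<close>
    demands.\<close>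
  define V where "V = (\<lambda>x. root 4 (\<integral>y. v (x, y) ^ 4 \<partial>M2))"
  define \<Phi> where "\<Phi> = (\<lambda>x. sqrt (\<integral>y. (f (x, y))\<^sup>2 \<partial>M2))"
  have v4: "0 \<le> (\<integral>y. v (x, y) ^ 4 \<partial>M2) \<and> (\<integral>y. v (x, y) ^ 4 \<partial>M2) \<le> 1" for x
    by (rule M2.integral_unit_valued) (use v01 in \<open>auto simp: power_le_one\<close>)
  have f2: "0 \<le> (\<integral>y. (f (x, y))\<^sup>2 \<partial>M2) \<and> (\<integral>y. (f (x, y))\<^sup>2 \<partial>M2) \<le> 1" for x
    by (rule M2.integral_unit_valued) (use f01 in \<open>auto simp: power_le_one\<close>)
  have V4: "V x ^ 4 = (\<integral>y. v (x, y) ^ 4 \<partial>M2)" for x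
    using v4 by (simp add: V_def)
  have F2: "(\<Phi> x)\<^sup>2 = (\<integral>y. (f (x, y))\<^sup>2 \<partial>M2)" for x
    using f2 by (simp add: \<Phi>_def)
  have V01: "0 \<le> V x \<and> V x \<le> 1" for x
    using v4 by (simp add: V_def)
  have F01: "0 \<le> \<Phi> x \<and> \<Phi> x \<le> 1" for x
    using f2 by (simp add: \<Phi>_def)
  have [measurable]: "V \<in> borel_measurable M1" "\<Phi> \<in> borel_measurable M1"
    unfolding V_def \<Phi>_def by measurable
  let ?F = "\<lambda>p. v (fst p) ^ 3 * f (T1 (fst (fst p)) (fst (snd p)), T2 (snd (fst p)) (snd (snd p)))"
  let ?J = "\<lambda>p. \<integral>q. v (fst p, fst q) ^ 3 * f (T1 (fst p) (snd p), T2 (fst q) (snd q)) \<partial>(M2 \<Otimes>\<^sub>M M2)"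
  have eq: "(\<integral>p. ?F p \<partial>((M1 \<Otimes>\<^sub>M M2) \<Otimes>\<^sub>M (M1 \<Otimes>\<^sub>M M2))) = (\<integral>p. ?J p \<partial>(M1 \<Otimes>\<^sub>M M1))"
    by (subst integral_pair_exchange[OF M1 M2]) (use v01 f01 in \<open>auto simp: power_le_one mult_le_one\<close>)
  have J0: "0 \<le> ?J p \<and> ?J p \<le> 1" for p
    by (rule P22.integral_unit_valued) (use v01 f01 in \<open>auto simp: power_le_one mult_le_one\<close>)
  have J: "?J p \<le> V (fst p) ^ 3 * \<Phi> (T1 (fst p) (snd p))" if "p \<in> space (M1 \<Otimes>\<^sub>M M1)" for p
  proof -
    have [measurable]: "fst p \<in> space M1" "T1 (fst p) (snd p) \<in> space M1"
      using that measurable_space[OF T1 that] by (auto simp: space_pair_measure split_beta)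
    have "?J p ^ 4 \<le> (\<integral>x. v (fst p, x) ^ 4 \<partial>M2) ^ 3 * (\<integral>x. (f (T1 (fst p) (snd p), x))\<^sup>2 \<partial>M2)\<^sup>2"
      using H2[unfolded hypercontractive_def, rule_format, of "\<lambda>x. v (fst p, x)" "\<lambda>x. f (T1 (fst p) (snd p), x)"] v01 f01
      by simp
    also have "\<dots> = (V (fst p) ^ 3 * \<Phi> (T1 (fst p) (snd p))) ^ 4"
      unfolding V4[symmetric] F2[symmetric] by (simp add: power_mult_distrib flip: power_mult)
    finally show ?thesis
      by (rule power_le_imp_le_base[of _ 3, simplified]) (use V01 F01 in auto)
  qed
  have "(\<integral>p. ?J p \<partial>(M1 \<Otimes>\<^sub>M M1)) \<le> (\<integral>p. V (fst p) ^ 3 * \<Phi> (T1 (fst p) (snd p)) \<partial>(M1 \<Otimes>\<^sub>M M1))"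
  proof (rule integral_mono[OF _ _ J])
    show "integrable (M1 \<Otimes>\<^sub>M M1) ?J" by (rule P11.integrable_unit_valued) (use J0 in auto)
    show "integrable (M1 \<Otimes>\<^sub>M M1) (\<lambda>p. V (fst p) ^ 3 * \<Phi> (T1 (fst p) (snd p)))"
      by (rule P11.integrable_unit_valued) (use V01 F01 in \<open>auto simp: power_le_one mult_le_one\<close>)
  qed
  then have "(\<integral>p. ?J p \<partial>(M1 \<Otimes>\<^sub>M M1)) ^ 4 \<le> (\<integral>p. V (fst p) ^ 3 * \<Phi> (T1 (fst p) (snd p)) \<partial>(M1 \<Otimes>\<^sub>M M1)) ^ 4"
    by (rule power_mono) (use P11.integral_unit_valued[of ?J] J0 in auto)
  also have "\<dots> \<le> (\<integral>x. V x ^ 4 \<partial>M1) ^ 3 * (\<integral>x. (\<Phi> x)\<^sup>2 \<partial>M1)\<^sup>2"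
    using H1[unfolded hypercontractive_def, rule_format, of V \<Phi>] V01 F01 by simp
  also have "(\<integral>x. V x ^ 4 \<partial>M1) = (\<integral>x. v x ^ 4 \<partial>(M1 \<Otimes>\<^sub>M M2))"
    unfolding V4 by (subst P12.integral_pair_unit_valued(1)) (use v01 in \<open>auto simp: power_le_one\<close>)
  also have "(\<integral>x. (\<Phi> x)\<^sup>2 \<partial>M1) = (\<integral>x. (f x)\<^sup>2 \<partial>(M1 \<Otimes>\<^sub>M M2))"
    unfolding F2 by (subst P12.integral_pair_unit_valued(1)) (use f01 in \<open>auto simp: power_le_one\<close>)
  finally show "(\<integral>p. v (fst p) ^ 3 * f (T1 (fst (fst p)) (fst (snd p)), T2 (snd (fst p)) (snd (snd p))) \<partial>((M1 \<Otimes>\<^sub>M M2) \<Otimes>\<^sub>M (M1 \<Otimes>\<^sub>M M2))) ^ 4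
      \<le> (\<integral>x. v x ^ 4 \<partial>(M1 \<Otimes>\<^sub>M M2)) ^ 3 * (\<integral>x. (f x)\<^sup>2 \<partial>(M1 \<Otimes>\<^sub>M M2))\<^sup>2"
    unfolding eq .
qed

text \<open>A measure preserving \<phi> that intertwines the two operations carries the inequality
  along. It serves for rescaling the line, for adding a coordinate to a product, and for passing
  from functions to vectors.\<close>

lemma hypercontractive_transport:
  assumes M: "prob_space M" and \<phi> [measurable]: "\<phi> \<in> M \<rightarrow>\<^sub>M M'" and M': "distr M M' \<phi> = M'"
    and T' [measurable]: "case_prod T' \<in> M' \<Otimes>\<^sub>M M' \<rightarrow>\<^sub>M M'"
    and T: "\<And>x y. x \<in> space M \<Longrightarrow> y \<in> space M \<Longrightarrow> T' (\<phi> x) (\<phi> y) = \<phi> (T x y)"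
    and H: "hypercontractive M T"
  shows "hypercontractive M' T'"
  unfolding hypercontractive_def
proof (intro allI impI)
  fix v f :: "'b \<Rightarrow> real"
  assume [measurable]: "v \<in> borel_measurable M'" "f \<in> borel_measurable M'"
    and v01: "\<forall>x. 0 \<le> v x \<and> v x \<le> 1" and f01: "\<forall>x. 0 \<le> f x \<and> f x \<le> 1"
  interpret M: prob_space M by fact
  have i: "(\<integral>x. g x \<partial>M') = (\<integral>x. g (\<phi> x) \<partial>M)" if "g \<in> borel_measurable M'" for g :: "'b \<Rightarrow> real"
    using integral_distr[OF \<phi> that] by (simp add: M')
  have d: "M' \<Otimes>\<^sub>M M' = distr (M \<Otimes>\<^sub>M M) (M' \<Otimes>\<^sub>M M') (\<lambda>(x, y). (\<phi> x, \<phi> y))"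
  proof -
    have "sigma_finite_measure (distr M M' \<phi>)"
      using M.prob_space_distr[OF \<phi>] by (rule prob_space_imp_sigma_finite)
    from pair_measure_distr[OF \<phi> \<phi> this] show ?thesis by (simp add: M')
  qed
  have "(\<integral>p. v (fst p) ^ 3 * f (T' (fst p) (snd p)) \<partial>(M' \<Otimes>\<^sub>M M'))
    = (\<integral>p. v (\<phi> (fst p)) ^ 3 * f (T' (\<phi> (fst p)) (\<phi> (snd p))) \<partial>(M \<Otimes>\<^sub>M M))"
    by (subst d, subst integral_distr) (auto simp: split_beta)
  also have "\<dots> = (\<integral>p. v (\<phi> (fst p)) ^ 3 * f (\<phi> (T (fst p) (snd p))) \<partial>(M \<Otimes>\<^sub>M M))"
    by (rule Bochner_Integration.integral_cong[OF refl]) (auto simp: space_pair_measure T)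
  finally show "(\<integral>p. v (fst p) ^ 3 * f (T' (fst p) (snd p)) \<partial>(M' \<Otimes>\<^sub>M M')) ^ 4
      \<le> (\<integral>x. v x ^ 4 \<partial>M') ^ 3 * (\<integral>x. (f x)\<^sup>2 \<partial>M')\<^sup>2"
    using H[unfolded hypercontractive_def, rule_format, of "\<lambda>x. v (\<phi> x)" "\<lambda>x. f (\<phi> x)"] v01 f01
    by (simp add: i)
qed

text \<open>Hoelder converts the bound on the L4 norm into the bilinear form that
  tensorizes.\<close>

lemma hypercontractive_std_normal:
  assumes r: "r\<^sup>2 \<le> 1 / 16"
  shows "hypercontractive (density lborel (\<lambda>x. ennreal (std_normal_density x))) (\<lambda>x y. r * x + sqrt (1 - r\<^sup>2) * y)"
    (is "hypercontractive ?S _")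
  unfolding hypercontractive_def
proof (intro allI impI)
  interpret rotation_invariant ?S "std_normal_density"
    by (rule rotation_invariant_normal) simp
  fix v f :: "real \<Rightarrow> real"
  assume "v \<in> borel_measurable ?S" "f \<in> borel_measurable ?S"
    and v01: "\<forall>x. 0 \<le> v x \<and> v x \<le> 1" and f01: "\<forall>x. 0 \<le> f x \<and> f x \<le> 1"
  then have [measurable]: "v \<in> borel_measurable borel" "f \<in> borel_measurable borel"
    by simp_all
  define s where "s = sqrt (1 - r\<^sup>2)"
  have uf: "unit_valued f" and uv: "unit_valued (\<lambda>x. v x ^ 3)"
    using v01 f01 by (auto simp: unit_valued_def power_le_one)
  note uT = unit_valued_noise[OF uf, of r s]
  have "(\<integral>p. v (fst p) ^ 3 * f (r * fst p + s * snd p) \<partial>(?S \<Otimes>\<^sub>M ?S)) ^ 4 = corr r s (\<lambda>x. v x ^ 3) f ^ 4"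
    by (simp add: corr_def)
  also have "\<dots> = (\<integral>x. v x ^ 3 * noise r s f x \<partial>?S) ^ 4"
    by (simp add: corr_eq_noise[OF uv uf])
  also have "\<dots> \<le> (\<integral>x. v x ^ 4 \<partial>?S) ^ 3 * (\<integral>x. noise r s f x ^ 4 \<partial>?S)"
    by (rule N.Holder_4) (use v01 uT in \<open>auto simp: unit_valued_def\<close>)
  also have "\<dots> \<le> (\<integral>x. v x ^ 4 \<partial>?S) ^ 3 * (\<integral>x. (f x)\<^sup>2 \<partial>?S)\<^sup>2"
    using noise_std_L4[of f r] r f01 by (intro mult_left_mono) (auto simp: noise_def s_def)
  finally show "(\<integral>p. v (fst p) ^ 3 * f (r * fst p + sqrt (1 - r\<^sup>2) * snd p) \<partial>(?S \<Otimes>\<^sub>M ?S)) ^ 4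
      \<le> (\<integral>x. v x ^ 4 \<partial>?S) ^ 3 * (\<integral>x. (f x)\<^sup>2 \<partial>?S)\<^sup>2"
    by (simp add: s_def)
qed

lemma hypercontractive_normal:
  assumes \<sigma>: "\<sigma> > 0" and r: "r\<^sup>2 \<le> 1 / 16"
  shows "hypercontractive (density lborel (\<lambda>x. ennreal (normal_density 0 \<sigma> x))) (\<lambda>x y. r * x + sqrt (1 - r\<^sup>2) * y)"
    (is "hypercontractive ?N _")
proof (rule hypercontractive_transport[OF _ _ _ _ _ hypercontractive_std_normal[OF r], where \<phi> = "\<lambda>x. \<sigma> * x"])
  let ?S = "density lborel (\<lambda>x. ennreal (std_normal_density x))"
  show S: "prob_space ?S" by (rule prob_space_normal_density) simp
  have "distributed ?S lborel (\<lambda>x. x) std_normal_density"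
    unfolding distributed_def by (auto intro!: distr_id2)
  then have "distributed ?S lborel (\<lambda>x. 0 + \<sigma> * x) (normal_density (0 + \<sigma> * 0) (\<bar>\<sigma>\<bar> * 1))"
    by (rule prob_space.normal_density_affine[OF S]) (use \<sigma> in auto)
  then have "distr ?S lborel (\<lambda>x. \<sigma> * x) = ?N"
    using \<sigma> by (simp add: distributed_def)
  then show "distr ?S ?N (\<lambda>x. \<sigma> * x) = ?N"
    by (subst distr_cong[of ?S ?S ?N lborel]) auto
qed (auto simp: algebra_simps)

lemma hypercontractive_PiM:
  fixes N :: "real measure"
  assumes N: "prob_space N" and [measurable_cong]: "sets N = sets borel"
    and H: "hypercontractive N (\<lambda>x y. r * x + s * y)" and I: "finite I"
  shows "hypercontractive (\<Pi>\<^sub>M i\<in>I. N) (\<lambda>x y. \<lambda>i\<in>I. r * x i + s * y i)"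
  using I
proof (induction I)
  case empty
  interpret N: prob_space N by fact
  interpret E: prob_space "\<Pi>\<^sub>M i\<in>({} :: 'a set). N" by (rule prob_space_PiM) (rule N)
  interpret EE: pair_prob_space "\<Pi>\<^sub>M i\<in>({} :: 'a set). N" "\<Pi>\<^sub>M i\<in>({} :: 'a set). N" ..
  \<comment> \<open>The product over no coordinates is the point mass at the everywhere
    \<open>undefined\<close> function; the inequality becomes an equality of powers of the values
    there.\<close>
  define \<omega> :: "'a \<Rightarrow> real" where "\<omega> = (\<lambda>_. undefined)"
  have 1: "(\<integral>x. g x \<partial>(\<Pi>\<^sub>M i\<in>{}. N)) = g \<omega>" for g :: "('a \<Rightarrow> real) \<Rightarrow> real"
  proof -
    have "(\<integral>x. g x \<partial>(\<Pi>\<^sub>M i\<in>{}. N)) = (\<integral>x. g \<omega> \<partial>(\<Pi>\<^sub>M i\<in>({} :: 'a set). N))"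
      by (rule Bochner_Integration.integral_cong) (auto simp: space_PiM \<omega>_def)
    then show ?thesis using E.prob_space by simp
  qed
  have 2: "(\<integral>p. g p \<partial>((\<Pi>\<^sub>M i\<in>{}. N) \<Otimes>\<^sub>M (\<Pi>\<^sub>M i\<in>{}. N))) = g (\<omega>, \<omega>)" for g :: "('a \<Rightarrow> real) \<times> ('a \<Rightarrow> real) \<Rightarrow> real"
  proof -
    have "(\<integral>p. g p \<partial>((\<Pi>\<^sub>M i\<in>{}. N) \<Otimes>\<^sub>M (\<Pi>\<^sub>M i\<in>{}. N))) = (\<integral>p. g (\<omega>, \<omega>) \<partial>((\<Pi>\<^sub>M i\<in>({} :: 'a set). N) \<Otimes>\<^sub>M (\<Pi>\<^sub>M i\<in>({} :: 'a set). N)))"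
      by (rule Bochner_Integration.integral_cong) (auto simp: space_pair_measure space_PiM \<omega>_def)
    then show ?thesis using EE.prob_space by simp
  qed
  show ?case
    unfolding hypercontractive_def 1 2
    by (simp add: restrict_def \<omega>_def[symmetric] power_mult_distrib flip: power_mult)
next
  case (insert i I)
  let ?P = "\<lambda>I. \<Pi>\<^sub>M i\<in>I. N"
  have P: "prob_space (?P J)" for J :: "'a set" by (rule prob_space_PiM) (rule N)
  have "hypercontractive (N \<Otimes>\<^sub>M ?P I)
      (\<lambda>x y. (r * fst x + s * fst y, \<lambda>j\<in>I. r * snd x j + s * snd y j))"
    by (rule hypercontractive_pair[OF N P _ _ H insert.IH]) measurable
  then show ?case
  proof (rule hypercontractive_transport[rotated -1])
    interpret N: prob_space N by fact
    interpret PI: prob_space "?P I" by (rule P)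
    interpret NP: pair_prob_space N "?P I" ..
    show "prob_space (N \<Otimes>\<^sub>M ?P I)" by unfold_locales
    show "(\<lambda>(a, w). w(i := a)) \<in> N \<Otimes>\<^sub>M ?P I \<rightarrow>\<^sub>M ?P (insert i I)" by measurable
    show "distr (N \<Otimes>\<^sub>M ?P I) (?P (insert i I)) (\<lambda>(a, w). w(i := a)) = ?P (insert i I)"
      by (rule distr_pair_PiM_eq_PiM) (use insert.hyps N in auto)
    show "(\<lambda>(x, y). \<lambda>j\<in>insert i I. r * x j + s * y j) \<in> ?P (insert i I) \<Otimes>\<^sub>M ?P (insert i I) \<rightarrow>\<^sub>M ?P (insert i I)"
      by measurable
  qed (use insert.hyps in \<open>auto simp: fun_eq_iff split: prod.splits\<close>)
qed

definition sd :: "'n::finite itself \<Rightarrow> real" where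
  "sd _ = 1 / sqrt (real CARD('n))"

lemma sd_pos [simp]: "sd TYPE('n::finite) > 0"
  by (simp add: sd_def)

lemma sets_gauss [simp, measurable_cong]: "sets (gauss :: (real ^ 'n::finite) measure) = sets borel"
  by (simp add: gauss_def)

lemma measurable_vec_lambda_PiM [measurable]:
  assumes "sets N = sets borel"
  shows "(\<lambda>w. \<chi> i. w i) \<in> (\<Pi>\<^sub>M i\<in>(UNIV :: 'n::finite set). N) \<rightarrow>\<^sub>M (borel :: (real ^ 'n) measure)"
proof -
  note [measurable_cong] = assms
  show ?thesis
    by (rule borel_measurable_euclidean_space[THEN iffD2]) (auto simp: Basis_vec_def inner_axis)
qed

lemma hypercontractive_gauss:
  assumes r: "r\<^sup>2 \<le> 1 / 16"
  shows "hypercontractive (gauss :: (real ^ 'n::finite) measure) (\<lambda>x y. r *\<^sub>R x + sqrt (1 - r\<^sup>2) *\<^sub>R y)"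
proof -
  let ?N = "density lborel (\<lambda>x. ennreal (normal_density 0 (sd TYPE('n)) x))"
  let ?P = "\<Pi>\<^sub>M i\<in>(UNIV :: 'n set). ?N"
  have N: "prob_space ?N" by (rule prob_space_normal_density) simp
  have "hypercontractive ?P (\<lambda>x y. \<lambda>i\<in>UNIV. r * x i + sqrt (1 - r\<^sup>2) * y i)"
    by (rule hypercontractive_PiM[OF N _ hypercontractive_normal[OF _ r]]) auto
  then show ?thesis
  proof (rule hypercontractive_transport[rotated -1])
    show "prob_space ?P" by (rule prob_space_PiM) (rule N)
    have m: "(\<lambda>w. \<chi> i. w i) \<in> ?P \<rightarrow>\<^sub>M (borel :: (real ^ 'n) measure)"
      by (rule measurable_vec_lambda_PiM) simp
    then show "(\<lambda>w. \<chi> i. w i) \<in> ?P \<rightarrow>\<^sub>M (gauss :: (real ^ 'n) measure)" by simp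
    show "distr ?P gauss (\<lambda>w. \<chi> i. w i) = (gauss :: (real ^ 'n) measure)"
      unfolding gauss_def sd_def by (rule distr_cong) auto
  qed (auto simp: vec_eq_iff)
qed

section \<open>The Gaussian measure\<close>

text \<open>Lebesgue measure is determined by its values on boxes. This links the coordinatewise
  construction of \<open>gauss\<close> to densities on the vector space.\<close>

lemma distr_PiM_lborel_vec:
  "distr (\<Pi>\<^sub>M i\<in>(UNIV :: 'n::finite set). lborel) borel (\<lambda>w. \<chi> i. w i) = (lborel :: (real ^ 'n) measure)"
proof (rule lborel_eqI[symmetric])
  interpret product_sigma_finite "\<lambda>_ :: 'n. lborel :: real measure" ..
  have m [measurable]: "(\<lambda>w. \<chi> i. w i) \<in> (\<Pi>\<^sub>M i\<in>(UNIV :: 'n set). lborel) \<rightarrow>\<^sub>M (borel :: (real ^ 'n) measure)"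
    by (rule measurable_vec_lambda_PiM) simp
  fix l u :: "real ^ 'n" assume lu: "\<And>b. b \<in> Basis \<Longrightarrow> l \<bullet> b \<le> u \<bullet> b"
  have lu': "l $ i \<le> u $ i" for i
    using lu[of "axis i 1"] by (auto simp: Basis_vec_def inner_axis)
  have "(\<lambda>w. \<chi> i. w i) -` box l u = (\<Pi>\<^sub>E i\<in>UNIV. {l $ i <..< u $ i})"
    by (auto simp: mem_box_cart PiE_def Pi_def)
  then have "emeasure (distr (\<Pi>\<^sub>M i\<in>UNIV. lborel) borel (\<lambda>w. \<chi> i. w i)) (box l u) =
      emeasure (\<Pi>\<^sub>M i\<in>(UNIV :: 'n set). lborel) (\<Pi>\<^sub>E i\<in>UNIV. {l $ i <..< u $ i})"
    by (subst emeasure_distr) (auto simp: space_PiM)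
  also have "\<dots> = (\<Prod>i\<in>UNIV. ennreal (u $ i - l $ i))"
    by (subst emeasure_PiM) (auto simp: lu')
  also have "\<dots> = ennreal (\<Prod>i\<in>UNIV. u $ i - l $ i)"
    by (rule prod_ennreal) (simp add: lu')
  also have "(\<Prod>i\<in>UNIV. u $ i - l $ i) = (\<Prod>b\<in>Basis. (u - l) \<bullet> b)"
  proof -
    have B: "(Basis :: (real ^ 'n) set) = (\<lambda>i. axis i 1) ` UNIV" by (auto simp: Basis_vec_def)
    have inj: "inj (\<lambda>i :: 'n. axis i (1 :: real))" by (auto simp: inj_def axis_eq_axis)
    have "(\<Prod>b\<in>Basis. (u - l) \<bullet> b) = (\<Prod>i\<in>UNIV. (u - l) \<bullet> axis i 1)"
      unfolding B prod.reindex[OF inj] o_def ..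
    then show ?thesis by (simp add: inner_axis)
  qed
  finally show "emeasure (distr (\<Pi>\<^sub>M i\<in>UNIV. lborel) borel (\<lambda>w. \<chi> i. w i)) (box l u) = ennreal (\<Prod>b\<in>Basis. (u - l) \<bullet> b)" .
qed simp

lemma gauss_eq_distr: "(gauss :: (real ^ 'n::finite) measure) =
    distr (\<Pi>\<^sub>M i\<in>(UNIV :: 'n set). density lborel (\<lambda>x. ennreal (normal_density 0 (sd TYPE('n)) x))) borel (\<lambda>w. \<chi> i. w i)"
  by (simp add: gauss_def sd_def)

lemma prob_space_gauss: "prob_space (gauss :: (real ^ 'n::finite) measure)"
proof -
  have "prob_space (\<Pi>\<^sub>M i\<in>(UNIV :: 'n set). density lborel (\<lambda>x. ennreal (normal_density 0 (sd TYPE('n)) x)))"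
    by (rule prob_space_PiM) (rule prob_space_normal_density, simp)
  then show ?thesis
    unfolding gauss_eq_distr by (rule prob_space.prob_space_distr) (rule measurable_vec_lambda_PiM, simp)
qed

definition gauss_density :: "real ^ 'n::finite \<Rightarrow> real" where
  "gauss_density x = (\<Prod>i\<in>UNIV. normal_density 0 (sd TYPE('n)) (x $ i))"

lemma gauss_density_measurable [measurable]: "gauss_density \<in> borel_measurable borel"
  unfolding gauss_density_def by measurable

text \<open>A product of measures with densities has the product density, which is checked on
  rectangles. The locale \<open>rotation_invariant\<close> asks for this form.\<close>

lemma gauss_eq_density: "(gauss :: (real ^ 'n::finite) measure) = density lborel (\<lambda>x. ennreal (gauss_density x))"
proof -
  let ?nd = "normal_density 0 (sd TYPE('n))"
  interpret L: product_sigma_finite "\<lambda>_ :: 'n. lborel :: real measure" ..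
  interpret N: product_prob_space "\<lambda>_ :: 'n. density lborel (\<lambda>x. ennreal (?nd x))"
    by (rule product_prob_spaceI) (rule prob_space_normal_density, simp)
  have "density (\<Pi>\<^sub>M i\<in>(UNIV :: 'n set). lborel) (\<lambda>w. \<Prod>i\<in>UNIV. ennreal (?nd (w i))) =
      (\<Pi>\<^sub>M i\<in>UNIV. density lborel (\<lambda>x. ennreal (?nd x)))"
  proof (rule N.PiM_eqI)
    show "sets (density (\<Pi>\<^sub>M i\<in>(UNIV :: 'n set). lborel) (\<lambda>w. \<Prod>i\<in>UNIV. ennreal (?nd (w i)))) =
      sets (\<Pi>\<^sub>M i\<in>UNIV. density lborel (\<lambda>x. ennreal (?nd x)))"
      by (simp cong: sets_PiM_cong)
    fix A :: "'n \<Rightarrow> real set" assume "\<And>i. i \<in> UNIV \<Longrightarrow> A i \<in> sets (density lborel (\<lambda>x. ennreal (?nd x)))"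
    then have A [measurable]: "A i \<in> sets borel" for i by simp
    have "Pi\<^sub>E UNIV A \<in> sets (\<Pi>\<^sub>M i\<in>(UNIV :: 'n set). lborel)" by (rule sets_PiM_I_finite) auto
    then have "emeasure (density (\<Pi>\<^sub>M i\<in>(UNIV :: 'n set). lborel) (\<lambda>w. \<Prod>i\<in>UNIV. ennreal (?nd (w i)))) (Pi\<^sub>E UNIV A) =
       (\<integral>\<^sup>+w. (\<Prod>i\<in>UNIV. ennreal (?nd (w i))) * indicator (Pi\<^sub>E UNIV A) w \<partial>(\<Pi>\<^sub>M i\<in>UNIV. lborel))"
      by (subst emeasure_density) auto
    also have "\<dots> = (\<integral>\<^sup>+w. (\<Prod>i\<in>UNIV. ennreal (?nd (w i)) * indicator (A i) (w i)) \<partial>(\<Pi>\<^sub>M i\<in>UNIV. lborel))"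
    proof (rule nn_integral_cong)
      fix w :: "'n \<Rightarrow> real"
      have "indicator (Pi\<^sub>E UNIV A) w = (\<Prod>i\<in>UNIV. indicator (A i) (w i) :: ennreal)"
        by (cases "\<forall>i. w i \<in> A i") (auto simp: indicator_def PiE_def Pi_def)
      then show "(\<Prod>i\<in>UNIV. ennreal (?nd (w i))) * indicator (Pi\<^sub>E UNIV A) w = (\<Prod>i\<in>UNIV. ennreal (?nd (w i)) * indicator (A i) (w i))"
        by (simp add: prod.distrib)
    qed
    also have "\<dots> = (\<Prod>i\<in>UNIV. \<integral>\<^sup>+x. ennreal (?nd x) * indicator (A i) x \<partial>lborel)"
      by (rule L.product_nn_integral_prod) auto
    also have "\<dots> = (\<Prod>i\<in>UNIV. emeasure (density lborel (\<lambda>x. ennreal (?nd x))) (A i))"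
      by (simp add: emeasure_density)
    finally show "emeasure (density (\<Pi>\<^sub>M i\<in>(UNIV :: 'n set). lborel) (\<lambda>w. \<Prod>i\<in>UNIV. ennreal (?nd (w i)))) (Pi\<^sub>E UNIV A) =
      (\<Prod>i\<in>UNIV. emeasure (density lborel (\<lambda>x. ennreal (?nd x))) (A i))" .
  qed simp
  then have "(gauss :: (real ^ 'n) measure) = distr (density (\<Pi>\<^sub>M i\<in>(UNIV :: 'n set). lborel) (\<lambda>w. \<Prod>i\<in>UNIV. ennreal (?nd (w i)))) borel (\<lambda>w. \<chi> i. w i)"
    by (simp add: gauss_eq_distr)
  also have "\<dots> = distr (density (\<Pi>\<^sub>M i\<in>(UNIV :: 'n set). lborel) (\<lambda>w. ennreal (gauss_density (\<chi> i. w i)))) borel (\<lambda>w. \<chi> i. w i)"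
    by (simp add: gauss_density_def prod_ennreal)
  also have "\<dots> = density (distr (\<Pi>\<^sub>M i\<in>(UNIV :: 'n set). lborel) borel (\<lambda>w. \<chi> i. w i)) (\<lambda>x. ennreal (gauss_density x))"
    by (rule density_distr[symmetric]) (auto intro: measurable_vec_lambda_PiM)
  also have "\<dots> = density lborel (\<lambda>x. ennreal (gauss_density x))"
    by (simp add: distr_PiM_lborel_vec)
  finally show ?thesis .
qed

lemma rotation_invariant_gauss: "rotation_invariant (gauss :: (real ^ 'n::finite) measure) gauss_density"
proof (rule rotation_invariant.intro)
  show "gauss = density lborel (\<lambda>x. ennreal (gauss_density x))" by (rule gauss_eq_density)
  show "prob_space (gauss :: (real ^ 'n) measure)" by (rule prob_space_gauss)
  fix c s :: real and x y :: "real ^ 'n"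
  assume cs: "c\<^sup>2 + s\<^sup>2 = 1"
  interpret R: rotation_invariant "density lborel (\<lambda>x. ennreal (normal_density 0 (sd TYPE('n)) x))" "normal_density 0 (sd TYPE('n))"
    by (rule rotation_invariant_normal) simp
  show "gauss_density (c *\<^sub>R x + s *\<^sub>R y) * gauss_density (c *\<^sub>R y - s *\<^sub>R x) = gauss_density x * gauss_density y"
    unfolding gauss_density_def prod.distrib[symmetric] using R.G_rotate[OF cs] by simp
qed (auto simp: gauss_density_def prod_nonneg)

interpretation gauss: rotation_invariant "gauss :: (real ^ 'n::finite) measure" gauss_density
  by (rule rotation_invariant_gauss)

text \<open>Small set expansion. Correlation \<open>c\<close> passes to \<open>c\<^sup>2\<close> and
  then to \<open>c ^ 4\<close>, at most 1/4 in absolute value, where hypercontractivity gives the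
  exponent 5/4. Undoing the two squarings leaves \<beta> with 8/16 and \<delta> with (4 +
  5)/16.\<close>

lemma gauss_corr_bound:
  fixes f h :: "real ^ 'n::finite \<Rightarrow> real"
  assumes h: "h \<in> borel_measurable borel" "\<And>x. h x = 0 \<or> h x = 1"
    and f: "f \<in> borel_measurable borel" "\<And>x. f x = 0 \<or> f x = 1"
    and cs: "c\<^sup>2 + s\<^sup>2 = 1" "s \<noteq> 0" and c: "c\<^sup>2 \<le> 1 / 2"
  shows "gauss.corr c s h f ^ 16 \<le> (\<integral>x. h x \<partial>gauss) ^ 8 * (\<integral>x. f x \<partial>gauss) ^ 9"
proof -
  have uh: "gauss.unit_valued h" using h by (auto simp: gauss.unit_valued_def) (metis zero_le_one order_refl)+
  have uf: "gauss.unit_valued f" using f by (auto simp: gauss.unit_valued_def) (metis zero_le_one order_refl)+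
  have pw: "(h x)\<^sup>2 = h x" "(f x)\<^sup>2 = f x" "f x ^ 3 = f x" "f x ^ 4 = f x" for x
    using h(2)[of x] f(2)[of x] by auto
  define \<beta> \<delta> where "\<beta> = (\<integral>x. h x \<partial>gauss)" and "\<delta> = (\<integral>x. f x \<partial>gauss)"
  have pos: "\<beta> \<ge> 0" "\<delta> \<ge> 0"
    unfolding \<beta>_def \<delta>_def using uh uf by (auto simp: gauss.unit_valued_def intro!: integral_nonneg_AE)
  define C2 where "C2 = gauss.corr (c\<^sup>2) (sqrt (1 - c ^ 4)) f f"
  define C4 where "C4 = gauss.corr ((c\<^sup>2)\<^sup>2) (sqrt (1 - (c\<^sup>2) ^ 4)) f f"
  have c4: "c ^ 4 \<le> 1 / 4"
    using power_mono[OF c, of 2] by (simp add: power_divide)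
  have 1: "(gauss.corr c s h f)\<^sup>2 \<le> \<beta> * C2"
    using gauss.corr_sq_le[OF uh uf cs] by (simp add: \<beta>_def C2_def pw)
  have 2: "C2\<^sup>2 \<le> \<delta> * C4"
    unfolding C2_def C4_def \<delta>_def using gauss.corr_sq_le[OF uf uf, of "c\<^sup>2" "sqrt (1 - c ^ 4)"] c4
    by (simp add: pw)
  have 3: "C4 ^ 4 \<le> \<delta> ^ 5"
  proof -
    define r where "r = (c\<^sup>2)\<^sup>2"
    have "r \<le> 1 / 4" "r \<ge> 0" using c4 by (auto simp: r_def)
    then have r: "r\<^sup>2 \<le> 1 / 16"
      using power_mono[of r "1 / 4" 2] by (simp add: power_divide)
    have r4: "(c\<^sup>2) ^ 4 = r\<^sup>2" by (simp add: r_def)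
    have "f \<in> borel_measurable (gauss :: (real ^ 'n) measure)" using f(1) by measurable
    \<comment> \<open>Tested with \<open>v = f\<close>: an indicator equals its own powers, so both
      integrals on the right are \<delta>.\<close>
    then have "(\<integral>p. f (fst p) ^ 3 * f (r *\<^sub>R fst p + sqrt (1 - r\<^sup>2) *\<^sub>R snd p) \<partial>(gauss \<Otimes>\<^sub>M gauss)) ^ 4
        \<le> (\<integral>x. f x ^ 4 \<partial>gauss) ^ 3 * (\<integral>x. (f x)\<^sup>2 \<partial>gauss)\<^sup>2"
      using hypercontractive_gauss[OF r, unfolded hypercontractive_def, rule_format, of f f] uf
      by (simp add: gauss.unit_valued_def)
    then have "C4 ^ 4 \<le> \<delta> ^ 3 * \<delta>\<^sup>2"
      unfolding C4_def gauss.corr_def r4 r_def[symmetric] \<delta>_def pw .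
    then show ?thesis by (simp flip: power_add)
  qed
  have "gauss.corr c s h f ^ 16 = ((gauss.corr c s h f)\<^sup>2) ^ 8" by (simp flip: power_mult)
  also have "\<dots> \<le> (\<beta> * C2) ^ 8" by (rule power_mono[OF 1]) simp
  also have "\<dots> = \<beta> ^ 8 * (C2\<^sup>2) ^ 4" by (simp add: power_mult_distrib flip: power_mult)
  also have "\<dots> \<le> \<beta> ^ 8 * (\<delta> * C4) ^ 4"
    using pos by (intro mult_left_mono power_mono[OF 2]) auto
  also have "\<dots> = \<beta> ^ 8 * \<delta> ^ 4 * C4 ^ 4" by (simp add: power_mult_distrib)
  also have "\<dots> \<le> \<beta> ^ 8 * \<delta> ^ 4 * \<delta> ^ 5"
    using pos by (intro mult_left_mono[OF 3]) auto
  finally show ?thesis by (simp add: \<beta>_def \<delta>_def mult.assoc flip: power_add)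
qed

section \<open>Concentration of the squared norm\<close>

lemma nn_integral_exp_norm_gauss:
  assumes \<theta>: "2 * \<theta> < real CARD('n::finite)"
  shows "(\<integral>\<^sup>+w. ennreal (exp (\<theta> * (norm w)\<^sup>2)) \<partial>(gauss :: (real ^ 'n) measure))
    = ennreal ((1 / sqrt (1 - 2 * \<theta> / real CARD('n))) ^ CARD('n))"
proof -
  let ?\<sigma> = "sd TYPE('n)"
  let ?N = "density lborel (\<lambda>x. ennreal (normal_density 0 ?\<sigma> x))"
  interpret N: product_prob_space "\<lambda>_ :: 'n. ?N"
    by (rule product_prob_spaceI) (rule prob_space_normal_density, simp)
  have d: "real CARD('n) > 0" by simp
  have \<sigma>2: "2 * \<theta> * ?\<sigma>\<^sup>2 = 2 * \<theta> / real CARD('n)" by (simp add: sd_def power_divide)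
  have lt: "2 * \<theta> * ?\<sigma>\<^sup>2 < 1" unfolding \<sigma>2 using \<theta> d by (simp add: divide_less_eq)
  have m: "(\<lambda>w. \<chi> i. w i) \<in> (\<Pi>\<^sub>M i\<in>(UNIV :: 'n set). ?N) \<rightarrow>\<^sub>M (borel :: (real ^ 'n) measure)"
    by (rule measurable_vec_lambda_PiM) simp
  have "(\<integral>\<^sup>+w. ennreal (exp (\<theta> * (norm w)\<^sup>2)) \<partial>(gauss :: (real ^ 'n) measure))
    = (\<integral>\<^sup>+w. ennreal (exp (\<theta> * (norm (\<chi> i. w i))\<^sup>2)) \<partial>(\<Pi>\<^sub>M i\<in>(UNIV :: 'n set). ?N))"
    unfolding gauss_eq_distr by (rule nn_integral_distr[OF m]) measurable
  also have "\<dots> = (\<integral>\<^sup>+w. (\<Prod>i\<in>UNIV. ennreal (exp (\<theta> * (w i)\<^sup>2))) \<partial>(\<Pi>\<^sub>M i\<in>(UNIV :: 'n set). ?N))"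
  proof -
    have "exp (\<theta> * (norm (\<chi> i :: 'n. w i))\<^sup>2) = (\<Prod>i\<in>UNIV. exp (\<theta> * (w i)\<^sup>2))" for w
      by (simp add: norm_vec_def L2_set_def sum_nonneg sum_distrib_left exp_sum)
    then show ?thesis by (simp add: prod_ennreal)
  qed
  also have "\<dots> = (\<Prod>i\<in>(UNIV :: 'n set). \<integral>\<^sup>+x. ennreal (exp (\<theta> * x\<^sup>2)) \<partial>?N)"
    by (rule N.product_nn_integral_prod) auto
  also have "(\<integral>\<^sup>+x. ennreal (exp (\<theta> * x\<^sup>2)) \<partial>?N) = ennreal (1 / sqrt (1 - 2 * \<theta> * ?\<sigma>\<^sup>2))"
  proof -
    note b = integral_exp_square_normal[OF sd_pos lt]
    have "(\<integral>\<^sup>+x. ennreal (exp (\<theta> * x\<^sup>2)) \<partial>?N) = (\<integral>\<^sup>+x. ennreal (normal_density 0 ?\<sigma> x * exp (\<theta> * x\<^sup>2)) \<partial>lborel)"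
      by (subst nn_integral_density) (auto simp: ennreal_mult)
    also have "\<dots> = ennreal (1 / sqrt (1 - 2 * \<theta> * ?\<sigma>\<^sup>2))"
      using b by (subst nn_integral_eq_integral) (auto simp: has_bochner_integral_iff)
    finally show ?thesis .
  qed
  finally show ?thesis
    using lt by (simp add: \<sigma>2 prod_ennreal[symmetric] ennreal_power)
qed

text \<open>Markov's inequality for the exponential moment. Negative \<theta> is allowed, so the
  same bound serves the upper and the lower tail.\<close>

lemma gauss_Chernoff:
  assumes \<theta>: "2 * \<theta> < real CARD('n::finite)"
  shows "measure gauss {w :: real ^ 'n. c \<le> \<theta> * (norm w)\<^sup>2}
    \<le> exp (- c) * (1 / sqrt (1 - 2 * \<theta> / real CARD('n))) ^ CARD('n)"
proof -
  let ?B = "(1 / sqrt (1 - 2 * \<theta> / real CARD('n))) ^ CARD('n)"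
  have B: "?B \<ge> 0" using \<theta> by (simp add: divide_le_eq)
  have "emeasure gauss {w :: real ^ 'n. c \<le> \<theta> * (norm w)\<^sup>2}
    = emeasure gauss ({w \<in> UNIV. 1 \<le> ennreal (exp (- c)) * ennreal (exp (\<theta> * (norm w)\<^sup>2))} :: (real ^ 'n) set)"
    by (rule arg_cong[where f = "emeasure gauss"])
      (auto simp: ennreal_mult[symmetric] mult_exp_exp simp flip: ennreal_1)
  also have "\<dots> \<le> ennreal (exp (- c)) * (\<integral>\<^sup>+w. ennreal (exp (\<theta> * (norm w)\<^sup>2)) * indicator UNIV w \<partial>(gauss :: (real ^ 'n) measure))"
    by (rule nn_integral_Markov_inequality) auto
  also have "\<dots> = ennreal (exp (- c) * ?B)"
    using nn_integral_exp_norm_gauss[OF \<theta>] B by (simp add: ennreal_mult)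
  finally show ?thesis
    using B by (simp add: gauss.N.emeasure_eq_measure)
qed

lemma gauss_norm_upper_tail:
  assumes t: "0 \<le> t" "t \<le> 1 / 20"
  shows "measure gauss {w :: real ^ 'n::finite. 1 + t \<le> (norm w)\<^sup>2} \<le> exp (- (t\<^sup>2 / 5) * real CARD('n))"
proof (cases "t = 0")
  case False
  let ?d = "real CARD('n)"
  have d: "?d > 0" by simp
  have td: "t * ?d > 0" using False t d by simp
  have eq: "{w :: real ^ 'n. 1 + t \<le> (norm w)\<^sup>2} = {w. (t / 2 * ?d) * (1 + t) \<le> (t / 2 * ?d) * (norm w)\<^sup>2}"
    using td by (auto simp: mult_le_cancel_left)
  \<comment> \<open>The optimal \<theta> is \<open>t / (2 * (1 + t))\<close> times the dimension;
    the choice \<open>t / 2\<close> agrees to first order and turns the square root into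
    \<open>sqrt (1 - t)\<close>.\<close>
  have "measure gauss {w :: real ^ 'n. 1 + t \<le> (norm w)\<^sup>2}
      \<le> exp (- ((t / 2 * ?d) * (1 + t))) * (1 / sqrt (1 - 2 * (t / 2 * ?d) / ?d)) ^ CARD('n)"
    unfolding eq by (rule gauss_Chernoff) (use t d in simp)
  also have "exp (- ((t / 2 * ?d) * (1 + t))) = exp (- (t / 2 * (1 + t))) ^ CARD('n)"
    by (simp add: exp_of_nat_mult[symmetric] mult_ac)
  also have "2 * (t / 2 * ?d) / ?d = t" by simp
  also have "exp (- (t / 2 * (1 + t))) ^ CARD('n) * (1 / sqrt (1 - t)) ^ CARD('n)
      = (exp (- (t / 2 * (1 + t))) / sqrt (1 - t)) ^ CARD('n)"
    by (simp add: power_mult_distrib[symmetric])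
  also have "\<dots> \<le> exp (- (t\<^sup>2 / 5)) ^ CARD('n)"
  proof (rule power_mono)
    \<comment> \<open>Chosen so that \<open>z / 2\<close> is the available exponent
      \<open>t / 2 * (1 + t)\<close> minus the claimed \<open>t\<^sup>2 / 5\<close>; what remains is
      \<open>exp (- z) \<le> 1 - t\<close>, which holds to second order with room to spare.\<close>
    define z where "z = t + 3 / 5 * t\<^sup>2"
    have z: "z \<ge> 0" using t by (simp add: z_def)
    have "1 \<le> (1 - t) * (1 + z + z\<^sup>2 / 2)"
    proof -
      have "z\<^sup>2 \<ge> t\<^sup>2" unfolding z_def using t by (intro power_mono) auto
      then have "1 + z + z\<^sup>2 / 2 \<ge> 1 + t + 11 / 10 * t\<^sup>2" by (simp add: z_def)
      then have "(1 - t) * (1 + z + z\<^sup>2 / 2) \<ge> (1 - t) * (1 + t + 11 / 10 * t\<^sup>2)"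
        using t by (intro mult_left_mono) auto
      also have "(1 - t) * (1 + t + 11 / 10 * t\<^sup>2) = 1 + t\<^sup>2 * (1 / 10 - 11 / 10 * t)"
        by (simp add: power2_eq_square field_simps)
      finally have "1 + t\<^sup>2 * (1 / 10 - 11 / 10 * t) \<le> (1 - t) * (1 + z + z\<^sup>2 / 2)" .
      moreover have "0 \<le> t\<^sup>2 * (1 / 10 - 11 / 10 * t)"
        using t by (intro mult_nonneg_nonneg) auto
      ultimately show ?thesis by linarith
    qed
    also have "\<dots> \<le> (1 - t) * exp z"
      using exp_lower_Taylor_quadratic[OF z] t by (intro mult_left_mono) auto
    finally have 1: "exp (- z) \<le> 1 - t" by (simp add: exp_minus field_simps)
    have "exp (- z / 2) = sqrt (exp (- z))"
      by (rule real_sqrt_unique[symmetric]) (simp_all add: power2_eq_square mult_exp_exp)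
    also have "\<dots> \<le> sqrt (1 - t)" using 1 by simp
    finally have "exp (- z / 2) \<le> sqrt (1 - t)" .
    moreover have "exp (- (t / 2 * (1 + t))) = exp (- z / 2) * exp (- (t\<^sup>2 / 5))"
      by (simp add: mult_exp_exp z_def power2_eq_square field_simps)
    ultimately show "exp (- (t / 2 * (1 + t))) / sqrt (1 - t) \<le> exp (- (t\<^sup>2 / 5))"
      using t by (simp add: divide_le_eq mult.commute)
  qed (use t in auto)
  also have "\<dots> = exp (- (t\<^sup>2 / 5) * real CARD('n))"
    by (simp add: exp_of_nat_mult[symmetric] mult_ac)
  finally show ?thesis .
qed (simp add: gauss.N.prob_le_1)

lemma ln_one_plus_quadratic:
  assumes "0 \<le> (t :: real)"
  shows "t - t\<^sup>2 / 2 \<le> ln (1 + t)"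
proof -
  let ?g = "\<lambda>x :: real. ln (1 + x) - x + x\<^sup>2 / 2"
  have "?g 0 \<le> ?g t"
  proof (rule DERIV_nonneg_imp_nondecreasing[OF assms])
    fix x :: real assume x: "0 \<le> x" "x \<le> t"
    have "DERIV ?g x :> 1 / (1 + x) - 1 + x"
      by (rule derivative_eq_intros refl | use x in simp)+
    moreover have "1 / (1 + x) - 1 + x = x\<^sup>2 / (1 + x)"
      using x by (simp add: field_simps power2_eq_square)
    ultimately show "\<exists>y. DERIV ?g x :> y \<and> 0 \<le> y"
      using x by auto
  qed
  then show ?thesis by simp
qed

lemma gauss_norm_lower_tail:
  assumes t: "0 \<le> t" "t \<le> 1 / 20"
  shows "measure gauss {w :: real ^ 'n::finite. (norm w)\<^sup>2 \<le> 1 - t} \<le> exp (- (t\<^sup>2 / 5) * real CARD('n))"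
proof (cases "t = 0")
  case False
  let ?d = "real CARD('n)"
  have d: "?d > 0" by simp
  have td: "t * ?d > 0" using False t d by simp
  have eq: "{w :: real ^ 'n. (norm w)\<^sup>2 \<le> 1 - t} = {w. (- t / 2 * ?d) * (1 - t) \<le> (- t / 2 * ?d) * (norm w)\<^sup>2}"
    using td by (auto simp: mult_le_cancel_left)
  have "measure gauss {w :: real ^ 'n. (norm w)\<^sup>2 \<le> 1 - t}
      \<le> exp (- ((- t / 2 * ?d) * (1 - t))) * (1 / sqrt (1 - 2 * (- t / 2 * ?d) / ?d)) ^ CARD('n)"
    unfolding eq by (rule gauss_Chernoff) (use td d in linarith)
  also have "exp (- ((- t / 2 * ?d) * (1 - t))) = exp (t / 2 * (1 - t)) ^ CARD('n)"
    by (simp add: exp_of_nat_mult[symmetric] mult_ac)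
  also have "2 * (- t / 2 * ?d) / ?d = - t" by simp
  also have "exp (t / 2 * (1 - t)) ^ CARD('n) * (1 / sqrt (1 - (- t))) ^ CARD('n)
      = (exp (t / 2 * (1 - t)) / sqrt (1 + t)) ^ CARD('n)"
    by (simp add: power_mult_distrib[symmetric])
  also have "\<dots> \<le> exp (- (t\<^sup>2 / 5)) ^ CARD('n)"
  proof (rule power_mono)
    \<comment> \<open>Now \<open>z / 2\<close> is \<open>t / 2 * (1 - t)\<close> plus the claimed
      \<open>t\<^sup>2 / 5\<close>, and \<open>exp z \<le> 1 + t\<close> remains.\<close>
    define z where "z = t - 3 / 5 * t\<^sup>2"
    have "z \<le> t - t\<^sup>2 / 2" by (simp add: z_def)
    then have "exp z \<le> exp (ln (1 + t))" using ln_one_plus_quadratic[OF t(1)] by (simp only: exp_le_cancel_iff)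
    then have 1: "exp z \<le> 1 + t" using t by simp
    have "exp (z / 2) = sqrt (exp z)"
      by (rule real_sqrt_unique[symmetric]) (simp_all add: power2_eq_square mult_exp_exp)
    also have "\<dots> \<le> sqrt (1 + t)" using 1 by simp
    finally have "exp (z / 2) \<le> sqrt (1 + t)" .
    moreover have "exp (t / 2 * (1 - t)) = exp (z / 2) * exp (- (t\<^sup>2 / 5))"
      by (simp add: mult_exp_exp z_def power2_eq_square field_simps)
    ultimately show "exp (t / 2 * (1 - t)) / sqrt (1 + t) \<le> exp (- (t\<^sup>2 / 5))"
      using t by (simp add: divide_le_eq mult.commute)
  qed (use t in auto)
  also have "\<dots> = exp (- (t\<^sup>2 / 5) * real CARD('n))"
    by (simp add: exp_of_nat_mult[symmetric] mult_ac)
  finally show ?thesis .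
qed (simp add: gauss.N.prob_le_1)

section \<open>Discarded constraints\<close>

lemma card_sources: "card (sources k0) = 2 * (k0 + 1)"
proof -
  have 1: "card (T_pos ` {1..k0}) = k0" "card (T_neg ` {1..k0}) = k0"
    by (subst card_image; simp add: inj_on_def)+
  have "card (T_pos ` {1..k0} \<union> T_neg ` {1..k0}) = 2 * k0"
    by (subst card_Un_disjoint) (auto simp: 1[simplified])
  then show ?thesis
    unfolding sources_def by (subst card_Un_disjoint) auto
qed

lemma finite_sources [simp]: "finite (sources k0)" and sources_nonempty [simp]: "sources k0 \<noteq> {}"
  by (auto simp: sources_def)

lemma prob_space_sampling: "prob_space (sampling k0 :: 'n::finite sample measure)"
proof -
  interpret P: pair_prob_space "measure_pmf (pmf_of_set (sources k0))" "gauss \<Otimes>\<^sub>M gauss :: ((real ^ 'n) \<times> (real ^ 'n)) measure"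
    by unfold_locales
  show ?thesis unfolding sampling_def by (rule P.prob_space_axioms)
qed

lemma measure_sampling_Times:
  fixes B :: "((real ^ 'n::finite) \<times> (real ^ 'n)) set"
  assumes "B \<in> sets (gauss \<Otimes>\<^sub>M gauss)"
  shows "measure (sampling k0) (A \<times> B) = measure_pmf.prob (pmf_of_set (sources k0)) A * measure (gauss \<Otimes>\<^sub>M gauss) B"
proof -
  have G: "finite_measure (gauss \<Otimes>\<^sub>M gauss :: ((real ^ 'n) \<times> (real ^ 'n)) measure)"
    by unfold_locales
  then have "sigma_finite_measure (gauss \<Otimes>\<^sub>M gauss :: ((real ^ 'n) \<times> (real ^ 'n)) measure)"
    by (simp add: finite_measure_def)
  from sigma_finite_measure.emeasure_pair_measure_Times[OF this _ assms, of A "measure_pmf (pmf_of_set (sources k0))"]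
  have "emeasure (sampling k0) (A \<times> B) = ennreal (measure_pmf.prob (pmf_of_set (sources k0)) A) * ennreal (measure (gauss \<Otimes>\<^sub>M gauss) B)"
    unfolding sampling_def using assms
    by (simp add: measure_pmf.emeasure_eq_measure finite_measure.emeasure_eq_measure[OF G])
  then show ?thesis
    by (simp add: measure_def enn2real_mult)
qed

text \<open>Passing from one fixed source to the whole sampling procedure costs the number of
  sources; this is where the factor \<open>k0 + 1\<close> of the violation bound arises.\<close>

lemma measure_sampling_ge:
  fixes B :: "((real ^ 'n::finite) \<times> (real ^ 'n)) set"
  assumes src: "src \<in> sources k0" and B: "B \<in> sets (gauss \<Otimes>\<^sub>M gauss)"
    and E: "E \<in> sets (sampling k0)" and sub: "\<And>w u. (w, u) \<in> B \<Longrightarrow> (src, w, u) \<in> E"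
  shows "measure (gauss \<Otimes>\<^sub>M gauss) B \<le> 2 * (real k0 + 1) * measure (sampling k0) E"
proof -
  interpret S: prob_space "sampling k0 :: 'n sample measure" by (rule prob_space_sampling)
  have "measure (sampling k0) ({src} \<times> B) \<le> measure (sampling k0) E"
    by (rule S.finite_measure_mono[OF _ E]) (use sub in auto)
  moreover have "measure (sampling k0) ({src} \<times> B) = measure (gauss \<Otimes>\<^sub>M gauss) B / (2 * (real k0 + 1))"
    using src by (simp add: measure_sampling_Times[OF B] measure_pmf_of_set card_sources measure_pmf_single)
  ultimately show ?thesis by (simp add: field_simps)
qed

lemma gauss_norm_deviation:
  assumes t: "0 < t" "t \<le> 1 / 20"
  shows "measure gauss {w :: real ^ 'n::finite. \<bar>(norm w)\<^sup>2 - 1\<bar> > t} \<le> 2 * exp (- (t\<^sup>2 / 5) * real CARD('n))"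
proof -
  let ?U = "{w :: real ^ 'n. 1 + t \<le> (norm w)\<^sup>2}" and ?L = "{w :: real ^ 'n. (norm w)\<^sup>2 \<le> 1 - t}"
  have m: "?U \<in> sets gauss" "?L \<in> sets gauss" by measurable
  have "measure gauss {w :: real ^ 'n. \<bar>(norm w)\<^sup>2 - 1\<bar> > t} \<le> measure gauss (?U \<union> ?L)"
    by (rule gauss.N.finite_measure_mono) (use m in auto)
  also have "\<dots> \<le> measure gauss ?U + measure gauss ?L"
    by (rule measure_Un_le[OF m])
  also have "\<dots> \<le> 2 * exp (- (t\<^sup>2 / 5) * real CARD('n))"
    using gauss_norm_upper_tail[where 'n = 'n, of t] gauss_norm_lower_tail[where 'n = 'n, of t] t by simp
  finally show ?thesis .
qed

lemma discard_probability:
  fixes \<epsilon> :: real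
  assumes \<epsilon>: "\<epsilon> > 0" and d: "real CARD('n::finite) \<ge> 80000000 / \<epsilon> ^ 3"
  shows "\<P>(smp in (sampling k0 :: 'n sample measure). discarded \<epsilon> smp) \<le> 6 * exp (- 10 / \<epsilon>)"
proof (cases "\<epsilon> < 10")
  \<comment> \<open>Here the claimed bound is at least 6/e, which exceeds 1.\<close>
  case False
  interpret S: prob_space "sampling k0 :: 'n sample measure" by (rule prob_space_sampling)
  have "exp (1 :: real) \<le> 6" using exp_le by simp
  then have "1 \<le> 6 * exp (- 1 :: real)" by (simp add: exp_minus field_simps)
  also have "\<dots> \<le> 6 * exp (- 10 / \<epsilon>)" using False \<epsilon> by (simp add: field_simps)
  finally show ?thesis using S.prob_le_1 order_trans by blast
next
  case True
  define t where "t = \<epsilon> / 1000"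
  have t: "0 < t" "t \<le> 1 / 20" using True \<epsilon> by (auto simp: t_def)
  let ?G = "gauss \<Otimes>\<^sub>M gauss :: ((real ^ 'n) \<times> (real ^ 'n)) measure"
  interpret S: prob_space "sampling k0 :: 'n sample measure" by (rule prob_space_sampling)
  interpret G: prob_space ?G by unfold_locales
  define D where "D = {w :: real ^ 'n. \<bar>(norm w)\<^sup>2 - 1\<bar> > t}"
  have D [measurable]: "D \<in> sets borel" unfolding D_def by measurable
  define q where "q = measure gauss D"
  have q: "q \<le> 2 * exp (- (16 / \<epsilon>))"
  proof -
    \<comment> \<open>The constant 80000000 is 16 times 5 times 1000^2: the tail exponent at
      deviation \<epsilon>/1000 becomes 16/\<epsilon>, leaving 6/\<epsilon> to pay for constant
      factors.\<close>
    have "16 / \<epsilon> = t\<^sup>2 / 5 * (80000000 / \<epsilon> ^ 3)"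
      using \<epsilon> by (simp add: t_def field_simps power2_eq_square power3_eq_cube)
    also have "\<dots> \<le> t\<^sup>2 / 5 * real CARD('n)" using d by (intro mult_left_mono) auto
    finally have "exp (- (t\<^sup>2 / 5) * real CARD('n)) \<le> exp (- (16 / \<epsilon>))" by simp
    then show ?thesis using gauss_norm_deviation[OF t, where 'n = 'n] unfolding q_def D_def by linarith
  qed
  \<comment> \<open>Rotation by 45 degrees. By polarization \<open>w \<bullet> u\<close> is half the
    difference of the squared norms of the two rotated vectors, so a large inner product forces one
    of these norms to deviate.\<close>
  define c where "c = 1 / sqrt (2 :: real)"
  have c2: "c * c = 1 / 2" by (simp add: c_def)
  then have cc: "c\<^sup>2 + c\<^sup>2 = 1" "c \<noteq> 0" by (auto simp: power2_eq_square)
  define R where "R = (\<lambda>p :: (real ^ 'n) \<times> (real ^ 'n). (c *\<^sub>R fst p + c *\<^sub>R snd p, c *\<^sub>R snd p - c *\<^sub>R fst p))"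
  have Rm [measurable]: "R \<in> ?G \<rightarrow>\<^sub>M ?G" unfolding R_def by measurable
  have R: "distr ?G ?G R = ?G" unfolding R_def by (rule gauss.distr_rotate[OF cc])
  have e1: "emeasure (gauss :: (real ^ 'n) measure) UNIV = 1"
    using gauss.N.emeasure_space_1 by simp
  have "emeasure ?G (D \<times> UNIV) = emeasure gauss D" "emeasure ?G (UNIV \<times> D) = emeasure gauss D"
    using gauss.N.emeasure_pair_measure_Times[of D "gauss :: (real ^ 'n) measure" "UNIV :: (real ^ 'n) set"]
      gauss.N.emeasure_pair_measure_Times[of UNIV "gauss :: (real ^ 'n) measure" D] D
    by (simp_all add: e1)
  then have mD: "measure ?G (D \<times> UNIV) = q" "measure ?G (UNIV \<times> D) = q"
    by (simp_all only: q_def measure_def)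
  have sD: "D \<times> UNIV \<in> sets ?G" "UNIV \<times> D \<in> sets ?G"
    by (auto intro!: pair_measureI)
  have mR: "measure ?G (R -` A) = measure ?G A" and sR: "R -` A \<in> sets ?G" if "A \<in> sets ?G" for A
  proof -
    have "measure ?G A = measure (distr ?G ?G R) A" by (simp add: R)
    also have "\<dots> = measure ?G (R -` A)"
      using that by (subst measure_distr) (auto simp: space_pair_measure)
    finally show "measure ?G (R -` A) = measure ?G A" ..
    show "R -` A \<in> sets ?G"
      using measurable_sets[OF Rm that] by (simp add: space_pair_measure)
  qed
  \<comment> \<open>Four norm deviations, of \<open>w\<close>, \<open>u\<close> and their two
    rotated copies, each of probability \<open>q\<close>. The event covers discarding for every
    source, which makes the bound independent of \<open>k0\<close>.\<close>
  define W where "W = (D \<times> UNIV \<union> UNIV \<times> D) \<union> (R -` (D \<times> UNIV) \<union> R -` (UNIV \<times> D))"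
  have Ws: "W \<in> sets ?G" unfolding W_def using sD sR by auto
  have W: "measure ?G W \<le> 4 * q"
  proof -
    have "measure ?G W \<le> (measure ?G (D \<times> UNIV) + measure ?G (UNIV \<times> D))
        + (measure ?G (R -` (D \<times> UNIV)) + measure ?G (R -` (UNIV \<times> D)))"
      unfolding W_def using sD sR
      by (intro order_trans[OF measure_Un_le] add_mono measure_Un_le sets.Un) auto
    then show ?thesis using mD mR sD by simp
  qed
  have dev: "t < \<bar>a - 1\<bar> \<or> t < \<bar>b - 1\<bar>" if "y = (a - b) / 2" "t < \<bar>y\<bar>" for a b y :: real
    using that by argo
  have bad: "(w, u) \<in> W" if "discarded \<epsilon> (src, w, u)" for src w u
  proof -
    have "w \<bullet> u = ((norm (fst (R (w, u))))\<^sup>2 - (norm (snd (R (w, u))))\<^sup>2) / 2"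
      unfolding R_def power2_norm_eq_inner
      by (simp add: inner_add inner_diff inner_commute mult.assoc[symmetric] c2 algebra_simps)
    then have "\<bar>w \<bullet> u\<bar> > t \<Longrightarrow> fst (R (w, u)) \<in> D \<or> snd (R (w, u)) \<in> D"
      unfolding D_def mem_Collect_eq by (rule dev)
    then show ?thesis
      using that unfolding W_def by (auto simp: D_def t_def[symmetric] mem_Times_iff)
  qed
  have "\<P>(smp in (sampling k0 :: 'n sample measure). discarded \<epsilon> smp) \<le> measure (sampling k0) (UNIV \<times> W)"
  proof (rule S.finite_measure_mono)
    show "{smp \<in> space (sampling k0). discarded \<epsilon> smp} \<subseteq> UNIV \<times> W"
      using bad by auto
    show "UNIV \<times> W \<in> sets (sampling k0 :: 'n sample measure)"
      unfolding sampling_def using Ws by (intro pair_measureI) auto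
  qed
  also have "\<dots> = measure ?G W"
    by (simp add: measure_sampling_Times[OF Ws])
  also have "\<dots> \<le> 8 * exp (- (16 / \<epsilon>))" using W q by simp
  also have "\<dots> \<le> 6 * exp (- 10 / \<epsilon>)"
  proof -
    \<comment> \<open>The spare exponent 6/\<epsilon> absorbs the ratio 8/6.\<close>
    have "4 / 3 \<le> 1 + 6 / \<epsilon>" using True \<epsilon> by (simp add: field_simps)
    also have "\<dots> \<le> exp (6 / \<epsilon>)" by (rule exp_ge_add_one_self)
    finally have "8 * exp (- (16 / \<epsilon>)) \<le> 6 * (exp (6 / \<epsilon>) * exp (- (16 / \<epsilon>)))" by simp
    also have "exp (6 / \<epsilon>) * exp (- (16 / \<epsilon>)) = exp (- 10 / \<epsilon>)"
      by (simp add: mult_exp_exp diff_divide_distrib[symmetric])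
    finally show ?thesis .
  qed
  finally show ?thesis .
qed

section \<open>Vector solutions\<close>

text \<open>A distribution on the cube with prescribed moments of degree 1 and 2: its Fourier expansion
  leaves only the coefficient \<open>m123\<close> free, so it suffices that the expansion is nonnegative.\<close>

lemma cube_distribution:
  fixes m1 m2 m3 m12 m13 m23 m123 :: real
  assumes nonneg: "\<And>x y z. x \<in> {-1, 1} \<Longrightarrow> y \<in> {-1, 1} \<Longrightarrow> z \<in> {-1, 1} \<Longrightarrow>
      0 \<le> 1 + m1 * x + m2 * y + m3 * z + m12 * x * y + m13 * x * z + m23 * y * z + m123 * x * y * z"
  obtains \<mu> :: "(real \<times> real \<times> real) pmf" where
    "set_pmf \<mu> \<subseteq> {-1, 1} \<times> {-1, 1} \<times> {-1, 1}"
    "measure_pmf.expectation \<mu> (\<lambda>(x1, x2, x3). x1) = m1"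
    "measure_pmf.expectation \<mu> (\<lambda>(x1, x2, x3). x2) = m2"
    "measure_pmf.expectation \<mu> (\<lambda>(x1, x2, x3). x3) = m3"
    "measure_pmf.expectation \<mu> (\<lambda>(x1, x2, x3). x1 * x2) = m12"
    "measure_pmf.expectation \<mu> (\<lambda>(x1, x2, x3). x1 * x3) = m13"
    "measure_pmf.expectation \<mu> (\<lambda>(x1, x2, x3). x2 * x3) = m23"
    "measure_pmf.prob \<mu> {x. one_in_three x} = (3 - (m1 + m2 + m3) - (m12 + m13 + m23) + 3 * m123) / 8"
proof -
  define p where "p = (\<lambda>x y z. (1 + m1 * x + m2 * y + m3 * z + m12 * x * y + m13 * x * z + m23 * y * z + m123 * x * y * z) / 8)"
  define xs where "xs = map (\<lambda>(x, y, z). ((x, y, z), p x y z))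
    [(1, 1, 1), (1, 1, -1), (1, -1, 1), (1, -1, -1), (-1, 1, 1), (-1, 1, -1), (-1, -1, 1), (-1, -1, -1 :: real)]"
  have p: "p x y z \<ge> 0" if "x \<in> {-1, 1}" "y \<in> {-1, 1}" "z \<in> {-1, 1}" for x y z
    using nonneg[OF that] by (simp add: p_def)
  have wf: "pmf_of_list_wf xs"
  proof (rule pmf_of_list_wfI)
    show "\<And>x. x \<in> set (map snd xs) \<Longrightarrow> 0 \<le> x"
      by (auto simp: xs_def intro!: p)
    show "sum_list (map snd xs) = 1"
      by (simp add: xs_def p_def field_simps)
  qed
  define \<mu> where "\<mu> = pmf_of_list xs"
  let ?A = "{-1, 1} \<times> {-1, 1} \<times> {-1, 1 :: real}"
  have set: "set_pmf \<mu> \<subseteq> ?A"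
    unfolding \<mu>_def using set_pmf_of_list[OF wf] by (rule order_trans) (auto simp: xs_def)
  have pmf: "pmf \<mu> (x, y, z) = p x y z" if "(x, y, z) \<in> ?A" for x y z
    unfolding \<mu>_def pmf_pmf_of_list[OF wf] using that by (auto simp: xs_def)
  have E: "measure_pmf.expectation \<mu> g = (\<Sum>x\<in>{-1, 1}. \<Sum>y\<in>{-1, 1}. \<Sum>z\<in>{-1, 1}. g (x, y, z) * p x y z)"
    for g :: "real \<times> real \<times> real \<Rightarrow> real"
  proof -
    have "measure_pmf.expectation \<mu> g = (\<Sum>a\<in>?A. g a * pmf \<mu> a)"
    proof (rule integral_measure_pmf_real)
      show "a \<in> ?A" if "a \<in> set_pmf \<mu>" for a using set that by (rule subsetD)
    qed simp
    also have "\<dots> = (\<Sum>(x, y, z)\<in>?A. g (x, y, z) * p x y z)"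
      by (rule sum.cong[OF refl]) (use pmf in auto)
    also have "\<dots> = (\<Sum>x\<in>{-1, 1}. \<Sum>y\<in>{-1, 1}. \<Sum>z\<in>{-1, 1}. g (x, y, z) * p x y z)"
      by (simp only: sum.cartesian_product)
    finally show ?thesis .
  qed
  show thesis
  proof (rule that[of \<mu>])
    show "set_pmf \<mu> \<subseteq> {-1, 1} \<times> {-1, 1} \<times> {-1, 1}"
      by (rule set)
    show "measure_pmf.prob \<mu> {x. one_in_three x} = (3 - (m1 + m2 + m3) - (m12 + m13 + m23) + 3 * m123) / 8"
      unfolding \<mu>_def measure_pmf_of_list[OF wf] by (simp add: xs_def p_def field_simps)
  qed (simp_all add: E p_def field_simps)
qed

lemma sum_lessThan_add:
  fixes f :: "nat \<Rightarrow> 'a::comm_monoid_add"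
  shows "(\<Sum>i<m + n. f i) = (\<Sum>i<m. f i) + (\<Sum>j<n. f (m + j))"
  by (induction n) (simp_all add: add.assoc)

text \<open>Padding every vector, \<open>e\<close> included, by an orthogonal direction of its own scales all the inner
  products of distinct vectors by the same factor \<open>1 - \<kappa>\<close>.\<close>

lemma padded_vectors:
  fixes X :: "'a::euclidean_space set" and e :: 'a
  assumes X: "finite X" and \<kappa>: "0 \<le> \<kappa>" "\<kappa> \<le> 1" and e: "norm e = 1"
  obtains N z V where "sdp_vectors N z V X"
    "\<And>c. c \<in> X \<Longrightarrow> (1 - \<kappa>) * (c \<bullet> c) \<le> 1 \<Longrightarrow> ip N (V c) z = (1 - \<kappa>) * (c \<bullet> e)"
    "\<And>c c'. c \<in> X \<Longrightarrow> c' \<in> X \<Longrightarrow> c \<noteq> c' \<Longrightarrow> (1 - \<kappa>) * (c \<bullet> c) \<le> 1 \<Longrightarrow> (1 - \<kappa>) * (c' \<bullet> c') \<le> 1 \<Longrightarrow>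
      ip N (V c) (V c') = (1 - \<kappa>) * (c \<bullet> c')"
proof -
  define D where "D = DIM('a)"
  obtain b :: "nat \<Rightarrow> 'a" where b: "bij_betw b {..<D} Basis"
    using ex_bij_betw_nat_finite[of "Basis :: 'a set"] by (auto simp: D_def atLeast0LessThan)
  obtain idx where idx: "bij_betw idx X {..<card X}"
    using ex_bij_betw_finite_nat[OF X] by (auto simp: atLeast0LessThan)
  define M where "M = card X"
  have idx_less: "idx c < M" if "c \<in> X" for c
    using idx that unfolding M_def bij_betw_def by auto
  have idx_inj: "idx c \<noteq> idx c'" if "c \<in> X" "c' \<in> X" "c \<noteq> c'" for c c'
    using idx that unfolding bij_betw_def inj_on_def by auto
  \<comment> \<open>The first \<open>D\<close> coordinates are those of the vector in an orthonormal
    basis; coordinate \<open>D + j\<close> is a private direction. Variables use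
    \<open>j < M\<close>, and \<open>j = M\<close> is reserved for \<open>z\<close>.\<close>
  define pad where "pad = (\<lambda>(a :: 'a) j r i. if i < D then a \<bullet> b i else if i = D + j then r else (0 :: real))"
  have ip_pad: "ip (Suc (D + M)) (pad a j r) (pad a' j' r') = a \<bullet> a' + (if j = j' then r * r' else 0)"
    if "j \<le> M" "j' \<le> M" for a a' j j' r r'
  proof -
    have "(\<Sum>i<D. (a \<bullet> b i) * (a' \<bullet> b i)) = a \<bullet> a'"
      unfolding euclidean_inner[of a a'] using sum.reindex_bij_betw[OF b, of "\<lambda>u. (a \<bullet> u) * (a' \<bullet> u)"] by simp
    moreover have "(\<Sum>k<Suc M. (if k = j then r else 0) * (if k = j' then r' else 0)) = (if j = j' then r * r' else 0)"
    proof -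
      have "(\<Sum>k<Suc M. (if k = j then r else 0) * (if k = j' then r' else 0)) = (\<Sum>k<Suc M. if k = j then (if j = j' then r * r' else 0) else 0)"
        by (rule sum.cong) auto
      then show ?thesis using that by (simp add: sum.delta)
    qed
    ultimately show ?thesis
      unfolding ip_def add_Suc_right[symmetric] sum_lessThan_add by (simp add: pad_def)
  qed
  \<comment> \<open>A center too long to be scaled into the unit ball, as the arbitrary
    \<open>far\<close> may be, is replaced by 0; the padding still makes it a unit vector.\<close>
  define a where "a = (\<lambda>c :: 'a. if (1 - \<kappa>) * (c \<bullet> c) \<le> 1 then sqrt (1 - \<kappa>) *\<^sub>R c else 0)"
  have a1: "a c \<bullet> a c \<le> 1" for c
    using \<kappa> by (auto simp: a_def mult.assoc[symmetric])
  define V where "V = (\<lambda>c. pad (a c) (idx c) (sqrt (1 - a c \<bullet> a c)))"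
  define z where "z = pad (sqrt (1 - \<kappa>) *\<^sub>R e) M (sqrt \<kappa>)"
  have ee: "e \<bullet> e = 1" using e by (simp add: power2_norm_eq_inner[symmetric])
  show thesis
  proof (rule that[of "Suc (D + M)" z V])
    show "sdp_vectors (Suc (D + M)) z V X"
      unfolding sdp_vectors_def z_def V_def
      using idx_less \<kappa> a1 by (auto simp: ip_pad less_imp_le ee mult.assoc[symmetric])
    show "ip (Suc (D + M)) (V c) z = (1 - \<kappa>) * (c \<bullet> e)" if "c \<in> X" "(1 - \<kappa>) * (c \<bullet> c) \<le> 1" for c
      unfolding z_def V_def using idx_less[OF that(1)] that \<kappa>
      by (simp add: ip_pad a_def mult.assoc[symmetric])
    show "ip (Suc (D + M)) (V c) (V c') = (1 - \<kappa>) * (c \<bullet> c')"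
      if "c \<in> X" "c' \<in> X" "c \<noteq> c'" "(1 - \<kappa>) * (c \<bullet> c) \<le> 1" "(1 - \<kappa>) * (c' \<bullet> c') \<le> 1" for c c'
      unfolding V_def using idx_less[OF that(1)] idx_less[OF that(2)] idx_inj[OF that(1-3)] that \<kappa>
      by (simp add: ip_pad a_def mult.assoc[symmetric])
  qed
qed

lemma ip_scale:
  "ip N (\<lambda>i. s * a i) (\<lambda>i. t * b i) = s * t * ip N a b"
  "ip N (\<lambda>i. s * a i) b = s * ip N a b"
  "ip N a (\<lambda>i. s * b i) = s * ip N a b"
  "ip N (\<lambda>i. - a i) b = - ip N a b"
  "ip N a (\<lambda>i. - b i) = - ip N a b"
  by (simp_all add: ip_def sum_distrib_left sum_negf mult_ac)

lemma ip_commute: "ip N a b = ip N b a"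
  by (simp add: ip_def mult.commute)

text \<open>The literal sign \<open>s\<close> enters the first moments only, since it cancels in the
  second ones. The third moment \<open>m123\<close> is free and is chosen anew in each
  application.\<close>

lemma sdp_value_geI:
  fixes m1 m2 m3 m12 m13 m23 m123 :: real
  assumes nonneg: "\<And>x y z. x \<in> {-1, 1} \<Longrightarrow> y \<in> {-1, 1} \<Longrightarrow> z \<in> {-1, 1} \<Longrightarrow>
      0 \<le> 1 + m1 * x + m2 * y + m3 * z + m12 * x * y + m13 * x * z + m23 * y * z + m123 * x * y * z"
    and m: "s * ip N (entry_vec z V e1) z = m1" "s * ip N (entry_vec z V e2) z = m2" "s * ip N (entry_vec z V e3) z = m3"
      "ip N (entry_vec z V e1) (entry_vec z V e2) = m12" "ip N (entry_vec z V e1) (entry_vec z V e3) = m13"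
      "ip N (entry_vec z V e2) (entry_vec z V e3) = m23"
    and s: "s * s = 1"
    and r: "r \<le> (3 - (m1 + m2 + m3) - (m12 + m13 + m23) + 3 * m123) / 8"
  shows "sdp_value_ge N z V s (e1, e2, e3) r"
proof -
  from cube_distribution[of m1 m2 m3 m12 m13 m23 m123, OF nonneg]
  obtain \<mu> :: "(real \<times> real \<times> real) pmf" where \<mu>:
    "set_pmf \<mu> \<subseteq> {-1, 1} \<times> {-1, 1} \<times> {-1, 1}"
    "measure_pmf.expectation \<mu> (\<lambda>(x1, x2, x3). x1) = m1"
    "measure_pmf.expectation \<mu> (\<lambda>(x1, x2, x3). x2) = m2"
    "measure_pmf.expectation \<mu> (\<lambda>(x1, x2, x3). x3) = m3"
    "measure_pmf.expectation \<mu> (\<lambda>(x1, x2, x3). x1 * x2) = m12"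
    "measure_pmf.expectation \<mu> (\<lambda>(x1, x2, x3). x1 * x3) = m13"
    "measure_pmf.expectation \<mu> (\<lambda>(x1, x2, x3). x2 * x3) = m23"
    "measure_pmf.prob \<mu> {x. one_in_three x} = (3 - (m1 + m2 + m3) - (m12 + m13 + m23) + 3 * m123) / 8"
    by blast
  have "local_distribution N z (literal_vec z V s e1) (literal_vec z V s e2) (literal_vec z V s e3) \<mu>"
    unfolding local_distribution_def literal_vec_def
    using \<mu>(1-7) m s by (simp add: ip_scale)
  then show ?thesis using \<mu>(8) r by auto
qed

section \<open>Geometry of the sampled and discretized vectors\<close>

lemma norm_v0 [simp]: "norm (v0 :: 'n::finite pt) = 1"
  by (simp add: v0_def norm_prod_def)

lemma discretize_near:
  assumes P: "regions \<epsilon> P ctr" and p: "norm p \<le> 2"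
  shows "discretize P ctr far p \<in> ctr ` P" "norm (discretize P ctr far p - p) \<le> \<epsilon> / 1000"
proof -
  have "p \<in> \<Union>P" using P p by (auto simp: regions_def partition_on_def)
  then obtain R where R: "R \<in> P" "p \<in> R" by blast
  have "(THE R. R \<in> P \<and> p \<in> R) = R"
    by (rule the_equality) (use R P in \<open>auto simp: regions_def partition_on_def disjoint_def\<close>)
  then have d: "discretize P ctr far p = ctr R" using p by (simp add: discretize_def)
  show "discretize P ctr far p \<in> ctr ` P" using R by (simp add: d)
  show "norm (discretize P ctr far p - p) \<le> \<epsilon> / 1000"
    using P R by (auto simp: d regions_def dist_norm)
qed

lemma discretize_in_variables:
  assumes P: "regions \<epsilon> P ctr"
  shows "discretize P ctr far p \<in> variables P ctr far"
proof (cases "norm p \<le> 2")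
  case True
  then show ?thesis using discretize_near(1)[OF P True] by (auto simp: variables_def)
qed (simp add: discretize_def variables_def)

lemma finite_variables: "regions \<epsilon> P ctr \<Longrightarrow> finite (variables P ctr far)"
  by (simp add: regions_def variables_def)

lemma inner_perturb:
  fixes c c' p p' :: "'a::real_inner"
  assumes "norm (c - p) \<le> t" "norm (c' - p') \<le> t" and t: "t \<le> 1 / 1000"
    and "p \<bullet> p \<le> 1 + 2 * t" "p' \<bullet> p' \<le> 1 + 2 * t"
  shows "\<bar>c \<bullet> c' - p \<bullet> p'\<bar> \<le> 3 * t"
proof -
  have t0: "t \<ge> 0" using assms(1) norm_ge_zero order_trans by blast
  have n: "norm q \<le> 101 / 100" if "q \<bullet> q \<le> 1 + 2 * t" for q :: 'a
  proof (rule power2_le_imp_le)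
    have "(norm q)\<^sup>2 \<le> 1 + 2 * t" using that by (simp add: power2_norm_eq_inner)
    also have "\<dots> \<le> (101 / 100)\<^sup>2" using t by (simp add: power2_eq_square)
    finally show "(norm q)\<^sup>2 \<le> (101 / 100)\<^sup>2" .
  qed simp
  have "norm c \<le> norm p + norm (c - p)" by (metis add_diff_cancel_left' diff_add_cancel norm_triangle_ineq)
  then have nc: "norm c \<le> 103 / 100" using n[OF assms(4)] assms(1) t by simp
  have "c \<bullet> c' - p \<bullet> p' = c \<bullet> (c' - p') + (c - p) \<bullet> p'" by (simp add: inner_diff)
  also have "\<bar>\<dots>\<bar> \<le> \<bar>c \<bullet> (c' - p')\<bar> + \<bar>(c - p) \<bullet> p'\<bar>" by (rule abs_triangle_ineq)
  also have "\<dots> \<le> norm c * norm (c' - p') + norm (c - p) * norm p'"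
    by (intro add_mono Cauchy_Schwarz_ineq2)
  also have "\<dots> \<le> (103 / 100) * t + t * (101 / 100)"
    by (intro add_mono mult_mono nc n assms t0) auto
  finally show ?thesis using t0 by simp
qed

lemma emb_inner [simp]:
  "emb w \<bullet> emb u = w \<bullet> u" "emb w \<bullet> v0 = 0" "v0 \<bullet> emb w = 0" "v0 \<bullet> (v0 :: 'n::finite pt) = 1"
  by (simp_all add: emb_def v0_def)

lemma abs_sqrt_mult_bound:
  fixes e t :: real
  assumes "0 \<le> a" "a \<le> 1" "\<bar>e\<bar> \<le> t"
  shows "\<bar>a * e\<bar> \<le> t"
proof -
  have "\<bar>a * e\<bar> = a * \<bar>e\<bar>" using assms by (simp add: abs_mult)
  also have "\<dots> \<le> 1 * t" using assms by (intro mult_mono) auto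
  finally show ?thesis by simp
qed

text \<open>For orthonormal \<open>w\<close> and \<open>u\<close> the stated values are exact. In
  general the deviations are linear in the three errors \<open>W\<close>, \<open>U\<close>,
  \<open>C\<close>, the squared norms and the inner product of the samples, with coefficients that
  contribute at most \<open>t\<close> for the norms and \<open>t\<close> for the inner
  product.\<close>

lemma T_vecs_geometry:
  fixes w u :: "real ^ 'n::finite"
  assumes T: "T_vecs s x w u = (p1, p2, p3)" and s: "s = 1 \<or> s = -1" and x: "1 / 2 \<le> x" "x < 1"
    and t: "\<bar>(norm w)\<^sup>2 - 1\<bar> \<le> t" "\<bar>(norm u)\<^sup>2 - 1\<bar> \<le> t" "\<bar>w \<bullet> u\<bar> \<le> t"
  shows "p1 \<bullet> v0 = s * x" "p2 \<bullet> v0 = s * x" "p3 \<bullet> v0 = s * (1 - 2 * x)"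
    "\<bar>p1 \<bullet> p1 - 1\<bar> \<le> 2 * t" "\<bar>p2 \<bullet> p2 - 1\<bar> \<le> 2 * t" "\<bar>p3 \<bullet> p3 - 1\<bar> \<le> 2 * t"
    "\<bar>p1 \<bullet> p2 - (2 * x - 1)\<bar> \<le> 2 * t" "\<bar>p1 \<bullet> p3 + x\<bar> \<le> 2 * t" "\<bar>p2 \<bullet> p3 + x\<bar> \<le> 2 * t"
proof -
  define A S \<rho> \<tau> where "A = sqrt (1 - x\<^sup>2)" and "S = sqrt (1 - (2 * x - 1)\<^sup>2)"
    and "\<rho> = rho x" and "\<tau> = sqrt (1 - (rho x)\<^sup>2)"
  define W U C where "W = w \<bullet> w - 1" and "U = u \<bullet> u - 1" and "C = w \<bullet> u"
  have t': "\<bar>W\<bar> \<le> t" "\<bar>U\<bar> \<le> t" "\<bar>C\<bar> \<le> t"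
    using t by (simp_all add: W_def U_def C_def power2_norm_eq_inner)
  have x2: "x\<^sup>2 < 1" using x by (simp add: power_less_one_iff abs_square_less_1)
  then have A: "A\<^sup>2 = 1 - x\<^sup>2" "A > 0" by (auto simp: A_def)
  have "(2 * x - 1)\<^sup>2 \<le> 1" using x by (simp add: abs_square_le_1)
  then have S: "S\<^sup>2 = 4 * x - 4 * x\<^sup>2" "S \<ge> 0"
    by (auto simp: S_def power2_eq_square algebra_simps)
  \<comment> \<open>The origin of \<open>rho\<close>: the correlation with \<open>w\<close> is tuned
    so that the first two vectors have inner product \<open>- x\<close> with the third.\<close>
  have rA: "\<rho> * A = S / 2" using A by (simp add: \<rho>_def rho_def A_def S_def)
  have \<rho>0: "\<rho> \<ge> 0" unfolding \<rho>_def rho_def using S(2) A(2) by (simp add: A_def S_def)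
  have "\<rho>\<^sup>2 * A\<^sup>2 = S\<^sup>2 / 4" using arg_cong[OF rA, of "\<lambda>z. z\<^sup>2"] by (simp add: power_mult_distrib power_divide)
  then have r2A: "\<rho>\<^sup>2 * A\<^sup>2 = x - x\<^sup>2" using S by simp
  have "\<rho>\<^sup>2 * A\<^sup>2 \<le> A\<^sup>2" unfolding r2A using A(1) x by simp
  moreover have "A\<^sup>2 > 0" using A(2) by simp
  ultimately have \<rho>1: "\<rho>\<^sup>2 \<le> 1" using mult_right_le_imp_le[of "\<rho>\<^sup>2" "A\<^sup>2" 1] by simp
  have \<tau>: "\<tau>\<^sup>2 = 1 - \<rho>\<^sup>2" "\<tau> \<ge> 0" using \<rho>1 by (auto simp: \<tau>_def \<rho>_def)
  have le1: "\<rho> \<le> 1" "\<tau> \<le> 1" "A \<le> 1" "S \<le> 1" "A\<^sup>2 \<le> 1"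
  proof -
    show "\<rho> \<le> 1" using \<rho>1 \<rho>0 by (simp add: abs_square_le_1)
    show "\<tau> \<le> 1" using \<tau> by (simp add: \<tau>_def)
    show "A \<le> 1" "S \<le> 1" by (simp_all add: A_def S_def)
    show "A\<^sup>2 \<le> 1" using A by simp
  qed
  have t2A: "\<tau>\<^sup>2 * A\<^sup>2 = A\<^sup>2 - (x - x\<^sup>2)" unfolding \<tau>(1) left_diff_distrib r2A by simp
  have key1: "x\<^sup>2 + (A\<^sup>2 * \<rho>\<^sup>2 + A\<^sup>2 * \<tau>\<^sup>2) = 1"
    unfolding mult.commute[of "A\<^sup>2"] r2A t2A by (simp add: A(1))
  have key2: "x\<^sup>2 + A\<^sup>2 * \<rho>\<^sup>2 - A\<^sup>2 * \<tau>\<^sup>2 = 2 * x - 1"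
    unfolding mult.commute[of "A\<^sup>2"] r2A t2A by (simp add: A(1))
  have p: "p1 = (s * x) *\<^sub>R v0 + A *\<^sub>R emb (- \<rho> *\<^sub>R w + \<tau> *\<^sub>R u)"
    "p2 = (s * x) *\<^sub>R v0 + A *\<^sub>R emb (- \<rho> *\<^sub>R w - \<tau> *\<^sub>R u)"
    "p3 = (s * (1 - 2 * x)) *\<^sub>R v0 + S *\<^sub>R emb w"
    using T by (auto simp: T_vecs_def A_def S_def \<rho>_def \<tau>_def)
  have ss: "s * s = 1" using s by auto
  show "p1 \<bullet> v0 = s * x" "p2 \<bullet> v0 = s * x" "p3 \<bullet> v0 = s * (1 - 2 * x)"
    by (simp_all add: p inner_add_left)
  have rt: "\<bar>2 * \<rho> * \<tau>\<bar> \<le> 1"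
  proof -
    have "0 \<le> (\<rho> - \<tau>)\<^sup>2" by simp
    then have "2 * \<rho> * \<tau> \<le> 1" using \<tau>(1) by (simp add: power2_diff)
    then show ?thesis using \<rho>0 \<tau>(2) by simp
  qed
  \<comment> \<open>The common shape of all six deviations.\<close>
  have comb: "\<bar>a * (b * W + c * U) + a * (e * C)\<bar> \<le> 2 * t"
    if "0 \<le> a" "a \<le> 1" "\<bar>b\<bar> + \<bar>c\<bar> \<le> 1" "\<bar>e\<bar> \<le> 1" for a b c e
  proof -
    have t0: "t \<ge> 0" using t'(1) by linarith
    have "\<bar>b * W + c * U\<bar> \<le> \<bar>b\<bar> * \<bar>W\<bar> + \<bar>c\<bar> * \<bar>U\<bar>"
      using abs_triangle_ineq[of "b * W" "c * U"] by (simp add: abs_mult)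
    also have "\<dots> \<le> \<bar>b\<bar> * t + \<bar>c\<bar> * t"
      using t' by (intro add_mono mult_left_mono) auto
    also have "\<dots> \<le> 1 * t" unfolding distrib_right[symmetric] using that t0 by (intro mult_right_mono) auto
    finally have 1: "\<bar>a * (b * W + c * U)\<bar> \<le> t" using abs_sqrt_mult_bound[OF that(1,2), of "b * W + c * U" t] by simp
    have "\<bar>e * C\<bar> \<le> 1 * t" unfolding abs_mult using that t' by (intro mult_mono) auto
    then have 2: "\<bar>a * (e * C)\<bar> \<le> t" using abs_sqrt_mult_bound[OF that(1,2), of "e * C" t] by simp
    show ?thesis using 1 2 abs_triangle_ineq[of "a * (b * W + c * U)" "a * (e * C)"] by linarith
  qed
  have sum1: "\<bar>\<rho>\<^sup>2\<bar> + \<bar>\<tau>\<^sup>2\<bar> \<le> 1" using \<tau>(1) \<rho>1 by simp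
  have wuW: "w \<bullet> w = 1 + W" "u \<bullet> u = 1 + U" "w \<bullet> u = C" "u \<bullet> w = C"
    by (simp_all add: W_def U_def C_def inner_commute)
  have "p1 \<bullet> p1 = (s * s) * x\<^sup>2 + A\<^sup>2 * (\<rho>\<^sup>2 * (1 + W) + \<tau>\<^sup>2 * (1 + U) - 2 * \<rho> * \<tau> * C)"
    unfolding p by (simp add: inner_add inner_diff wuW power2_eq_square algebra_simps)
  also have "\<dots> = 1 + (A\<^sup>2 * (\<rho>\<^sup>2 * W + \<tau>\<^sup>2 * U) + A\<^sup>2 * ((- (2 * \<rho> * \<tau>)) * C))"
    unfolding ss using key1 by (simp add: algebra_simps)
  finally show "\<bar>p1 \<bullet> p1 - 1\<bar> \<le> 2 * t"
    using comb[of "A\<^sup>2" "\<rho>\<^sup>2" "\<tau>\<^sup>2" "- (2 * \<rho> * \<tau>)"] le1 sum1 rt by simp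
  have "p2 \<bullet> p2 = (s * s) * x\<^sup>2 + A\<^sup>2 * (\<rho>\<^sup>2 * (1 + W) + \<tau>\<^sup>2 * (1 + U) + 2 * \<rho> * \<tau> * C)"
    unfolding p by (simp add: inner_add inner_diff wuW power2_eq_square algebra_simps)
  also have "\<dots> = 1 + (A\<^sup>2 * (\<rho>\<^sup>2 * W + \<tau>\<^sup>2 * U) + A\<^sup>2 * ((2 * \<rho> * \<tau>) * C))"
    unfolding ss using key1 by (simp add: algebra_simps)
  finally show "\<bar>p2 \<bullet> p2 - 1\<bar> \<le> 2 * t"
    using comb[of "A\<^sup>2" "\<rho>\<^sup>2" "\<tau>\<^sup>2" "2 * \<rho> * \<tau>"] le1 sum1 rt by simp
  have "p3 \<bullet> p3 = (s * s) * (1 - 2 * x)\<^sup>2 + S\<^sup>2 * (1 + W)"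
    unfolding p by (simp add: inner_add inner_diff wuW power2_eq_square algebra_simps)
  also have "\<dots> = 1 + (S\<^sup>2 * (1 * W + 0 * U) + S\<^sup>2 * (0 * C))"
    unfolding ss using S(1) by (simp add: power2_eq_square algebra_simps)
  finally show "\<bar>p3 \<bullet> p3 - 1\<bar> \<le> 2 * t"
    using comb[of "S\<^sup>2" 1 0 0] le1 S(2) by (simp add: power_le_one)
  have "p1 \<bullet> p2 = (s * s) * x\<^sup>2 + A\<^sup>2 * (\<rho>\<^sup>2 * (1 + W) - \<tau>\<^sup>2 * (1 + U))"
    unfolding p by (simp add: inner_add inner_diff wuW power2_eq_square algebra_simps)
  also have "\<dots> = (2 * x - 1) + (A\<^sup>2 * (\<rho>\<^sup>2 * W + (- \<tau>\<^sup>2) * U) + A\<^sup>2 * (0 * C))"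
    unfolding ss using key2 by (simp add: algebra_simps)
  finally show "\<bar>p1 \<bullet> p2 - (2 * x - 1)\<bar> \<le> 2 * t"
    using comb[of "A\<^sup>2" "\<rho>\<^sup>2" "- \<tau>\<^sup>2" 0] le1 sum1 by simp
  have AS: "0 \<le> A * S" "A * S \<le> 1" using A S le1 by (auto simp: mult_le_one)
  have rAS: "\<rho> * (A * S) = 2 * x - 2 * x\<^sup>2"
    using S(1) by (simp add: mult.assoc[symmetric] rA power2_eq_square)
  have b1: "\<bar>- \<rho>\<bar> + \<bar>0 :: real\<bar> \<le> 1" using \<rho>0 le1 by simp
  have "p1 \<bullet> p3 = (s * s) * (x * (1 - 2 * x)) + A * S * (- \<rho> * (1 + W) + \<tau> * C)"
    unfolding p by (simp add: inner_add inner_diff wuW power2_eq_square algebra_simps)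
  also have "\<dots> = - x + (A * S * ((- \<rho>) * W + 0 * U) + A * S * (\<tau> * C))"
    unfolding ss using rAS by (simp add: power2_eq_square algebra_simps)
  finally show "\<bar>p1 \<bullet> p3 + x\<bar> \<le> 2 * t"
    using comb[OF AS b1, of \<tau>] le1 \<tau>(2) by simp
  have "p2 \<bullet> p3 = (s * s) * (x * (1 - 2 * x)) + A * S * (- \<rho> * (1 + W) - \<tau> * C)"
    unfolding p by (simp add: inner_add inner_diff wuW power2_eq_square algebra_simps)
  also have "\<dots> = - x + (A * S * ((- \<rho>) * W + 0 * U) + A * S * ((- \<tau>) * C))"
    unfolding ss using rAS by (simp add: power2_eq_square algebra_simps)
  finally show "\<bar>p2 \<bullet> p3 + x\<bar> \<le> 2 * t"
    using comb[OF AS b1, of "- \<tau>"] le1 \<tau>(2) by simp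
qed

lemma abs_scale_diff:
  fixes K a b :: real
  assumes "0 \<le> K" "K \<le> 1" "\<bar>a - b\<bar> \<le> e"
  shows "K * a \<le> K * b + e" "K * b - e \<le> K * a"
  using abs_sqrt_mult_bound[OF assms] by (simp_all add: right_diff_distrib abs_le_iff)

text \<open>The ideal moments are those of the distribution that makes only the first, only the
  second or only the third literal true, with probabilities (1 - x)/2, (1 - x)/2 and x. The factor
  \<open>1 - 1000 * t\<close> mixes in the uniform distribution with weight \<open>1000 * t\<close>,
  and the six moment errors of \<open>5 * t\<close> disturb each Fourier sum by at most
  \<open>30 * t\<close>.\<close>

lemma sdp_value_T:
  fixes c1 c2 c3 :: "'n::finite pt" and x t \<sigma> :: real
  assumes t: "0 < t" "t < 1 / 1000" and x: "1 / 2 \<le> x" "x < 1" and \<sigma>: "\<sigma> * \<sigma> = 1"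
    and ipz: "\<And>c. c \<in> {c1, c2, c3} \<Longrightarrow> ip N (V c) z = (1 - 1000 * t) * (c \<bullet> v0)"
    and ipV: "\<And>c c'. c \<in> {c1, c2, c3} \<Longrightarrow> c' \<in> {c1, c2, c3} \<Longrightarrow> c \<noteq> c' \<Longrightarrow> ip N (V c) (V c') = (1 - 1000 * t) * (c \<bullet> c')"
    and unit: "ip N (V c1) (V c1) = 1"
    and v: "\<bar>\<sigma> * (c1 \<bullet> v0) - (- x)\<bar> \<le> 5 * t" "\<bar>\<sigma> * (c2 \<bullet> v0) - (- x)\<bar> \<le> 5 * t" "\<bar>\<sigma> * (c3 \<bullet> v0) - (2 * x - 1)\<bar> \<le> 5 * t"
    and n: "\<bar>c1 \<bullet> c1 - 1\<bar> \<le> 5 * t" "\<bar>c2 \<bullet> c2 - 1\<bar> \<le> 5 * t"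
    and m: "\<bar>c1 \<bullet> c2 - (2 * x - 1)\<bar> \<le> 5 * t" "\<bar>c1 \<bullet> c3 - (- x)\<bar> \<le> 5 * t" "\<bar>c2 \<bullet> c3 - (- x)\<bar> \<le> 5 * t"
  shows "sdp_value_ge N z V \<sigma> (Var c1, Var c2, Var c3) (1 - 1000 * t)"
proof -
  define K where "K = 1 - 1000 * t"
  have K: "0 \<le> K" "K \<le> 1" using t by (auto simp: K_def)
  define y where "y = K * x"
  have Kx: "K * (- x) = - y" "K * (2 * x - 1) = 2 * y - K" by (simp_all add: y_def algebra_simps)
  have y: "y \<le> K" using K x by (simp add: y_def mult_left_le)
  have y2: "K \<le> 2 * y"
    using mult_left_mono[of "1 / 2" x K] K x by (simp add: y_def)
  \<comment> \<open>The first two centers have squared norm near 1 but negative inner product with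
    the third. They may coincide with each other, which is why the two cases below are
    needed.\<close>
  have ne: "c1 \<noteq> c3" "c2 \<noteq> c3" using n m x t by (auto simp: abs_le_iff)
  define m1 m2 m3 m12 m13 m23 where "m1 = K * (\<sigma> * (c1 \<bullet> v0))" and "m2 = K * (\<sigma> * (c2 \<bullet> v0))"
    and "m3 = K * (\<sigma> * (c3 \<bullet> v0))" and "m12 = K * (c1 \<bullet> c2)" and "m13 = K * (c1 \<bullet> c3)" and "m23 = K * (c2 \<bullet> c3)"
  note defs = m1_def m2_def m3_def m12_def m13_def m23_def
  note bounds = abs_scale_diff[OF K v(1)] abs_scale_diff[OF K v(2)] abs_scale_diff[OF K v(3)]
    abs_scale_diff[OF K m(2)] abs_scale_diff[OF K m(3)]
  note bounds = bounds[folded defs, unfolded Kx]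
  have mz: "\<sigma> * ip N (entry_vec z V (Var c1)) z = m1" "\<sigma> * ip N (entry_vec z V (Var c2)) z = m2"
    "\<sigma> * ip N (entry_vec z V (Var c3)) z = m3"
    by (simp_all add: ipz K_def defs)
  have mV: "ip N (entry_vec z V (Var c1)) (entry_vec z V (Var c3)) = m13" "ip N (entry_vec z V (Var c2)) (entry_vec z V (Var c3)) = m23"
    using ne by (simp_all add: ipV K_def defs)
  have r: "1 - 1000 * t = K" by (simp add: K_def)
  have tK: "1000 * t = 1 - K" by (simp add: K_def)
  show ?thesis
  proof (cases "c1 = c2")
    case False
    then have mV12: "ip N (entry_vec z V (Var c1)) (entry_vec z V (Var c2)) = m12"
      by (simp add: ipV K_def defs)
    note b = bounds abs_scale_diff[OF K m(1), folded defs, unfolded Kx]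
    show ?thesis
    \<comment> \<open>Every assignment with exactly one true literal has product 1, so the ideal
      third moment is 1, scaled by \<open>K\<close>.\<close>
    proof (rule sdp_value_geI[OF _ mz mV12 mV \<sigma>, where ?m123.0 = K])
      fix a b c :: real assume "a \<in> {-1, 1}" "b \<in> {-1, 1}" "c \<in> {-1, 1}"
      then consider "a = 1" "b = 1" "c = 1" | "a = 1" "b = 1" "c = -1" | "a = 1" "b = -1" "c = 1" | "a = 1" "b = -1" "c = -1"
        | "a = -1" "b = 1" "c = 1" | "a = -1" "b = 1" "c = -1" | "a = -1" "b = -1" "c = 1" | "a = -1" "b = -1" "c = -1"
        by auto
      then show "0 \<le> 1 + m1 * a + m2 * b + m3 * c + m12 * a * b + m13 * a * c + m23 * b * c + K * a * b * c"
        by cases (simp_all, (use b y y2 tK t K in linarith)+)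
    next
      show "1 - 1000 * t \<le> (3 - (m1 + m2 + m3) - (m12 + m13 + m23) + 3 * K) / 8"
        unfolding r using b y tK t K by simp
    qed
  next
    case True
    \<comment> \<open>Coinciding centers share one unit vector, so this moment is not scaled. Then
      \<open>2 * x - 1\<close> must be close to 1, so \<open>x\<close> is close to 1 as
      well.\<close>
    have mV12: "ip N (entry_vec z V (Var c1)) (entry_vec z V (Var c2)) = 1"
      using True unit by simp
    have "x \<ge> 1 - 5 * t" using True n m by (auto simp: abs_le_iff)
    then have "K * x \<ge> K * (1 - 5 * t)" using K by (intro mult_left_mono) auto
    moreover have "K * (5 * t) \<le> 1 * (5 * t)" using K t by (intro mult_right_mono) auto
    ultimately have yK: "y \<ge> K - 5 * t" by (simp add: y_def right_diff_distrib)
    have eq: "m2 = m1" "m23 = m13" using True by (simp_all add: defs)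
    note b = bounds[unfolded eq]
    show ?thesis
    \<comment> \<open>The first two bits are equal with certainty, so their product with the third
      bit has the mean of the third bit; no other third moment is possible.\<close>
    proof (rule sdp_value_geI[OF _ mz mV12 mV \<sigma>, where ?m123.0 = m3])
      fix a b c :: real assume "a \<in> {-1, 1}" "b \<in> {-1, 1}" "c \<in> {-1, 1}"
      then consider "a = 1" "b = 1" "c = 1" | "a = 1" "b = 1" "c = -1" | "a = 1" "b = -1" "c = 1" | "a = 1" "b = -1" "c = -1"
        | "a = -1" "b = 1" "c = 1" | "a = -1" "b = 1" "c = -1" | "a = -1" "b = -1" "c = 1" | "a = -1" "b = -1" "c = -1"
        by auto
      then show "0 \<le> 1 + m1 * a + m2 * b + m3 * c + 1 * a * b + m13 * a * c + m23 * b * c + m3 * a * b * c"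
        unfolding eq by cases (simp_all, (use b y y2 yK tK t K in linarith)+)
    next
      show "1 - 1000 * t \<le> (3 - (m1 + m2 + m3) - (1 + m13 + m23) + 3 * m3) / 8"
        unfolding r eq using b y yK tK t K by simp
    qed
  qed
qed

text \<open>Both constant literals are false, so only the third bit is random and the constraint
  holds exactly when it is 1.\<close>

lemma sdp_value_A:
  fixes c :: "'n::finite pt"
  assumes z: "ip N z z = 1" and m3: "\<sigma> * ip N (V c) z = m3" "\<bar>m3\<bar> \<le> 1" and r: "r \<le> (1 + m3) / 2"
    and e: "(e = Const_neg \<and> \<sigma> = 1) \<or> (e = Const_pos \<and> \<sigma> = -1)"
  shows "sdp_value_ge N z V \<sigma> (e, e, Var c) r"
proof (rule sdp_value_geI[where ?m1.0 = "-1" and ?m2.0 = "-1" and ?m3.0 = m3 and ?m12.0 = 1 and ?m13.0 = "- m3" and ?m23.0 = "- m3" and ?m123.0 = m3])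
  fix a b c :: real assume "a \<in> {-1, 1}" "b \<in> {-1, 1}" "c \<in> {-1, 1}"
  then show "0 \<le> 1 + - 1 * a + - 1 * b + m3 * c + 1 * a * b + - m3 * a * c + - m3 * b * c + m3 * a * b * c"
    using m3(2) by (auto simp: abs_le_iff)
qed (use e z m3 r ip_commute[of N z "V c"] in \<open>auto simp: ip_scale\<close>)

text \<open>For \<epsilon> \<ge> 1 the required value is at most 0, but a local distribution must
  still exist: independent fair bits, identified where centers coincide.\<close>

lemma sdp_value_orthogonal:
  fixes c1 c2 c3 :: "'n::finite pt"
  assumes ipz: "\<And>c. c \<in> {c1, c2, c3} \<Longrightarrow> ip N (V c) z = 0"
    and ipV: "\<And>c c'. c \<in> {c1, c2, c3} \<Longrightarrow> c' \<in> {c1, c2, c3} \<Longrightarrow> c \<noteq> c' \<Longrightarrow> ip N (V c) (V c') = 0"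
    and unit: "\<And>c. c \<in> {c1, c2, c3} \<Longrightarrow> ip N (V c) (V c) = 1"
    and \<sigma>: "\<sigma> * \<sigma> = 1" and r: "r \<le> 0"
  shows "sdp_value_ge N z V \<sigma> (Var c1, Var c2, Var c3) r"
proof (rule sdp_value_geI[where ?m1.0 = 0 and ?m2.0 = 0 and ?m3.0 = 0 and ?m12.0 = "of_bool (c1 = c2)"
      and ?m13.0 = "of_bool (c1 = c3)" and ?m23.0 = "of_bool (c2 = c3)" and ?m123.0 = 0, OF _ _ _ _ _ _ _ \<sigma>])
  fix a b c :: real assume "a \<in> {-1, 1}" "b \<in> {-1, 1}" "c \<in> {-1, 1}"
  then show "0 \<le> 1 + 0 * a + 0 * b + 0 * c + of_bool (c1 = c2) * a * b + of_bool (c1 = c3) * a * c + of_bool (c2 = c3) * b * c + 0 * a * b * c"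
    by auto
qed (use r in \<open>auto simp: ipz ipV unit of_bool_def\<close>)

lemma A_vec_geometry:
  fixes w :: "real ^ 'n::finite"
  assumes "\<bar>x\<bar> \<le> 1" "\<bar>(norm w)\<^sup>2 - 1\<bar> \<le> t"
  shows "A_vec x w \<bullet> v0 = x" "\<bar>A_vec x w \<bullet> A_vec x w - 1\<bar> \<le> t"
proof -
  show "A_vec x w \<bullet> v0 = x" by (simp add: A_vec_def inner_add)
  have x2: "x\<^sup>2 \<le> 1" using assms(1) by (simp add: abs_square_le_1)
  then have "A_vec x w \<bullet> A_vec x w = 1 + (1 - x\<^sup>2) * (w \<bullet> w - 1)"
    by (simp add: A_vec_def inner_add power2_eq_square algebra_simps)
  moreover have "\<bar>(1 - x\<^sup>2) * (w \<bullet> w - 1)\<bar> \<le> t"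
    by (rule abs_sqrt_mult_bound) (use x2 assms(2) in \<open>auto simp: power2_norm_eq_inner\<close>)
  ultimately show "\<bar>A_vec x w \<bullet> A_vec x w - 1\<bar> \<le> t" by simp
qed

lemma level_bounds:
  "0 \<le> level k" "level k < 1" "k \<ge> 1 \<Longrightarrow> 1 / 2 \<le> level k"
proof -
  show "0 \<le> level k" "level k < 1" by (simp_all add: level_def power_le_one)
  assume "k \<ge> 1"
  then have "(1 / 2 :: real) ^ k \<le> (1 / 2) ^ 1" by (intro power_decreasing) auto
  then show "1 / 2 \<le> level k" by (simp add: level_def)
qed

text \<open>The summand 20 makes the last level come within \<epsilon>/1000 of 1, since 2^20 exceeds
  1000.\<close>

lemma level_k0:
  assumes \<epsilon>: "0 < \<epsilon>" "\<epsilon> < 1" and k0: "k0 = nat (\<lceil>log 2 (1 / \<epsilon>)\<rceil> + 20)"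
  shows "real_of_int \<lceil>log 2 (1 / \<epsilon>)\<rceil> \<ge> 1" "real k0 = real_of_int \<lceil>log 2 (1 / \<epsilon>)\<rceil> + 20" "1 - \<epsilon> / 1000 \<le> level k0"
proof -
  have l: "log 2 (1 / \<epsilon>) > 0" using \<epsilon> by (simp add: field_simps)
  then have L: "\<lceil>log 2 (1 / \<epsilon>)\<rceil> \<ge> 1" by (simp add: one_le_ceiling)
  then show "real_of_int \<lceil>log 2 (1 / \<epsilon>)\<rceil> \<ge> 1" by simp
  show rk: "real k0 = real_of_int \<lceil>log 2 (1 / \<epsilon>)\<rceil> + 20" using L k0 by simp
  have "log 2 (1 / \<epsilon>) + 20 \<le> real k0" unfolding rk by (simp add: le_of_int_ceiling)
  then have "2 powr (log 2 (1 / \<epsilon>) + 20) \<le> 2 powr real k0" by simp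
  also have "2 powr (log 2 (1 / \<epsilon>) + 20) = 2 ^ 20 / \<epsilon>"
  proof -
    have "2 powr (20 :: real) = 2 ^ 20" using powr_realpow[of 2 20] by simp
    then show ?thesis using \<epsilon> by (simp add: powr_add)
  qed
  also have "2 powr real k0 = 2 ^ k0" by (simp add: powr_realpow)
  finally have "2 ^ 20 / \<epsilon> \<le> 2 ^ k0" .
  moreover have "1000 / \<epsilon> \<le> 2 ^ 20 / \<epsilon>" using \<epsilon> by (intro divide_right_mono) auto
  ultimately have "1000 / \<epsilon> \<le> 2 ^ k0" by linarith
  then have "(1 / 2) ^ k0 \<le> \<epsilon> / 1000" using \<epsilon> by (simp add: power_divide field_simps)
  then show "1 - \<epsilon> / 1000 \<le> level k0" by (simp add: level_def)
qed

lemma sdp_solution: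
  fixes \<epsilon> :: real and P :: "'n::finite pt set set"
  assumes \<epsilon>: "\<epsilon> > 0" and k0: "k0 = nat (\<lceil>log 2 (1 / \<epsilon>)\<rceil> + 20)" and P: "regions \<epsilon> P ctr"
  shows "\<exists>N z V. sdp_vectors N z V (variables P ctr far) \<and>
    (\<forall>src\<in>sources k0. \<forall>w u :: real ^ 'n. \<not> discarded \<epsilon> (src, w, u) \<longrightarrow>
       sdp_value_ge N z V (literal_sign src) (constraint_triple P ctr far k0 (src, w, u)) (1 - \<epsilon>))"
proof -
  define X where "X = variables P ctr far"
  \<comment> \<open>For \<epsilon> \<ge> 1 the padding takes over completely and all distinct
    vectors become orthogonal.\<close>
  define \<kappa> where "\<kappa> = min \<epsilon> 1"
  have \<kappa>: "0 \<le> \<kappa>" "\<kappa> \<le> 1" using \<epsilon> by (auto simp: \<kappa>_def)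
  obtain N z V where sdp: "sdp_vectors N z V X"
    and ipz: "\<And>c. c \<in> X \<Longrightarrow> (1 - \<kappa>) * (c \<bullet> c) \<le> 1 \<Longrightarrow> ip N (V c) z = (1 - \<kappa>) * (c \<bullet> v0)"
    and ipV: "\<And>c c'. c \<in> X \<Longrightarrow> c' \<in> X \<Longrightarrow> c \<noteq> c' \<Longrightarrow> (1 - \<kappa>) * (c \<bullet> c) \<le> 1 \<Longrightarrow> (1 - \<kappa>) * (c' \<bullet> c') \<le> 1 \<Longrightarrow>
      ip N (V c) (V c') = (1 - \<kappa>) * (c \<bullet> c')"
    using padded_vectors[of X \<kappa> v0] \<kappa> finite_variables[OF P] unfolding X_def by (metis norm_v0)
  have zz: "ip N z z = 1" and VV: "\<And>c. c \<in> X \<Longrightarrow> ip N (V c) (V c) = 1"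
    using sdp by (auto simp: sdp_vectors_def)
  let ?d = "discretize P ctr far"
  have dX: "?d p \<in> X" for p unfolding X_def by (rule discretize_in_variables[OF P])
  have "sdp_value_ge N z V (literal_sign src) (constraint_triple P ctr far k0 (src, w, u)) (1 - \<epsilon>)"
    if src: "src \<in> sources k0" and nd: "\<not> discarded \<epsilon> (src, w, u)" for src and w u :: "real ^ 'n"
  proof (cases "\<epsilon> < 1")
    case False
    then have k1: "\<kappa> = 1" by (simp add: \<kappa>_def)
    have T: "sdp_value_ge N z V \<sigma> (Var (?d p1), Var (?d p2), Var (?d p3)) (1 - \<epsilon>)" if "\<sigma> * \<sigma> = 1" for p1 p2 p3 \<sigma>
    proof (rule sdp_value_orthogonal[OF _ _ _ that])
      show "ip N (V c) z = 0" if "c \<in> {?d p1, ?d p2, ?d p3}" for c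
        using that by (elim insertE emptyE) (simp_all add: ipz[OF dX] k1)
      show "ip N (V c) (V c') = 0" if "c \<in> {?d p1, ?d p2, ?d p3}" "c' \<in> {?d p1, ?d p2, ?d p3}" "c \<noteq> c'" for c c'
        using that by (elim insertE emptyE) (simp_all add: ipV[OF dX dX] k1)
      show "ip N (V c) (V c) = 1" if "c \<in> {?d p1, ?d p2, ?d p3}" for c
        using that by (elim insertE emptyE) (simp_all add: VV[OF dX])
    qed (use False in simp)
    have A: "sdp_value_ge N z V \<sigma> (e, e, Var (?d p)) (1 - \<epsilon>)"
      if "(e = Const_neg \<and> \<sigma> = 1) \<or> (e = Const_pos \<and> \<sigma> = -1)" for e \<sigma> p
      by (rule sdp_value_A[OF zz _ _ _ that, where ?m3.0 = 0]) (use ipz[OF dX] k1 False in auto)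
    show ?thesis
    proof (cases src)
      case (T_pos k)
      then show ?thesis by (auto simp: constraint_triple_def T_vecs_def intro!: T simp del: sdp_value_ge.simps)
    next
      case (T_neg k)
      then show ?thesis by (auto simp: constraint_triple_def T_vecs_def intro!: T simp del: sdp_value_ge.simps)
    next
      case A_pos
      then show ?thesis by (auto simp: constraint_triple_def intro!: A simp del: sdp_value_ge.simps)
    next
      case A_neg
      then show ?thesis by (auto simp: constraint_triple_def intro!: A simp del: sdp_value_ge.simps)
    qed
  next
    case True
    define t where "t = \<epsilon> / 1000"
    have t: "0 < t" "t < 1 / 1000" using True \<epsilon> by (auto simp: t_def)
    have \<epsilon>t: "\<epsilon> = 1000 * t" and \<kappa>t: "\<kappa> = 1000 * t" using True by (auto simp: t_def \<kappa>_def)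
    have w: "\<bar>(norm w)\<^sup>2 - 1\<bar> \<le> t" using nd by (auto simp: t_def not_less)
    have near: "norm (?d p - p) \<le> t" if "p \<bullet> p \<le> 1 + 2 * t" for p
    proof -
      have "norm p \<le> 2"
        by (rule power2_le_imp_le) (use that t in \<open>simp_all add: power2_norm_eq_inner\<close>)
      then show ?thesis using discretize_near(2)[OF P] by (simp add: t_def)
    qed
    \<comment> \<open>An error of \<open>2 * t\<close> comes from the Gaussian samples and one of
      \<open>3 * t\<close> from moving two vectors to their centers.\<close>
    have near_inner: "\<bar>?d p \<bullet> ?d p' - a\<bar> \<le> 5 * t"
      if "\<bar>p \<bullet> p - 1\<bar> \<le> 2 * t" "\<bar>p' \<bullet> p' - 1\<bar> \<le> 2 * t" "\<bar>p \<bullet> p' - a\<bar> \<le> 2 * t" for p p' a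
    proof -
      have pp: "p \<bullet> p \<le> 1 + 2 * t" "p' \<bullet> p' \<le> 1 + 2 * t" using that by linarith+
      have "\<bar>?d p \<bullet> ?d p' - p \<bullet> p'\<bar> \<le> 3 * t"
        by (rule inner_perturb[OF near near]) (use pp t in auto)
      then show ?thesis using that(3) by linarith
    qed
    have near_v0: "\<bar>\<sigma> * (?d p \<bullet> v0) - \<sigma> * (p \<bullet> v0)\<bar> \<le> t"
      if "\<bar>p \<bullet> p - 1\<bar> \<le> 2 * t" "\<bar>\<sigma>\<bar> = 1" for p \<sigma>
    proof -
      have "\<bar>\<sigma> * (?d p \<bullet> v0) - \<sigma> * (p \<bullet> v0)\<bar> = \<bar>(?d p - p) \<bullet> v0\<bar>"
        using that(2) by (simp add: inner_diff_left right_diff_distrib[symmetric] abs_mult)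
      also have "\<dots> \<le> norm (?d p - p) * norm (v0 :: 'n pt)" by (rule Cauchy_Schwarz_ineq2)
      also have "\<dots> \<le> t" using near[of p] that(1) by simp
      finally show ?thesis .
    qed
    \<comment> \<open>Centers of retained samples exceed squared length 1 by at most
      \<open>5 * t\<close>, while the scaling removes \<open>1000 * t\<close>; so the padding lemma
      applies to them.\<close>
    have short: "(1 - \<kappa>) * (?d p \<bullet> ?d p) \<le> 1" if "\<bar>p \<bullet> p - 1\<bar> \<le> 2 * t" for p
    proof -
      have "?d p \<bullet> ?d p \<le> 1 + 5 * t" using near_inner[OF that that that] by linarith
      then have "(1 - \<kappa>) * (?d p \<bullet> ?d p) \<le> (1 - \<kappa>) * (1 + 5 * t)"
        using \<kappa> by (intro mult_left_mono) auto
      also have "\<dots> = 1 - t * (995 + 5000 * t)" by (simp add: \<kappa>t algebra_simps)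
      also have "\<dots> \<le> 1" using t by simp
      finally show ?thesis .
    qed
    have T: "sdp_value_ge N z V (- s) (Var (?d p1), Var (?d p2), Var (?d p3)) (1 - \<epsilon>)"
      if T: "T_vecs s x w u = (p1, p2, p3)" and s: "s = 1 \<or> s = -1" and x: "1 / 2 \<le> x" "x < 1"
        and u: "\<bar>(norm u)\<^sup>2 - 1\<bar> \<le> t" "\<bar>w \<bullet> u\<bar> \<le> t" for s x p1 p2 p3
    proof -
      note g = T_vecs_geometry[OF T s x w u]
      have s1: "\<bar>- s\<bar> = 1" "s * s = 1" using s by auto
      have ss: "- s * (s * y) = - y" for y using s by auto
      show ?thesis unfolding \<epsilon>t
      proof (rule sdp_value_T[OF t x])
        show "- s * - s = 1" using s by auto
        show "ip N (V c) z = (1 - 1000 * t) * (c \<bullet> v0)" if "c \<in> {?d p1, ?d p2, ?d p3}" for c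
          using that g(4-6) by (elim insertE emptyE) (simp_all add: ipz[OF dX short] \<kappa>t)
        show "ip N (V c) (V c') = (1 - 1000 * t) * (c \<bullet> c')"
          if "c \<in> {?d p1, ?d p2, ?d p3}" "c' \<in> {?d p1, ?d p2, ?d p3}" "c \<noteq> c'" for c c'
          using that g(4-6) by (elim insertE emptyE) (simp_all add: ipV[OF dX dX _ short short] \<kappa>t)
        show "ip N (V (?d p1)) (V (?d p1)) = 1" by (rule VV[OF dX])
        show "\<bar>- s * (?d p1 \<bullet> v0) - - x\<bar> \<le> 5 * t"
          using near_v0[OF g(4) s1(1)] t unfolding g(1) ss by linarith
        show "\<bar>- s * (?d p2 \<bullet> v0) - - x\<bar> \<le> 5 * t"
          using near_v0[OF g(5) s1(1)] t unfolding g(2) ss by linarith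
        show "\<bar>- s * (?d p3 \<bullet> v0) - (2 * x - 1)\<bar> \<le> 5 * t"
          using near_v0[OF g(6) s1(1)] t unfolding g(3) ss by linarith
        show "\<bar>?d p1 \<bullet> ?d p1 - 1\<bar> \<le> 5 * t" by (rule near_inner[OF g(4) g(4) g(4)])
        show "\<bar>?d p2 \<bullet> ?d p2 - 1\<bar> \<le> 5 * t" by (rule near_inner[OF g(5) g(5) g(5)])
        show "\<bar>?d p1 \<bullet> ?d p2 - (2 * x - 1)\<bar> \<le> 5 * t" by (rule near_inner[OF g(4) g(5) g(7)])
        show "\<bar>?d p1 \<bullet> ?d p3 - - x\<bar> \<le> 5 * t" by (rule near_inner[OF g(4) g(6)]) (use g(8) in simp)
        show "\<bar>?d p2 \<bullet> ?d p3 - - x\<bar> \<le> 5 * t" by (rule near_inner[OF g(5) g(6)]) (use g(9) in simp)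
      qed
    qed
    have A: "sdp_value_ge N z V \<sigma> (e, e, Var (?d (A_vec (\<sigma> * level k0) w))) (1 - \<epsilon>)"
      if e: "(e = Const_neg \<and> \<sigma> = 1) \<or> (e = Const_pos \<and> \<sigma> = -1)" for e \<sigma>
    proof -
      define p where "p = A_vec (\<sigma> * level k0) w"
      have \<sigma>: "\<bar>\<sigma>\<bar> = 1" "\<sigma> * (\<sigma> * y) = y" for y using e by auto
      have "\<bar>\<sigma> * level k0\<bar> \<le> 1" using \<sigma>(1) level_bounds(1,2)[of k0] by (simp add: abs_mult)
      note g = A_vec_geometry[OF this w, folded p_def]
      have g2: "\<bar>p \<bullet> p - 1\<bar> \<le> 2 * t" using g(2) t by linarith
      have v: "\<bar>\<sigma> * (?d p \<bullet> v0) - level k0\<bar> \<le> t"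
        using near_v0[OF g2 \<sigma>(1)] unfolding g(1) \<sigma>(2) .
      have l: "1 - t \<le> level k0" "level k0 < 1"
        using level_k0(3)[OF \<epsilon> True k0] level_bounds(2)[of k0] by (auto simp: t_def)
      show ?thesis unfolding p_def[symmetric]
      proof (rule sdp_value_A[OF zz refl _ _ e])
        have m3: "\<sigma> * ip N (V (?d p)) z = (1 - 1000 * t) * (\<sigma> * (?d p \<bullet> v0))"
          using ipz[OF dX short[OF g2]] by (simp add: \<kappa>t)
        define q where "q = \<sigma> * (?d p \<bullet> v0)"
        \<comment> \<open>One \<open>t\<close> is lost by discretization and one by the distance of
          \<open>level k0\<close> from 1. The scaling lowers the mean by about
          \<open>1000 * t\<close>, hence the value by about half of that.\<close>
        have q: "1 - 2 * t \<le> q" "q \<le> 1 + t" using v l unfolding q_def by linarith+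
        have K: "0 \<le> 1 - 1000 * t" using t by simp
        have "(1 - 1000 * t) * q \<le> (1 - 1000 * t) * (1 + t)" using K q by (intro mult_left_mono) auto
        also have "\<dots> = 1 - t * (999 + 1000 * t)" by (simp add: algebra_simps)
        also have "\<dots> \<le> 1" using t by simp
        finally have u1: "(1 - 1000 * t) * q \<le> 1" .
        have "(1 - 1000 * t) * (1 - 2 * t) \<le> (1 - 1000 * t) * q" using K q by (intro mult_left_mono) auto
        moreover have "(1 - 1000 * t) * (1 - 2 * t) = 1 - 1002 * t + 2000 * (t * t)" by (simp add: algebra_simps)
        moreover have "0 \<le> t * t" by simp
        ultimately have u2: "1 - 1002 * t \<le> (1 - 1000 * t) * q" by linarith
        show "\<bar>\<sigma> * ip N (V (?d p)) z\<bar> \<le> 1"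
          unfolding m3 q_def[symmetric] using u1 u2 t by (simp add: abs_le_iff)
        show "1 - \<epsilon> \<le> (1 + \<sigma> * ip N (V (?d p)) z) / 2"
          unfolding m3 q_def[symmetric] \<epsilon>t using u2 t by simp
      qed
    qed
    show ?thesis
    proof (cases src)
      case (T_pos k)
      obtain p1 p2 p3 where p: "T_vecs 1 (level k) w u = (p1, p2, p3)" by (metis prod_cases3)
      have "1 \<le> k" using src T_pos by (auto simp: sources_def)
      then have "sdp_value_ge N z V (- 1) (Var (?d p1), Var (?d p2), Var (?d p3)) (1 - \<epsilon>)"
        using nd T_pos level_bounds[of k] by (intro T[OF p]) (auto simp: t_def not_less)
      then show ?thesis using T_pos p by (simp add: constraint_triple_def del: sdp_value_ge.simps)
    next
      case (T_neg k)
      obtain p1 p2 p3 where p: "T_vecs (- 1) (level k) w u = (p1, p2, p3)" by (metis prod_cases3)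
      have "1 \<le> k" using src T_neg by (auto simp: sources_def)
      then have "sdp_value_ge N z V (- (- 1)) (Var (?d p1), Var (?d p2), Var (?d p3)) (1 - \<epsilon>)"
        using nd T_neg level_bounds[of k] by (intro T[OF p]) (auto simp: t_def not_less)
      then show ?thesis using T_neg p by (simp add: constraint_triple_def del: sdp_value_ge.simps)
    next
      case A_pos
      then show ?thesis using A[of Const_neg 1] by (simp add: constraint_triple_def del: sdp_value_ge.simps)
    next
      case A_neg
      then show ?thesis using A[of Const_pos "- 1"] by (simp add: constraint_triple_def del: sdp_value_ge.simps)
    qed
  qed
  then show ?thesis using sdp unfolding X_def by blast
qed

section \<open>Violated constraints\<close>

lemma A_vec_eq: "A_vec x w = (sqrt (1 - x\<^sup>2) *\<^sub>R w, x)"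
  by (simp add: A_vec_def v0_def emb_def)

lemma A_vec_measurable [measurable]: "A_vec x \<in> borel \<rightarrow>\<^sub>M borel"
  unfolding A_vec_eq[abs_def] by (intro borel_measurable_continuous_onI continuous_intros)

text \<open>Each entry becomes \<open>A_vec\<close> at a signed level applied to a Gaussian vector,
  so an assignment is seen only through one set in R^d per signed level.\<close>

lemma T_vecs_eq:
  assumes s: "s = 1 \<or> s = -1"
  shows "T_vecs s x w u =
    (A_vec (s * x) ((- rho x) *\<^sub>R w + sqrt (1 - (rho x)\<^sup>2) *\<^sub>R u),
     A_vec (s * x) ((- rho x) *\<^sub>R w + (- sqrt (1 - (rho x)\<^sup>2)) *\<^sub>R u),
     A_vec (- s * (2 * x - 1)) w)"
proof -
  have sq: "(s * y)\<^sup>2 = y\<^sup>2" "(- s * y)\<^sup>2 = y\<^sup>2" for y using s by auto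
  show ?thesis
    unfolding T_vecs_def A_vec_def sq by (simp add: algebra_simps)
qed

text \<open>In closed form \<open>(rho x)\<^sup>2\<close> is \<open>x / (1 + x)\<close>; the bound
  1/2 is approached as \<open>x\<close> tends to 1.\<close>

lemma rho_bounds:
  assumes x: "1 / 2 \<le> x" "x < 1"
  shows "(rho x)\<^sup>2 \<le> 1 / 2" "(- rho x)\<^sup>2 + (sqrt (1 - (rho x)\<^sup>2))\<^sup>2 = 1" "sqrt (1 - (rho x)\<^sup>2) \<noteq> 0"
proof -
  have x2: "x\<^sup>2 < 1" using x by (simp add: abs_square_less_1)
  have y2: "(2 * x - 1)\<^sup>2 \<le> 1" using x by (simp add: abs_square_le_1)
  have "(rho x)\<^sup>2 = (1 - (2 * x - 1)\<^sup>2) / (4 * (1 - x\<^sup>2))"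
    using x2 y2 by (simp add: rho_def power_divide power_mult_distrib)
  moreover have "1 - (2 * x - 1)\<^sup>2 \<le> 2 * (1 - x\<^sup>2)"
  proof -
    have "2 * (1 - x\<^sup>2) - (1 - (2 * x - 1)\<^sup>2) = 2 * (1 - x)\<^sup>2"
      by (simp add: power2_eq_square algebra_simps)
    then show ?thesis by (smt (verit) zero_le_power2)
  qed
  ultimately show r: "(rho x)\<^sup>2 \<le> 1 / 2" using x2 by (simp add: divide_le_eq)
  then show "(- rho x)\<^sup>2 + (sqrt (1 - (rho x)\<^sup>2))\<^sup>2 = 1" "sqrt (1 - (rho x)\<^sup>2) \<noteq> 0" by auto
qed

text \<open>The third entry of a triple at level \<open>k\<close> lies one level lower with the
  opposite sign, which chains the levels together.\<close>

lemma level_pred: "k \<ge> 1 \<Longrightarrow> 2 * level k - 1 = level (k - 1)"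
  by (cases k) (simp_all add: level_def)

text \<open>The threshold \<open>1 / 2 ^ 32\<close> is where the bound \<open>16 \<delta> powr (9/8)\<close>, which small set expansion
  gives for the next level, drops below \<open>\<delta>\<close>.\<close>

lemma small_set_step:
  fixes \<beta> \<delta> v X Y :: real
  assumes \<beta>: "\<beta> \<le> v + X + Y" and X: "X ^ 16 \<le> \<beta> ^ 8 * \<delta> ^ 9" and Y: "Y ^ 16 \<le> \<beta> ^ 8 * \<delta> ^ 9"
    and \<delta>: "0 \<le> \<delta>" "\<delta> \<le> 1 / 2 ^ 32" and v: "v \<le> 1 / 2 ^ 33"
  shows "\<beta> \<le> 1 / 2 ^ 32"
proof (rule ccontr)
  define q :: real where "q = 1 / 2 ^ 32"
  assume "\<not> \<beta> \<le> 1 / 2 ^ 32"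
  then have \<beta>q: "\<beta> > q" by (simp add: q_def)
  have q0: "q > 0" by (simp add: q_def)
  have "v \<le> q / 2" using v by (simp add: q_def)
  \<comment> \<open>The violations account for less than half of \<beta>, so one of the two
    correlation terms carries a quarter of it.\<close>
  then have "\<beta> / 4 \<le> X \<or> \<beta> / 4 \<le> Y" using \<beta> \<beta>q by linarith
  then have "(\<beta> / 4) ^ 16 \<le> \<beta> ^ 8 * \<delta> ^ 9"
  proof
    assume "\<beta> / 4 \<le> X"
    then have "(\<beta> / 4) ^ 16 \<le> X ^ 16" using \<beta>q q0 by (intro power_mono) auto
    then show ?thesis using X by (rule order_trans)
  next
    assume "\<beta> / 4 \<le> Y"
    then have "(\<beta> / 4) ^ 16 \<le> Y ^ 16" using \<beta>q q0 by (intro power_mono) auto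
    then show ?thesis using Y by (rule order_trans)
  qed
  also have "\<dots> \<le> \<beta> ^ 8 * q ^ 9"
    using \<delta> \<beta>q q0 by (intro mult_left_mono power_mono) (auto simp: q_def)
  finally have "\<beta> ^ 8 * \<beta> ^ 8 \<le> \<beta> ^ 8 * (2 ^ 32 * q ^ 9)"
    by (simp add: power_divide field_simps flip: power_add)
  \<comment> \<open>Here the threshold is fixed: 2^32 is the cost 4^16 of the factor 1/4, and the
    ninth power of \<delta> pays for it exactly when \<open>q\<close> is 2^-32.\<close>
  also have "2 ^ 32 * q ^ 9 = q ^ 8" by (simp add: q_def power_divide flip: power_mult power_add)
  finally have "\<beta> ^ 8 \<le> q ^ 8"
    by (rule mult_left_le_imp_le) (use \<beta>q q0 in simp)
  moreover have "q ^ 8 < \<beta> ^ 8" using \<beta>q q0 by (intro power_strict_mono) auto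
  ultimately show False by simp
qed

section \<open>The chain of levels for a fixed assignment\<close>

context
  fixes \<epsilon> :: real and k0 :: nat and P :: "'n::finite pt set set" and ctr :: "'n pt set \<Rightarrow> 'n pt" and far :: "'n pt"
    and f :: "'n pt \<Rightarrow> real"
  assumes P: "regions \<epsilon> P ctr" and f: "\<forall>c\<in>variables P ctr far. f c \<in> {-1, 1}"
begin

definition colour :: "'n pt \<Rightarrow> real" where
  "colour p = f (discretize P ctr far p)"

lemma colour_values: "colour p = -1 \<or> colour p = 1"
  using bspec[OF f discretize_in_variables[OF P, of far p]] by (simp add: colour_def)

text \<open>On the ball it is a finite combination of indicators of Borel regions, because exactly
  one region contains the point; outside it is constant.\<close>

lemma colour_measurable [measurable]: "colour \<in> borel_measurable borel"
proof -
  have fin: "finite P" and sets: "\<And>R. R \<in> P \<Longrightarrow> R \<in> sets borel" and part: "partition_on {p. norm p \<le> 2} P"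
    using P by (auto simp: regions_def)
  have "colour p = (if norm p \<le> 2 then (\<Sum>R\<in>P. f (ctr R) * indicator R p) else f far)" for p
  proof (cases "norm p \<le> 2")
    case True
    then have "p \<in> \<Union>P" using part by (simp add: partition_on_def)
    then obtain R where R: "R \<in> P" "p \<in> R" by (rule UnionE)
    have uniq: "R' = R" if "R' \<in> P" "p \<in> R'" for R'
    proof (rule ccontr)
      assume "R' \<noteq> R"
      then have "R' \<inter> R = {}"
        using part that(1) R(1) by (intro disjointD[of P]) (simp_all add: partition_on_def)
      then show False using that(2) R(2) by blast
    qed
    have "(THE R. R \<in> P \<and> p \<in> R) = R"
    proof (rule the_equality)
      show "R \<in> P \<and> p \<in> R" using R by simp
      show "R' = R" if "R' \<in> P \<and> p \<in> R'" for R' using uniq[of R'] that by simp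
    qed
    moreover have "(\<Sum>R'\<in>P. f (ctr R') * indicator R' p) = (\<Sum>R'\<in>P. if R' = R then f (ctr R) else 0)"
    proof (rule sum.cong[OF refl])
      fix R' assume R': "R' \<in> P"
      show "f (ctr R') * indicator R' p = (if R' = R then f (ctr R) else 0)"
      proof (cases "R' = R")
        case True
        then show ?thesis using R(2) by simp
      next
        case False
        then have "p \<notin> R'" using uniq[OF R'] by metis
        then show ?thesis using False by simp
      qed
    qed
    ultimately show ?thesis using True R fin by (simp add: colour_def discretize_def)
  qed (simp add: colour_def discretize_def)
  then have "colour = (\<lambda>p. if norm p \<le> 2 then (\<Sum>R\<in>P. f (ctr R) * indicator R p) else f far)" by blast
  moreover have "(\<lambda>p. if norm p \<le> 2 then (\<Sum>R\<in>P. f (ctr R) * indicator R p) else f far) \<in> borel_measurable borel"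
    using sets by measurable
  ultimately show ?thesis by simp
qed

definition violated :: "('n sample) set" where
  "violated = {smp. \<not> nae (triple_values f (constraint_triple P ctr far k0 smp))}"

text \<open>Indexing the sources by a sign lets the two mirror images of every argument be treated
  at once.\<close>

definition T_source :: "real \<Rightarrow> nat \<Rightarrow> source" where
  "T_source s k = (if s = 1 then T_pos k else T_neg k)"

definition A_source :: "real \<Rightarrow> source" where
  "A_source s = (if s = 1 then A_pos else A_neg)"

lemma violated_T:
  assumes "s = 1 \<or> s = -1"
  shows "(T_source s k, w, u) \<in> violated \<longleftrightarrow> (case T_vecs s (level k) w u of (p1, p2, p3) \<Rightarrow> colour p1 = colour p2 \<and> colour p2 = colour p3)"
proof -
  obtain p1 p2 p3 where T: "T_vecs s (level k) w u = (p1, p2, p3)" by (metis prod_cases3)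
  show ?thesis
    using assms T by (elim disjE) (simp_all add: violated_def T_source_def constraint_triple_def colour_def)
qed

lemma violated_A:
  assumes "s = 1 \<or> s = -1"
  shows "(A_source s, w, u) \<in> violated \<longleftrightarrow> colour (A_vec (s * level k0) w) = - s"
proof -
  have "triple_values f (constraint_triple P ctr far k0 (A_source s, w, u)) = (- s, - s, colour (A_vec (s * level k0) w))"
    using assms by (elim disjE) (simp_all add: A_source_def constraint_triple_def colour_def)
  then show ?thesis by (auto simp: violated_def)
qed

lemma source_cases:
  obtains s k where "s = 1 \<or> s = -1" "src = T_source s k" | s where "s = 1 \<or> s = -1" "src = A_source s"
proof (cases src)
  case (T_pos k)
  then show ?thesis using that(1)[of 1 k] by (simp add: T_source_def)
next
  case (T_neg k)
  then show ?thesis using that(1)[of "-1" k] by (simp add: T_source_def)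
next
  case A_pos
  then show ?thesis using that(2)[of 1] by (simp add: A_source_def)
next
  case A_neg
  then show ?thesis using that(2)[of "-1"] by (simp add: A_source_def)
qed

lemma countable_source: "countable (UNIV :: source set)"
proof -
  have "(UNIV :: source set) \<subseteq> range T_pos \<union> range T_neg \<union> {A_pos, A_neg}"
  proof
    fix src :: source show "src \<in> range T_pos \<union> range T_neg \<union> {A_pos, A_neg}" by (cases src) auto
  qed
  then show ?thesis by (rule countable_subset) auto
qed

lemma colour_A_vec_measurable:
  "(\<lambda>q. colour (A_vec y (a *\<^sub>R fst q + b *\<^sub>R snd q))) \<in> borel_measurable (gauss \<Otimes>\<^sub>M gauss)"
  "(\<lambda>q. colour (A_vec y (fst q))) \<in> borel_measurable (gauss \<Otimes>\<^sub>M (gauss :: (real ^ 'n) measure))"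
proof -
  have c: "(\<lambda>w. colour (A_vec y w)) \<in> borel_measurable borel"
    by (rule measurable_compose[OF A_vec_measurable colour_measurable])
  have "(\<lambda>q. a *\<^sub>R fst q + b *\<^sub>R snd q) \<in> borel_measurable (gauss \<Otimes>\<^sub>M (gauss :: (real ^ 'n) measure))"
    by measurable
  from measurable_compose[OF this c]
  show "(\<lambda>q. colour (A_vec y (a *\<^sub>R fst q + b *\<^sub>R snd q))) \<in> borel_measurable (gauss \<Otimes>\<^sub>M gauss)" .
  have "fst \<in> borel_measurable (gauss \<Otimes>\<^sub>M (gauss :: (real ^ 'n) measure))"
    by measurable
  from measurable_compose[OF this c]
  show "(\<lambda>q. colour (A_vec y (fst q))) \<in> borel_measurable (gauss \<Otimes>\<^sub>M (gauss :: (real ^ 'n) measure))" .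
qed

lemma violated_section: "{q. (src, q) \<in> violated} \<in> sets (gauss \<Otimes>\<^sub>M gauss)"
proof (cases src rule: source_cases)
  case (1 s k)
  let ?x = "level k"
  have "(src, q) \<in> violated \<longleftrightarrow>
      colour (A_vec (s * ?x) ((- rho ?x) *\<^sub>R fst q + sqrt (1 - (rho ?x)\<^sup>2) *\<^sub>R snd q)) =
      colour (A_vec (s * ?x) ((- rho ?x) *\<^sub>R fst q + (- sqrt (1 - (rho ?x)\<^sup>2)) *\<^sub>R snd q)) \<and>
      colour (A_vec (s * ?x) ((- rho ?x) *\<^sub>R fst q + (- sqrt (1 - (rho ?x)\<^sup>2)) *\<^sub>R snd q)) =
      colour (A_vec (- s * (2 * ?x - 1)) (fst q))" (is "_ \<longleftrightarrow> ?C q") for q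
    by (cases q) (simp only: 1(2) violated_T[OF 1(1)] T_vecs_eq[OF 1(1)] prod.case fst_conv snd_conv)
  then have "{q. (src, q) \<in> violated} = {q \<in> space (gauss \<Otimes>\<^sub>M gauss). ?C q}"
    by (simp add: space_pair_measure)
  also have "\<dots> \<in> sets (gauss \<Otimes>\<^sub>M gauss)" by (intro sets.sets_Collect_conj borel_measurable_eq colour_A_vec_measurable)
  finally show ?thesis .
next
  case (2 s)
  have "(src, q) \<in> violated \<longleftrightarrow> colour (A_vec (s * level k0) (fst q)) = - s" for q
    by (cases q) (simp only: 2(2) violated_A[OF 2(1)] fst_conv)
  then have "{q. (src, q) \<in> violated} = {q \<in> space (gauss \<Otimes>\<^sub>M gauss). colour (A_vec (s * level k0) (fst q)) = - s}"
    by (simp add: space_pair_measure)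
  also have "\<dots> \<in> sets (gauss \<Otimes>\<^sub>M gauss)" by (rule borel_measurable_eq[OF colour_A_vec_measurable(2) borel_measurable_const])
  finally show ?thesis .
qed

text \<open>There are countably many sources, so it suffices that each section is
  measurable.\<close>

lemma violated_sets: "violated \<in> sets (sampling k0)"
proof -
  have "violated = (\<Union>src\<in>UNIV. {src} \<times> {q. (src, q) \<in> violated})" by auto
  also have "\<dots> \<in> sets (sampling k0)"
  proof (rule sets.countable_UN'[OF countable_source])
    show "range (\<lambda>src. {src} \<times> {q. (src, q) \<in> violated}) \<subseteq> sets (sampling k0)"
      unfolding sampling_def using violated_section by (auto intro!: pair_measureI)
  qed
  finally show ?thesis .
qed

text \<open>A point on the side of \<open>s *\<^sub>R v0\<close> ought to receive the value
  \<open>s\<close> of that constant. The mean of this indicator is the quantity \<open>D s k\<close>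
  of the overview.\<close>

definition wrong :: "real \<Rightarrow> nat \<Rightarrow> real ^ 'n \<Rightarrow> real" where
  "wrong s k w = of_bool (colour (A_vec (s * level k) w) = - s)"

lemma wrong_measurable [measurable]: "wrong s k \<in> borel_measurable borel"
proof -
  have "{w \<in> space borel. colour (A_vec (s * level k) w) = - s} \<in> sets borel"
    by (rule borel_measurable_eq[OF measurable_compose[OF A_vec_measurable colour_measurable] borel_measurable_const])
  moreover have "wrong s k = indicator {w \<in> space borel. colour (A_vec (s * level k) w) = - s}"
    by (simp add: wrong_def indicator_def fun_eq_iff)
  ultimately show ?thesis by (simp only: borel_measurable_indicator)
qed

lemma wrong_01: "wrong s k w = 0 \<or> wrong s k w = 1"
  by (simp add: wrong_def)

definition wrong_prob :: "real \<Rightarrow> nat \<Rightarrow> real" where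
  "wrong_prob s k = (\<integral>w. wrong s k w \<partial>gauss)"

lemma wrong_unit: "gauss.unit_valued (wrong s k)"
  unfolding gauss.unit_valued_def by (intro conjI allI wrong_measurable) (simp_all add: wrong_def)

lemma integral_fst_gauss:
  fixes h :: "real ^ 'n \<Rightarrow> real"
  assumes h: "gauss.unit_valued h"
  shows "(\<integral>q. h (fst q) \<partial>(gauss \<Otimes>\<^sub>M (gauss :: (real ^ 'n) measure))) = (\<integral>w. h w \<partial>gauss)"
proof -
  have [measurable]: "h \<in> borel_measurable borel" and h01: "\<And>x. 0 \<le> h x \<and> h x \<le> 1"
    using h by (simp_all add: gauss.unit_valued_def)
  have "(\<lambda>q. h (fst q)) \<in> borel_measurable (borel \<Otimes>\<^sub>M (borel :: (real ^ 'n) measure))"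
    by measurable
  from gauss.integral_pair_unit_valued[OF this h01] show ?thesis by simp
qed

text \<open>The correlations of the third entry with the first and the second share \<open>c\<close>
  and differ in the sign of \<tau>, so \<open>gauss_corr_bound\<close> covers both and the threshold
  of \<open>small_set_step\<close> passes one level down, with the sign flipped.\<close>

lemma wrong_prob_step:
  assumes s: "s = 1 \<or> s = -1" and k: "1 \<le> k"
    and v: "measure (gauss \<Otimes>\<^sub>M gauss) {q. (T_source s k, q) \<in> violated} \<le> 1 / 2 ^ 33"
    and small: "wrong_prob s k \<le> 1 / 2 ^ 32"
  shows "wrong_prob (- s) (k - 1) \<le> 1 / 2 ^ 32"
proof -
  let ?G = "gauss \<Otimes>\<^sub>M gauss :: ((real ^ 'n) \<times> (real ^ 'n)) measure"
  define x where "x = level k"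
  have x: "1 / 2 \<le> x" "x < 1" using level_bounds(2)[of k] level_bounds(3)[OF k] by (simp_all add: x_def)
  define c \<tau> where "c = - rho x" and "\<tau> = sqrt (1 - (rho x)\<^sup>2)"
  have r: "c\<^sup>2 \<le> 1 / 2" "c\<^sup>2 + \<tau>\<^sup>2 = 1" "\<tau> \<noteq> 0" "c\<^sup>2 + (- \<tau>)\<^sup>2 = 1" "- \<tau> \<noteq> 0"
    using rho_bounds[OF x] by (auto simp: c_def \<tau>_def)
  let ?h = "wrong (- s) (k - 1)" and ?f = "wrong s k"
  let ?B = "{q. (T_source s k, q) \<in> violated}"
  have B [measurable]: "?B \<in> sets ?G" by (rule violated_section)
  \<comment> \<open>If the third entry has the value \<open>s\<close>, wrong for its side, then
    either one of the first two has the value \<open>- s\<close>, wrong for theirs, or all three are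
    equal to \<open>s\<close> and the constraint is violated.\<close>
  have point: "?h (fst q) \<le> indicator ?B q + ?h (fst q) * ?f (c *\<^sub>R fst q + \<tau> *\<^sub>R snd q) + ?h (fst q) * ?f (c *\<^sub>R fst q + (- \<tau>) *\<^sub>R snd q)" for q
  proof -
    obtain w u where q: "q = (w, u)" by (cases q)
    define p1 p2 p3 where "p1 = A_vec (s * x) (c *\<^sub>R w + \<tau> *\<^sub>R u)" and "p2 = A_vec (s * x) (c *\<^sub>R w + (- \<tau>) *\<^sub>R u)"
      and "p3 = A_vec (- s * level (k - 1)) w"
    have T: "T_vecs s (level k) w u = (p1, p2, p3)"
      unfolding T_vecs_eq[OF s] level_pred[OF k] by (simp add: p1_def p2_def p3_def x_def c_def \<tau>_def)
    have "indicator ?B q = (of_bool (colour p1 = colour p2 \<and> colour p2 = colour p3) :: real)"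
      by (simp add: q indicator_def violated_T[OF s] T)
    moreover have "?h (fst q) = of_bool (colour p3 = s)" "?f (c *\<^sub>R fst q + \<tau> *\<^sub>R snd q) = of_bool (colour p1 = - s)"
      "?f (c *\<^sub>R fst q + (- \<tau>) *\<^sub>R snd q) = of_bool (colour p2 = - s)"
      unfolding wrong_def p1_def p2_def p3_def x_def q by simp_all
    ultimately show ?thesis
      using s colour_values[of p1] colour_values[of p2] colour_values[of p3] by auto
  qed
  have iB: "integrable ?G (\<lambda>q. indicator ?B q :: real)"
    by (rule gauss.NN.integrable_unit_valued[OF borel_measurable_indicator[OF B]]) (simp add: indicator_def)
  have ic: "integrable ?G (\<lambda>q. ?h (fst q) * ?f (a *\<^sub>R fst q + b *\<^sub>R snd q))" for a b
    by (rule gauss.NN.integrable_unit_valued) (use wrong_unit in \<open>auto simp: gauss.unit_valued_def mult_le_one\<close>)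
  have ih: "integrable ?G (\<lambda>q. ?h (fst q))"
    by (rule gauss.NN.integrable_unit_valued) (use wrong_unit in \<open>auto simp: gauss.unit_valued_def\<close>)
  have "wrong_prob (- s) (k - 1) = (\<integral>q. ?h (fst q) \<partial>?G)"
    by (simp add: wrong_prob_def integral_fst_gauss[OF wrong_unit])
  also have "\<dots> \<le> (\<integral>q. indicator ?B q + ?h (fst q) * ?f (c *\<^sub>R fst q + \<tau> *\<^sub>R snd q) + ?h (fst q) * ?f (c *\<^sub>R fst q + (- \<tau>) *\<^sub>R snd q) \<partial>?G)"
    by (rule integral_mono[OF ih _ point]) (intro Bochner_Integration.integrable_add iB ic)
  also have "\<dots> = measure ?G ?B + gauss.corr c \<tau> ?h ?f + gauss.corr c (- \<tau>) ?h ?f"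
    using iB ic[of c \<tau>] ic[of c "- \<tau>"] by (simp add: gauss.corr_def space_pair_measure del: scaleR_minus_left)
  finally have *: "wrong_prob (- s) (k - 1) \<le> measure ?G ?B + gauss.corr c \<tau> ?h ?f + gauss.corr c (- \<tau>) ?h ?f" .
  note cb = gauss_corr_bound[OF wrong_measurable wrong_01 wrong_measurable wrong_01, folded wrong_prob_def]
  show ?thesis
  proof (rule small_set_step[OF * _ _ _ small v])
    show "gauss.corr c \<tau> ?h ?f ^ 16 \<le> wrong_prob (- s) (k - 1) ^ 8 * wrong_prob s k ^ 9"
      by (rule cb[OF r(2,3,1)])
    show "gauss.corr c (- \<tau>) ?h ?f ^ 16 \<le> wrong_prob (- s) (k - 1) ^ 8 * wrong_prob s k ^ 9"
      by (rule cb[OF r(4,5,1)])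
    show "0 \<le> wrong_prob s k"
      unfolding wrong_prob_def by (rule integral_nonneg_AE) (simp add: wrong_def)
  qed
qed

text \<open>Both constants of the boundary triple have the value \<open>- s\<close>, so it is
  violated exactly when its sampled vector gets that value too.\<close>

lemma wrong_prob_base:
  assumes s: "s = 1 \<or> s = -1"
  shows "wrong_prob s k0 = measure (gauss \<Otimes>\<^sub>M gauss) {q. (A_source s, q) \<in> violated}"
proof -
  let ?B = "{q. (A_source s, q) \<in> violated}"
  have "indicator ?B q = wrong s k0 (fst q)" for q
    using violated_A[OF s] by (cases q) (auto simp: indicator_def wrong_def)
  then have "(\<integral>q. indicator ?B q \<partial>(gauss \<Otimes>\<^sub>M gauss)) = (\<integral>q. wrong s k0 (fst q) \<partial>(gauss \<Otimes>\<^sub>M (gauss :: (real ^ 'n) measure)))"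
    by simp
  also have "\<dots> = wrong_prob s k0" by (simp add: integral_fst_gauss[OF wrong_unit] wrong_prob_def)
  finally show ?thesis using violated_section[of "A_source s"] by simp
qed

text \<open>At level 0 the two signs describe the same vector, orthogonal to \<open>v0\<close>, and
  its value is wrong for exactly one of them.\<close>

lemma wrong_prob_0: "wrong_prob 1 0 + wrong_prob (-1) 0 = 1"
proof -
  have "wrong 1 0 w + wrong (-1) 0 w = 1" for w
    using colour_values[of "A_vec 0 w"] by (auto simp: wrong_def level_def)
  then have "(\<integral>w. wrong 1 0 w + wrong (-1) 0 w \<partial>gauss) = 1" by simp
  moreover have "integrable gauss (wrong s 0)" for s
    by (rule gauss.N.integrable_unit_valued) (use wrong_unit in \<open>auto simp: gauss.unit_valued_def\<close>)
  ultimately show ?thesis by (simp add: wrong_prob_def)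
qed

text \<open>The 34th power of 2 consists of half the threshold 2^-32, which
  \<open>small_set_step\<close> allows to the violations, and the 2 in the number of
  sources.\<close>

lemma violated_probability: "measure (sampling k0) violated > 1 / (2 ^ 34 * (real k0 + 1))"
proof (rule ccontr)
  assume "\<not> ?thesis"
  then have p: "2 * (real k0 + 1) * measure (sampling k0) violated \<le> 1 / 2 ^ 33"
    by (simp add: not_less field_simps)
  have v: "measure (gauss \<Otimes>\<^sub>M gauss) {q. (src, q) \<in> violated} \<le> 1 / 2 ^ 33" if "src \<in> sources k0" for src
    using measure_sampling_ge[OF that violated_section violated_sets, of src] p by simp
  have A: "A_source s \<in> sources k0" for s by (auto simp: A_source_def sources_def)
  have T: "T_source s k \<in> sources k0" if "1 \<le> k" "k \<le> k0" for s k
    using that by (auto simp: T_source_def sources_def)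
  \<comment> \<open>Induction from the boundary level downwards. Both signs are carried together,
    since each step exchanges them.\<close>
  have "\<forall>s. s = 1 \<or> s = -1 \<longrightarrow> wrong_prob s (k0 - j) \<le> 1 / 2 ^ 32" if "j \<le> k0" for j
    using that
  proof (induction j)
    case 0
    show ?case
    proof (intro allI impI)
      fix s :: real assume s: "s = 1 \<or> s = -1"
      show "wrong_prob s (k0 - 0) \<le> 1 / 2 ^ 32"
        using wrong_prob_base[OF s] v[OF A[of s]] by simp
    qed
  next
    case (Suc j)
    show ?case
    proof (intro allI impI)
      fix s :: real assume s: "s = 1 \<or> s = -1"
      then have s': "- s = 1 \<or> - s = -1" by auto
      have k: "1 \<le> k0 - j" "k0 - j \<le> k0" using Suc.prems by auto
      have "wrong_prob (- s) (k0 - j) \<le> 1 / 2 ^ 32" using Suc.IH[OF Suc_leD[OF Suc.prems]] s' by blast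
      from wrong_prob_step[OF s' k(1) v[OF T[OF k]] this]
      show "wrong_prob s (k0 - Suc j) \<le> 1 / 2 ^ 32" by simp
    qed
  qed
  from this[of k0] have "wrong_prob 1 0 \<le> 1 / 2 ^ 32" "wrong_prob (-1) 0 \<le> 1 / 2 ^ 32" by auto
  then show False using wrong_prob_0 by simp
qed

lemma nae_violation_probability:
  "1 / (2 ^ 34 * (real k0 + 1)) <
    measure (sampling k0) {smp. \<not> nae (triple_values f (constraint_triple P ctr far k0 smp))}"
  using violated_probability by (simp only: violated_def)

end

lemma violation_bound:
  fixes \<epsilon> :: real
  assumes \<epsilon>: "\<epsilon> > 0" and k0: "k0 = nat (\<lceil>log 2 (1 / \<epsilon>)\<rceil> + 20)"
  shows "1 / (10 ^ 60 * real_of_int \<lceil>log 2 (1 / \<epsilon>)\<rceil>) \<le> 1 / (2 ^ 34 * (real k0 + 1))"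
proof (cases "\<epsilon> < 1")
  case True
  define L where "L = real_of_int \<lceil>log 2 (1 / \<epsilon>)\<rceil>"
  have L: "L \<ge> 1" "real k0 = L + 20" using level_k0[OF \<epsilon> True k0] by (simp_all add: L_def)
  \<comment> \<open>\<open>real k0 + 1\<close> is \<open>L + 21\<close>, at most
    \<open>22 * L\<close> because \<open>L\<close> is at least 1; the constant 10^60 leaves ample
    room.\<close>
  then have "2 ^ 34 * (real k0 + 1) \<le> 2 ^ 34 * (22 * L)" by (intro mult_left_mono) auto
  also have "\<dots> \<le> 10 ^ 60 * L" using L by simp
  finally show ?thesis
    using L unfolding L_def[symmetric] by (intro divide_left_mono) auto
next
  case False
  then have "log 2 (1 / \<epsilon>) \<le> 0" using \<epsilon> by (simp add: field_simps)
  then have "\<lceil>log 2 (1 / \<epsilon>)\<rceil> \<le> 0" by (simp add: ceiling_le_iff)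
  \<comment> \<open>For \<epsilon> \<ge> 1 the ceiling is at most 0, and when it is 0 the quotient
    is 0 by the convention for division.\<close>
  then have "1 / (10 ^ 60 * real_of_int \<lceil>log 2 (1 / \<epsilon>)\<rceil>) \<le> 0"
    by (simp add: divide_le_0_iff mult_le_0_iff)
  also have "0 \<le> 1 / (2 ^ 34 * (real k0 + 1))" by simp
  finally show ?thesis .
qed

theorem theorem3p7:
  fixes \<epsilon> :: real
    and k0 :: nat
    and P :: "'n::finite pt set set"
    and ctr :: "'n pt set \<Rightarrow> 'n pt"
    and far :: "'n pt"
  assumes "\<epsilon> > 0"
    and "k0 = nat (\<lceil>log 2 (1 / \<epsilon>)\<rceil> + 20)"
    and "real CARD('n) \<ge> 80000000 / \<epsilon> ^ 3"
    and "regions \<epsilon> P ctr"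
  shows "(\<exists>N z V. sdp_vectors N z V (variables P ctr far) \<and>
            (\<forall>src\<in>sources k0. \<forall>w u :: real ^ 'n. \<not> discarded \<epsilon> (src, w, u) \<longrightarrow>
               sdp_value_ge N z V (literal_sign src)
                 (constraint_triple P ctr far k0 (src, w, u)) (1 - \<epsilon>)))
       \<and> \<P>(smp in (sampling k0 :: 'n sample measure). discarded \<epsilon> smp) \<le> 6 * exp (- 10 / \<epsilon>)
       \<and> (\<forall>f. (\<forall>c\<in>variables P ctr far. f c \<in> {-1, 1}) \<longrightarrow>
            \<P>(smp in sampling k0. \<not> nae (triple_values f (constraint_triple P ctr far k0 smp)))
              \<ge> 1 / (10 ^ 60 * real_of_int \<lceil>log 2 (1 / \<epsilon>)\<rceil>))"
proof (intro conjI allI impI)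
  show "\<exists>N z V. sdp_vectors N z V (variables P ctr far) \<and>
      (\<forall>src\<in>sources k0. \<forall>w u :: real ^ 'n. \<not> discarded \<epsilon> (src, w, u) \<longrightarrow>
         sdp_value_ge N z V (literal_sign src) (constraint_triple P ctr far k0 (src, w, u)) (1 - \<epsilon>))"
    using assms(1,2,4) by (rule sdp_solution)
  show "\<P>(smp in (sampling k0 :: 'n sample measure). discarded \<epsilon> smp) \<le> 6 * exp (- 10 / \<epsilon>)"
    using assms(1,3) by (rule discard_probability)
next
  fix f :: "'n pt \<Rightarrow> real" assume f: "\<forall>c\<in>variables P ctr far. f c \<in> {-1, 1}"
  have "space (sampling k0 :: 'n sample measure) = UNIV"
    by (simp add: sampling_def space_pair_measure)
  then show "\<P>(smp in sampling k0. \<not> nae (triple_values f (constraint_triple P ctr far k0 smp)))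
      \<ge> 1 / (10 ^ 60 * real_of_int \<lceil>log 2 (1 / \<epsilon>)\<rceil>)"
    using violation_bound[OF assms(1,2)] nae_violation_probability[OF assms(4) f, of k0] by simp
qed

end
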